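(* Let $\mathcal{B}\subset\Sigma_{2\times 2}(2)$ and write $$\mathcal{B}=C_{1}\cup C_{2}\cup\cdots\cup C_{k}\cup N,$$ where $k\ge 0$, $C_{1},\dots,C_{k}$ are different minimal cycle generators, $N\subset\Sigma_{2\times2}(2)$, and $\mathcal{B}$ contains no minimal cycle generator except those contained in $C_{1}\cup\cdots\cup C_{k}$. Then $$h(\mathcal{B})>0 \quad\text{if and only if}\quad h(C_{1}\cup C_{2}\cup\cdots\cup C_{k})>0.$$ Furthermore, among the equivalence classes $[\mathcal{A}]$ of those sets $\mathcal{A}\subset\Sigma_{2\times2}(2)$ that can be written as $\mathcal{A}=C_1\cup\cdots\cup C_k$ for some $1\le k\le 5$ and some different minimal cycle generators $C_1,\dots,C_k$, exactly $1187$ equivalence classes have positive entropy and exactly $31$ equivalence classes have zero entropy.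
   Context: A Wang tile with two symbols is a unit square with colored edges, identified with the quadruple $B=(b(B),l(B),t(B),r(B))\in\{0,1\}^4$ of the colors of its bottom, left, top and right edges. $\Sigma_{2\times 2}(2)$ is the set of all 16 such tiles. For $\mathcal{B}\subset\Sigma_{2\times2}(2)$ and $m,n\ge 2$, $\Sigma_{m\times n}(\mathcal{B})$ is the set of all $\mathcal{B}$-admissible patterns on the lattice $\mathbb{Z}_{m\times n}=\{(i,j):0\le i\le m-1,\,0\le j\le n-1\}$, i.e. all arrays $(T_{i,j})_{0\le i\le m-2,\,0\le j\le n-2}$ of tiles of $\mathcal{B}$ with $r(T_{i,j})=l(T_{i+1,j})$ and $t(T_{i,j})=b(T_{i,j+1})$ whenever both tiles are in the array (tiles may not be rotated or reflected). Let $\Gamma_{m\times n}(\mathcal{B})=|\Sigma_{m\times n}(\mathcal{B})|$. The spatial entropy is $h(\mathcal{B})=\lim_{m,n\to\infty}\frac{\log\Gamma_{m\times n}(\mathcal{B})}{mn}$, with the convention $h(\mathcal{B})=0$ if $\Gamma_{m\times n}(\mathcal{B})=0$ for some $m,n$. $\mathcal{P}(\mathcal{B})$ is the set of all periodic patterns on $\mathbb{Z}^2$ generated by $\mathcal{B}$, i.e. arrays $(T_{i,j})_{(i,j)\in\mathbb{Z}^2}$ of tiles of $\mathcal{B}$ satisfying the same matching conditions for which there are $p,q\ge1$ with $T_{i+p,j}=T_{i,j}=T_{i,j+q}$ for all $i,j$. A set $C\subset\Sigma_{2\times2}(2)$ is a minimal cycle generator if $\mathcal{P}(C)\ne\emptyset$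 and $\mathcal{P}(C')=\emptyset$ for every $C'\subsetneq C$. Equivalence: the dihedral group $D_4$ of order 8 (symmetries of the unit square) acts on tiles by rotating/reflecting the colored square; a permutation $\eta_h\in S_2$ of $\{0,1\}$ acts by permuting the colors of horizontal (bottom and top) edges, and $\eta_v\in S_2$ by permuting the colors of vertical (left and right) edges. The equivalence class $[\mathcal{B}]$ is the set of all $\mathcal{B}'=(((\mathcal{B})_{\tau})_{\eta_h})_{\eta_v}$ with $\tau\in D_4$, $\eta_h,\eta_v\in S_2$. The entropy $h$ is constant on each equivalence class. *)

theory Defs
  imports Complex_Main "HOL-Library.FuncSet"
begin

text \<open>The colors 0 and 1 are \<^const>\<open>False\<close> and \<^const>\<open>True\<close>; a tile is the quadruple
  (bottom, left, top, right), so the full set of 16 tiles is the whole type.\<close>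

type_synonym tile = "bool \<times> bool \<times> bool \<times> bool"

fun bottom_col :: "tile \<Rightarrow> bool" where "bottom_col (b, l, t, r) = b"
fun left_col :: "tile \<Rightarrow> bool" where "left_col (b, l, t, r) = l"
fun top_col :: "tile \<Rightarrow> bool" where "top_col (b, l, t, r) = t"
fun right_col :: "tile \<Rightarrow> bool" where "right_col (b, l, t, r) = r"

text \<open>Admissible patterns on the $m \times n$ vertex lattice, given by arrays of
  $(m-1) \times (n-1)$ tiles; meant for $m, n \ge 2$.  The arrays are extensional functions,
  so that distinct functions are distinct patterns.\<close>

definition patterns :: "nat \<Rightarrow> nat \<Rightarrow> tile set \<Rightarrow> (nat \<times> nat \<Rightarrow> tile) set" where
  "patterns m n B = {T \<in> ({..<m - 1} \<times> {..<n - 1}) \<rightarrow>\<^sub>E B.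
     (\<forall>i j. i + 1 < m - 1 \<and> j < n - 1 \<longrightarrow> right_col (T (i, j)) = left_col (T (i + 1, j))) \<and>
     (\<forall>i j. i < m - 1 \<and> j + 1 < n - 1 \<longrightarrow> top_col (T (i, j)) = bottom_col (T (i, j + 1)))}"

definition num_patterns :: "nat \<Rightarrow> nat \<Rightarrow> tile set \<Rightarrow> nat" where
  "num_patterns m n B = card (patterns m n B)"

text \<open>The limit is the double limit, with $m$ and $n$ tending to infinity independently; in the
  second case of the definition it exists by subadditivity of $\log\Gamma_{m\times n}$.\<close>

definition entropy :: "tile set \<Rightarrow> real" where
  "entropy B =
     (if \<exists>m\<ge>2. \<exists>n\<ge>2. num_patterns m n B = 0 then 0
      else Lim (sequentially \<times>\<^sub>F sequentially)
             (\<lambda>(m, n). ln (real (num_patterns m n B)) / (real m * real n)))"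

definition periodic_patterns :: "tile set \<Rightarrow> (int \<times> int \<Rightarrow> tile) set" where
  "periodic_patterns B = {T.
     (\<forall>i j. T (i, j) \<in> B) \<and>
     (\<forall>i j. right_col (T (i, j)) = left_col (T (i + 1, j))) \<and>
     (\<forall>i j. top_col (T (i, j)) = bottom_col (T (i, j + 1))) \<and>
     (\<exists>p\<ge>1. \<exists>q\<ge>1. \<forall>i j. T (i + p, j) = T (i, j) \<and> T (i, j + q) = T (i, j))}"

definition min_cycle_gen :: "tile set \<Rightarrow> bool" where
  "min_cycle_gen C \<longleftrightarrow>
     periodic_patterns C \<noteq> {} \<and> (\<forall>C'. C' \<subset> C \<longrightarrow> periodic_patterns C' = {})"

text \<open>Rotation of the colored square by a quarter turn counterclockwise (the old left edge becomes
  the new bottom edge, the old top edge the new left edge, and so on), and reflection in the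
  vertical axis.  Together they generate the symmetry group of the square.\<close>

fun rotate_tile :: "tile \<Rightarrow> tile" where "rotate_tile (b, l, t, r) = (l, t, r, b)"
fun reflect_tile :: "tile \<Rightarrow> tile" where "reflect_tile (b, l, t, r) = (b, r, t, l)"

definition D4 :: "(tile \<Rightarrow> tile) set" where
  "D4 = {(rotate_tile ^^ k) \<circ> (reflect_tile ^^ e) | k e. k < 4 \<and> e < 2}"

fun permute_h :: "(bool \<Rightarrow> bool) \<Rightarrow> tile \<Rightarrow> tile" where
  "permute_h \<eta> (b, l, t, r) = (\<eta> b, l, \<eta> t, r)"

fun permute_v :: "(bool \<Rightarrow> bool) \<Rightarrow> tile \<Rightarrow> tile" where
  "permute_v \<eta> (b, l, t, r) = (b, \<eta> l, t, \<eta> r)"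

definition equiv_class :: "tile set \<Rightarrow> tile set set" where
  "equiv_class B = {permute_v \<eta>v ` permute_h \<eta>h ` \<tau> ` B | \<tau> \<eta>h \<eta>v. \<tau> \<in> D4 \<and> bij \<eta>h \<and> bij \<eta>v}"

definition different_min_cycle_gens :: "nat \<Rightarrow> (nat \<Rightarrow> tile set) \<Rightarrow> bool" where
  "different_min_cycle_gens k C \<longleftrightarrow>
     inj_on C {1..k} \<and> (\<forall>i\<in>{1..k}. min_cycle_gen (C i))"

definition unions_upto_5 :: "tile set set" where
  "unions_upto_5 =
     {\<Union>i\<in>{1..k}. C i | k C. 1 \<le> k \<and> k \<le> 5 \<and> different_min_cycle_gens k C}"

end

theory Submission
  imports Defs
begin

text \<open>The logarithm of the number of patterns is subadditive in both directions, so the entropy is a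
  limit. It is positive as soon as there are two different blocks with the same periodic border,
  because such blocks can be placed independently of each other.

  For weights $\alpha, \beta$ with $\alpha (t - b) + \beta (r - l) \ge 0$ on all tiles of $B$, the sum of
  these numbers over an $n \times n$ pattern telescopes to a boundary term, so only $O(n)$ tiles make
  a nonzero contribution. If the other tiles are determined by their bottom and left colors, then
  a pattern is determined by $O(n)$ of its tiles, there are only $\exp(O(n \log n))$ patterns and the
  entropy vanishes. On a torus the sum is zero, which identifies the minimal cycle generators as
  the minimal tile sets whose vectors $(t - b, r - l)$ have zero in their convex hull.

  A search through the lexicographically greatest representatives of the orbits of the symmetry
  group (of order 32) shows that every tile set is, up to symmetry, contained in a set whose
  entropy vanishes for this reason or in one exceptional set of zero entropy, or contains two
  blocks as above whose tiles form a union of minimal cycle generators. The first claim follows,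
  and the search also counts the unions of at most five minimal cycle generators.\<close>

section \<open>Entropy as a limit\<close>

text \<open>Zero entropy passes to subsets and positive entropy to supersets. It is therefore enough
  to give large sets of the first kind and small sets of the second, and to check that every
  canonical set lies below one of the former or above one of the latter. The vectors (t - b, r - l)
  take all nine values in {-1, 0, 1}^2: the value zero on four tiles, each diagonal value on one
  tile, each remaining value on two. A minimal set with zero in its convex hull is thus one of 4
  single tiles, 10 opposite pairs or 24 triangles. A zero sum alone does not produce a tiling, so
  for each of these 38 sets a periodic block is exhibited. Asking that a positive certificate be a
  union of minimal cycle generators costs nothing in the search but is what links B to its
  generators: the blocks that give B positive entropy use only tiles of generators contained in
  B.\<close>

definition rect :: "nat \<Rightarrow> nat \<Rightarrow> tile set \<Rightarrow> (nat \<times> nat \<Rightarrow> tile) set" where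
  "rect a b B = {T \<in> ({..<a} \<times> {..<b}) \<rightarrow>\<^sub>E B.
     (\<forall>i j. Suc i < a \<longrightarrow> j < b \<longrightarrow> right_col (T (i, j)) = left_col (T (Suc i, j))) \<and>
     (\<forall>i j. i < a \<longrightarrow> Suc j < b \<longrightarrow> top_col (T (i, j)) = bottom_col (T (i, Suc j)))}"

text \<open>Counting tiles instead of lattice points makes sizes add exactly when rectangles are
  glued. The shift by 1 is paid only once, in the limit.\<close>

lemma num_patterns_eq_rect: "num_patterns m n B = card (rect (m - 1) (n - 1) B)"
  unfolding num_patterns_def patterns_def rect_def by (intro arg_cong[where f = card]) auto

lemma rectI:
  assumes "\<And>i j. i < a \<Longrightarrow> j < b \<Longrightarrow> T (i, j) \<in> B"
    and "\<And>p. p \<notin> {..<a} \<times> {..<b} \<Longrightarrow> T p = undefined"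
    and "\<And>i j. Suc i < a \<Longrightarrow> j < b \<Longrightarrow> right_col (T (i, j)) = left_col (T (Suc i, j))"
    and "\<And>i j. i < a \<Longrightarrow> Suc j < b \<Longrightarrow> top_col (T (i, j)) = bottom_col (T (i, Suc j))"
  shows "T \<in> rect a b B"
  using assms unfolding rect_def by (auto simp: PiE_iff extensional_def)

lemma rectD:
  assumes "T \<in> rect a b B"
  shows "\<And>i j. i < a \<Longrightarrow> j < b \<Longrightarrow> T (i, j) \<in> B"
    and "\<And>p. p \<notin> {..<a} \<times> {..<b} \<Longrightarrow> T p = undefined"
    and "\<And>i j. Suc i < a \<Longrightarrow> j < b \<Longrightarrow> right_col (T (i, j)) = left_col (T (Suc i, j))"
    and "\<And>i j. i < a \<Longrightarrow> Suc j < b \<Longrightarrow> top_col (T (i, j)) = bottom_col (T (i, Suc j))"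
  using assms unfolding rect_def by (auto simp: PiE_iff extensional_def)

lemma rect_eqI:
  assumes "T \<in> rect a b B" "T' \<in> rect a b B'"
    and "\<And>i j. i < a \<Longrightarrow> j < b \<Longrightarrow> T (i, j) = T' (i, j)"
  shows "T = T'"
proof
  fix p
  show "T p = T' p"
    using assms(3) rectD(2)[OF assms(1)] rectD(2)[OF assms(2)]
    by (cases "p \<in> {..<a} \<times> {..<b}") auto
qed

lemma finite_rect [simp]: "finite (rect a b B)"
  by (rule finite_subset[OF _ finite_PiE[of "{..<a} \<times> {..<b}" "\<lambda>_. B"]]) (auto simp: rect_def)

lemma rect_mono: "B \<subseteq> B' \<Longrightarrow> rect a b B \<subseteq> rect a b B'"
  unfolding rect_def by (auto simp: PiE_iff)

lemma rect_0 [simp]: "rect 0 b B = {\<lambda>_. undefined}" "rect a 0 B = {\<lambda>_. undefined}"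
  by (auto simp: rect_def)

text \<open>A pattern can be recovered from its transform because \<phi> reaches every cell and g is
  injective. The reverse inequalities below come from applying the same transform again, as it has
  finite order on tile sets.\<close>

lemma card_rect_image_le:
  assumes "inj g"
    and cover: "\<And>i j. i < a \<Longrightarrow> j < b \<Longrightarrow> (i, j) \<in> \<phi> ` ({..<a'} \<times> {..<b'})"
    and into: "\<And>T. T \<in> rect a b B \<Longrightarrow>
      restrict (\<lambda>p. g (T (\<phi> p))) ({..<a'} \<times> {..<b'}) \<in> rect a' b' (g ` B)"
  shows "card (rect a b B) \<le> card (rect a' b' (g ` B))"
proof (rule card_inj_on_le)
  let ?h = "\<lambda>T. restrict (\<lambda>p. g (T (\<phi> p))) ({..<a'} \<times> {..<b'})"
  show "?h ` rect a b B \<subseteq> rect a' b' (g ` B)" using into by blast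
  show "inj_on ?h (rect a b B)"
  proof (rule inj_onI)
    fix T T' assume T: "T \<in> rect a b B" "T' \<in> rect a b B" and eq: "?h T = ?h T'"
    show "T = T'"
    proof (rule rect_eqI[OF T])
      fix i j assume "i < a" "j < b"
      then obtain p where p: "p \<in> {..<a'} \<times> {..<b'}" "(i, j) = \<phi> p" using cover by blast
      have "?h T p = ?h T' p" using eq by simp
      then show "T (i, j) = T' (i, j)" using p assms(1) by (simp add: inj_eq)
    qed
  qed
qed simp

section \<open>Pattern counts under the symmetries\<close>

lemma col_simps [simp]:
  "bottom_col (rotate_tile x) = left_col x" "left_col (rotate_tile x) = top_col x"
  "top_col (rotate_tile x) = right_col x" "right_col (rotate_tile x) = bottom_col x"
  "bottom_col (reflect_tile x) = bottom_col x" "left_col (reflect_tile x) = right_col x"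
  "top_col (reflect_tile x) = top_col x" "right_col (reflect_tile x) = left_col x"
  "bottom_col (permute_h \<eta> x) = \<eta> (bottom_col x)" "left_col (permute_h \<eta> x) = left_col x"
  "top_col (permute_h \<eta> x) = \<eta> (top_col x)" "right_col (permute_h \<eta> x) = right_col x"
  "bottom_col (permute_v \<eta> x) = bottom_col x" "left_col (permute_v \<eta> x) = \<eta> (left_col x)"
  "top_col (permute_v \<eta> x) = top_col x" "right_col (permute_v \<eta> x) = \<eta> (right_col x)"
  by (cases x; simp)+

lemma inj_rotate_tile: "inj rotate_tile" and inj_reflect_tile: "inj reflect_tile"
  by (auto simp: inj_def)

lemma inj_permute: "bij \<eta> \<Longrightarrow> inj (permute_h \<eta>)" "bij \<eta> \<Longrightarrow> inj (permute_v \<eta>)"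
  by (auto simp: inj_def bij_def)

lemma rotate_tile_4: "rotate_tile ` rotate_tile ` rotate_tile ` rotate_tile ` B = B"
  by (force simp: image_iff)

lemma reflect_tile_2: "reflect_tile ` reflect_tile ` B = B"
  by (force simp: image_iff)

lemma bij_bool_invol:
  assumes "bij (\<eta> :: bool \<Rightarrow> bool)" shows "\<eta> (\<eta> x) = x"
proof -
  have "\<eta> True \<noteq> \<eta> False" using assms by (auto simp: bij_def inj_def)
  then show ?thesis by (cases x; cases "\<eta> True"; cases "\<eta> False") auto
qed

lemma permute_2:
  assumes "bij \<eta>"
  shows "permute_h \<eta> ` permute_h \<eta> ` B = B" "permute_v \<eta> ` permute_v \<eta> ` B = B"
  by (force simp: image_iff bij_bool_invol[OF assms])+

lemma card_rect_rotate_le: "card (rect a b B) \<le> card (rect b a (rotate_tile ` B))"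
\<comment> \<open>A quarter turn moves the cell (x, y) to (b - 1 - y, x); \<phi> is the inverse map,
  from new cells to old ones.\<close>
proof (rule card_rect_image_le[where \<phi> = "\<lambda>(i, j). (j, b - 1 - i)", OF inj_rotate_tile])
  fix i j assume "i < a" "j < b"
  then show "(i, j) \<in> (\<lambda>(i, j). (j, b - 1 - i)) ` ({..<b} \<times> {..<a})"
    by (auto simp: image_iff intro!: bexI[of _ "b - 1 - j"])
next
  fix T assume T: "T \<in> rect a b B"
  note D = rectD[OF T]
  show "restrict (\<lambda>p. rotate_tile (T (case p of (i, j) \<Rightarrow> (j, b - 1 - i)))) ({..<b} \<times> {..<a})
    \<in> rect b a (rotate_tile ` B)"
  proof (rule rectI, goal_cases)
    case (1 i j)
    then show ?case using D(1)[of j "b - 1 - i"] by auto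
  next
    case (3 i j)
    then have "Suc (b - 1 - Suc i) = b - 1 - i" by auto
    with D(4)[of j "b - 1 - Suc i"] 3 show ?case by auto
  next
    case (4 i j)
    with D(3)[of j "b - 1 - i"] show ?case by auto
  qed auto
qed

lemma card_rect_rotate: "card (rect b a (rotate_tile ` B)) = card (rect a b B)"
proof (rule antisym)
  show "card (rect a b B) \<le> card (rect b a (rotate_tile ` B))"
    by (rule card_rect_rotate_le)
  have "card (rect b a (rotate_tile ` B)) \<le> card (rect a b (rotate_tile ` rotate_tile ` B))"
    by (rule card_rect_rotate_le)
  also have "\<dots> \<le> card (rect b a (rotate_tile ` rotate_tile ` rotate_tile ` B))"
    by (rule card_rect_rotate_le)
  also have "\<dots> \<le> card (rect a b (rotate_tile ` rotate_tile ` rotate_tile ` rotate_tile ` B))"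
    by (rule card_rect_rotate_le)
  finally show "card (rect b a (rotate_tile ` B)) \<le> card (rect a b B)"
    by (simp only: rotate_tile_4)
qed

lemma card_rect_reflect_le: "card (rect a b B) \<le> card (rect a b (reflect_tile ` B))"
proof (rule card_rect_image_le[where \<phi> = "\<lambda>(i, j). (a - 1 - i, j)", OF inj_reflect_tile])
  fix i j assume "i < a" "j < b"
  then show "(i, j) \<in> (\<lambda>(i, j). (a - 1 - i, j)) ` ({..<a} \<times> {..<b})"
    by (auto simp: image_iff intro!: bexI[of _ "a - 1 - i"])
next
  fix T assume T: "T \<in> rect a b B"
  note D = rectD[OF T]
  show "restrict (\<lambda>p. reflect_tile (T (case p of (i, j) \<Rightarrow> (a - 1 - i, j)))) ({..<a} \<times> {..<b})
    \<in> rect a b (reflect_tile ` B)"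
  proof (rule rectI, goal_cases)
    case (1 i j)
    then show ?case using D(1)[of "a - 1 - i" j] by auto
  next
    case (3 i j)
    then have "Suc (a - 1 - Suc i) = a - 1 - i" by auto
    with D(3)[of "a - 1 - Suc i" j] 3 show ?case by auto
  next
    case (4 i j)
    with D(4)[of "a - 1 - i" j] show ?case by auto
  qed auto
qed

lemma card_rect_reflect: "card (rect a b (reflect_tile ` B)) = card (rect a b B)"
  using card_rect_reflect_le[of a b B] card_rect_reflect_le[of a b "reflect_tile ` B"]
  by (simp add: reflect_tile_2)

lemma card_rect_permute_h:
  assumes "bij \<eta>" shows "card (rect a b (permute_h \<eta> ` B)) = card (rect a b B)"
proof -
  have "card (rect a b B) \<le> card (rect a b (permute_h \<eta> ` B))" for B
  proof (rule card_rect_image_le[where \<phi> = "\<lambda>p. p", OF inj_permute(1)[OF assms]])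
    fix T assume T: "T \<in> rect a b B"
    note D = rectD[OF T]
    show "restrict (\<lambda>p. permute_h \<eta> (T p)) ({..<a} \<times> {..<b}) \<in> rect a b (permute_h \<eta> ` B)"
      by (rule rectI) (use D in auto)
  qed auto
  from this[of B] this[of "permute_h \<eta> ` B"] show ?thesis by (simp add: permute_2[OF assms])
qed

lemma card_rect_permute_v:
  assumes "bij \<eta>" shows "card (rect a b (permute_v \<eta> ` B)) = card (rect a b B)"
proof -
  have "card (rect a b B) \<le> card (rect a b (permute_v \<eta> ` B))" for B
  proof (rule card_rect_image_le[where \<phi> = "\<lambda>p. p", OF inj_permute(2)[OF assms]])
    fix T assume T: "T \<in> rect a b B"
    note D = rectD[OF T]
    show "restrict (\<lambda>p. permute_v \<eta> (T p)) ({..<a} \<times> {..<b}) \<in> rect a b (permute_v \<eta> ` B)"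
      by (rule rectI) (use D in auto)
  qed auto
  from this[of B] this[of "permute_v \<eta> ` B"] show ?thesis by (simp add: permute_2[OF assms])
qed

text \<open>Cutting along a vertical line forgets only the matching condition across the cut, so the
  two pieces still determine the pattern.\<close>

lemma card_rect_add1: "card (rect (a + a') b B) \<le> card (rect a b B) * card (rect a' b B)"
proof -
  let ?h = "\<lambda>T. (restrict T ({..<a} \<times> {..<b}),
    restrict (\<lambda>(i, j). T (i + a, j)) ({..<a'} \<times> {..<b}))"
  have "card (rect (a + a') b B) \<le> card (rect a b B \<times> rect a' b B)"
  proof (rule card_inj_on_le[of ?h])
    show "inj_on ?h (rect (a + a') b B)"
    proof (rule inj_onI)
      fix T T' assume T: "T \<in> rect (a + a') b B" "T' \<in> rect (a + a') b B" and eq: "?h T = ?h T'"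
      show "T = T'"
      proof (rule rect_eqI[OF T])
        fix i j assume ij: "i < a + a'" "j < b"
        show "T (i, j) = T' (i, j)"
        proof (cases "i < a")
          case True
          have "fst (?h T) (i, j) = fst (?h T') (i, j)" using eq by simp
          then show ?thesis using True ij by simp
        next
          case False
          have "snd (?h T) (i - a, j) = snd (?h T') (i - a, j)" using eq by simp
          then show ?thesis using False ij by (simp add: less_diff_conv2)
        qed
      qed
    qed
    show "?h ` rect (a + a') b B \<subseteq> rect a b B \<times> rect a' b B"
    proof (rule image_subsetI)
      fix T assume T: "T \<in> rect (a + a') b B"
      note D = rectD[OF T]
      have "restrict T ({..<a} \<times> {..<b}) \<in> rect a b B"
        by (rule rectI) (use D in auto)
      moreover have "restrict (\<lambda>(i, j). T (i + a, j)) ({..<a'} \<times> {..<b}) \<in> rect a' b B"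
        by (rule rectI) (use D(1) D(3)[of "_ + a"] D(4) in auto)
      ultimately show "?h T \<in> rect a b B \<times> rect a' b B" by simp
    qed
  qed auto
  then show ?thesis by (simp add: card_cartesian_product)
qed

lemma card_rect_add2: "card (rect a (b + b') B) \<le> card (rect a b B) * card (rect a b' B)"
  using card_rect_add1[of b b' a "rotate_tile ` B"] by (simp add: card_rect_rotate)

section \<open>A two-dimensional Fekete lemma\<close>

lemma filterlim_fst: "filterlim fst F (F \<times>\<^sub>F G)"
  and filterlim_snd: "filterlim snd G (F \<times>\<^sub>F G)"
  by (simp_all add: filterlim_def filtermap_fst_prod_filter filtermap_snd_prod_filter)

lemma subadditive_mult:
  fixes f :: "nat \<Rightarrow> real"
  assumes "\<And>a a'. f (a + a') \<le> f a + f a'" "f 0 \<le> 0"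
  shows "f (k * a) \<le> k * f a"
proof (induction k)
  case (Suc k)
  have "f (Suc k * a) \<le> f a + f (k * a)" using assms(1)[of a "k * a"] by simp
  with Suc show ?case by (simp add: algebra_simps)
qed (use assms in simp)

text \<open>Fill the a by b rectangle with p by q rectangles. The leftover strips are narrower than
  p and q, so they have at most p b + q a cells, each costing at most f 1 1.\<close>

lemma biadditive_upper:
  fixes f :: "nat \<Rightarrow> nat \<Rightarrow> real"
  assumes s1: "\<And>a a' b. f (a + a') b \<le> f a b + f a' b"
    and s2: "\<And>a b b'. f a (b + b') \<le> f a b + f a b'"
    and z: "\<And>b. f 0 b = 0" "\<And>a. f a 0 = 0" and nn: "\<And>a b. f a b \<ge> 0"
    and pq: "p > 0" "q > 0"
  shows "f a b \<le> f p q / (p * q) * (a * b) + (p * b + q * a) * f 1 1"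
proof -
  have m1: "f (k * a) b \<le> k * f a b" for k a b
    using subadditive_mult[of "\<lambda>a. f a b" k a] s1 z by simp
  have m2: "f a (k * b) \<le> k * f a b" for k a b
    using subadditive_mult[of "\<lambda>b. f a b" k b] s2 z by simp
  have one: "f a b \<le> (a * b) * f 1 1" for a b
    using m1[of a 1 b] m2[of 1 b 1] mult_left_mono[of "f 1 b" "b * f 1 1" "real a"]
    by (simp add: algebra_simps)
  define k l r s where "k = a div p" "l = b div q" "r = a mod p" "s = b mod q"
  have a: "a = k * p + r" and b: "b = l * q + s" and r: "r < p" and s: "s < q"
    using pq by (auto simp: k_l_r_s_def)
  have "f a b \<le> f (k * p) b + f r b" unfolding a by (rule s1)
  also have "f (k * p) b \<le> f (k * p) (l * q) + f (k * p) s" unfolding b by (rule s2)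
  also have "f (k * p) (l * q) \<le> k * f p (l * q)" by (rule m1)
  also have "\<dots> \<le> k * (l * f p q)" by (intro mult_left_mono m2) simp
  also have "\<dots> = (k * p) * (l * q) * (f p q / (p * q))" using pq by simp
  also have "\<dots> \<le> (a * b) * (f p q / (p * q))"
    using a b nn[of p q]
    by (intro mult_right_mono) (simp_all only: of_nat_le_iff of_nat_mult[symmetric] mult_le_mono
        le_add1 divide_nonneg_nonneg of_nat_0_le_iff)
  also have "f (k * p) s \<le> (k * p * s) * f 1 1" using one[of "k * p" s] by simp
  also have "\<dots> \<le> (a * q) * f 1 1"
    using a s nn[of 1 1] by (intro mult_right_mono) (simp_all only: of_nat_le_iff of_nat_mult[symmetric]
        mult_le_mono le_add1 less_imp_le)
  also have "f r b \<le> (r * b) * f 1 1" using one[of r b] by simp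
  also have "\<dots> \<le> (p * b) * f 1 1"
    using r nn[of 1 1] by (intro mult_right_mono) (simp_all add: mult_right_mono)
  finally show ?thesis by (simp add: algebra_simps)
qed

text \<open>The limit is the infimum of f p q / (p q) over p, q \<ge> 1. The infimum bounds all
  quotients from below, and \<open>biadditive_upper\<close> for a nearly optimal pair p, q bounds
  them from above; the shift to m - 1 and n - 1 disappears in the limit.\<close>

lemma fekete_2d:
  fixes f :: "nat \<Rightarrow> nat \<Rightarrow> real"
  assumes s1: "\<And>a a' b. f (a + a') b \<le> f a b + f a' b"
    and s2: "\<And>a b b'. f a (b + b') \<le> f a b + f a b'"
    and z: "\<And>b. f 0 b = 0" "\<And>a. f a 0 = 0" and nn: "\<And>a b. f a b \<ge> 0"
  obtains L where "((\<lambda>(m, n). f (m - 1) (n - 1) / (real m * real n)) \<longlongrightarrow> L)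
    (sequentially \<times>\<^sub>F sequentially)"
proof -
  define S where "S = (\<lambda>(p, q). f p q / (real p * real q)) ` ({1..} \<times> {1..})"
  define L where "L = Inf S"
  have S: "S \<noteq> {}" "bdd_below S"
    unfolding S_def by (auto intro!: bdd_belowI[of _ 0] divide_nonneg_nonneg mult_nonneg_nonneg nn)
  let ?F = "sequentially \<times>\<^sub>F sequentially"
  let ?g = "\<lambda>(m, n). f (m - 1) (n - 1) / (real m * real n)"
  have inv: "((\<lambda>x. 1 / real (fst x)) \<longlongrightarrow> 0) ?F" "((\<lambda>x. 1 / real (snd x)) \<longlongrightarrow> 0) ?F"
    by (rule filterlim_compose[OF lim_1_over_n filterlim_fst],
        rule filterlim_compose[OF lim_1_over_n filterlim_snd])
  have ev: "eventually (\<lambda>x. fst x \<ge> 2 \<and> snd x \<ge> (2::nat)) ?F"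
    using eventually_prodI[OF eventually_ge_at_top[of "2::nat"] eventually_ge_at_top[of "2::nat"]]
    by simp
  have "(?g \<longlongrightarrow> L) ?F"
  proof (rule order_tendstoI)
    fix y assume y: "y < L"
    have lim: "((\<lambda>x. L * ((1 - 1 / real (fst x)) * (1 - 1 / real (snd x)))) \<longlongrightarrow>
        L * ((1 - 0) * (1 - 0))) ?F"
      by (intro tendsto_intros inv)
    have "eventually (\<lambda>x. y < L * ((1 - 1 / real (fst x)) * (1 - 1 / real (snd x)))) ?F"
      using order_tendstoD(1)[OF lim] y by simp
    then show "eventually (\<lambda>x. y < ?g x) ?F"
      using ev
    proof eventually_elim
      case (elim x)
      obtain m n where x: "x = (Suc m, Suc n)" "m > 0" "n > 0"
        using elim(2) by (cases x; cases "fst x"; cases "snd x") auto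
      have "L \<le> f m n / (real m * real n)"
        unfolding L_def
        by (rule cInf_lower[OF _ S(2)], unfold S_def, rule image_eqI[of _ _ "(m, n)"]) (use x in auto)
      then have "L * (real m * real n) \<le> f m n" using x by (simp add: field_simps)
      moreover have "(1 - 1 / real (Suc m)) * (1 - 1 / real (Suc n)) =
          (real m * real n) / (real (Suc m) * real (Suc n))"
        by (simp add: field_simps)
      ultimately show ?case using elim(1) x
        by (simp add: divide_right_mono order.strict_trans2)
    qed
  next
    fix y assume y: "L < y"
    then obtain z where "z \<in> S" "z < y" unfolding L_def using cInf_lessD[OF S(1)] by blast
    then obtain p q where pq: "p > 0" "q > 0" "f p q / (real p * real q) < y"
      unfolding S_def by (auto simp: Suc_le_eq)
    let ?c = "f p q / (real p * real q)"
    have lim: "((\<lambda>x. ?c + (p * (1 / real (fst x)) + q * (1 / real (snd x))) * f 1 1) \<longlongrightarrow>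
        ?c + (real p * 0 + real q * 0) * f 1 1) ?F"
      by (intro tendsto_intros inv)
    have "eventually (\<lambda>x. ?c + (p * (1 / real (fst x)) + q * (1 / real (snd x))) * f 1 1 < y) ?F"
      using order_tendstoD(2)[OF lim] pq by simp
    then show "eventually (\<lambda>x. ?g x < y) ?F"
      using ev
    proof eventually_elim
      case (elim x)
      obtain m n where x: "x = (Suc m, Suc n)"
        using elim(2) by (cases x; cases "fst x"; cases "snd x") auto
      let ?M = "real (Suc m)" and ?N = "real (Suc n)"
      have MN: "?M > 0" "?N > 0" by simp_all
      have "f m n \<le> ?c * (m * n) + (p * n + q * m) * f 1 1"
        using biadditive_upper[OF s1 s2 z nn pq(1,2), of m n] by simp
      also have "\<dots> \<le> ?c * (?M * ?N) + (p * ?N + q * ?M) * f 1 1"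
        using nn by (intro add_mono mult_left_mono mult_right_mono)
          (auto simp: divide_nonneg_nonneg algebra_simps)
      finally have "f m n / (?M * ?N) \<le> (?c * (?M * ?N) + (p * ?N + q * ?M) * f 1 1) / (?M * ?N)"
        using MN by (intro divide_right_mono) auto
      also have "\<dots> = ?c + (p * (1 / ?M) + q * (1 / ?N)) * f 1 1"
        using MN by (simp add: add_divide_distrib distrib_right del: of_nat_Suc)
      finally show ?case using elim(1) x by simp
    qed
  qed
  then show thesis by (rule that)
qed

text \<open>A rectangle with a side of length 0 has exactly one pattern, so admitting such
  rectangles creates no new vanishing counts.\<close>

lemma card_rect_pos_iff:
  "(\<exists>m\<ge>2. \<exists>n\<ge>2. num_patterns m n B = 0) \<longleftrightarrow> (\<exists>a b. card (rect a b B) = 0)"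
proof
  assume "\<exists>a b. card (rect a b B) = 0"
  then obtain a b where ab: "card (rect a b B) = 0" by blast
  then have "a \<noteq> 0" "b \<noteq> 0" by (metis card.empty card_insert_disjoint finite.emptyI empty_iff nat.distinct(1) rect_0(1), metis card.empty card_insert_disjoint finite.emptyI empty_iff nat.distinct(1) rect_0(2))
  then have "num_patterns (Suc a) (Suc b) B = 0" "Suc a \<ge> 2" "Suc b \<ge> 2"
    using ab by (simp_all add: num_patterns_eq_rect)
  then show "\<exists>m\<ge>2. \<exists>n\<ge>2. num_patterns m n B = 0" by blast
qed (auto simp: num_patterns_eq_rect)

text \<open>Fekete's lemma for the logarithm of the counts shows that the limit exists; only then
  does \<open>Lim\<close> in the definition of \<open>entropy\<close> denote it.\<close>

lemma entropy_tendsto: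
  assumes "\<And>a b. card (rect a b B) > 0"
  shows "((\<lambda>(m, n). ln (real (num_patterns m n B)) / (real m * real n)) \<longlongrightarrow> entropy B)
    (sequentially \<times>\<^sub>F sequentially)"
proof -
  let ?f = "\<lambda>a b. ln (real (card (rect a b B)))"
  have ge1: "real (card (rect a b B)) \<ge> 1" for a b using assms[of a b] by linarith
  have pos': "real (card (rect a b B)) > 0" for a b using assms[of a b] by linarith
  obtain L where L: "((\<lambda>(m, n). ?f (m - 1) (n - 1) / (real m * real n)) \<longlongrightarrow> L)
    (sequentially \<times>\<^sub>F sequentially)"
  proof (rule fekete_2d[of ?f])
    fix a a' b
    have "?f (a + a') b \<le> ln (real (card (rect a b B) * card (rect a' b B)))"
      using card_rect_add1[of a a' b B] ge1[of "a + a'" b] assms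
      by (subst ln_le_cancel_iff) (simp_all only: of_nat_le_iff of_nat_0_less_iff nat_0_less_mult_iff)
    then show "?f (a + a') b \<le> ?f a b + ?f a' b" using ln_mult_pos[OF pos' pos'] by (simp only: of_nat_mult)
  next
    fix a b b'
    have "?f a (b + b') \<le> ln (real (card (rect a b B) * card (rect a b' B)))"
      using card_rect_add2[of a b b' B] ge1[of a "b + b'"] assms
      by (subst ln_le_cancel_iff) (simp_all only: of_nat_le_iff of_nat_0_less_iff nat_0_less_mult_iff)
    then show "?f a (b + b') \<le> ?f a b + ?f a b'" using ln_mult_pos[OF pos' pos'] by (simp only: of_nat_mult)
  qed (use ge1 in \<open>simp_all add: ln_ge_zero\<close>)
  moreover have "\<not> (\<exists>m\<ge>2. \<exists>n\<ge>2. num_patterns m n B = 0)"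
    unfolding card_rect_pos_iff using assms by (metis less_irrefl)
  moreover have "sequentially \<times>\<^sub>F sequentially \<noteq> (bot :: (nat \<times> nat) filter)"
    by (simp add: prod_filter_eq_bot)
  ultimately show ?thesis
    unfolding entropy_def num_patterns_eq_rect using tendsto_Lim by (simp only: if_False) blast
qed

lemma entropy_cong:
  assumes "\<And>a b. card (rect a b B) = card (rect a b B')"
  shows "entropy B = entropy B'"
proof -
  have "num_patterns m n B = num_patterns m n B'" for m n
    unfolding num_patterns_eq_rect by (rule assms)
  then show ?thesis unfolding entropy_def by presburger
qed

text \<open>Rotation exchanges the two sides, and a limit in which m and n grow independently is
  insensitive to that. If some count vanishes, the convention gives 0 for both sets.\<close>

lemma entropy_rotate: "entropy (rotate_tile ` B) = entropy B"
proof (cases "\<exists>a b. card (rect a b B) = 0")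
  case True
  then have "\<exists>a b. card (rect a b (rotate_tile ` B)) = 0" by (auto simp: card_rect_rotate)
  then show ?thesis using True card_rect_pos_iff by (auto simp: entropy_def)
next
  case False
  then have pos: "card (rect a b B) > 0" for a b by (metis neq0_conv)
  let ?F = "sequentially \<times>\<^sub>F sequentially :: (nat \<times> nat) filter"
  have "filterlim (\<lambda>x. (snd x, fst x)) ?F ?F"
    by (intro filterlim_Pair filterlim_fst filterlim_snd)
  from filterlim_compose[OF entropy_tendsto[OF pos] this]
  have "((\<lambda>(m, n). ln (real (num_patterns m n (rotate_tile ` B))) / (real m * real n)) \<longlongrightarrow> entropy B) ?F"
    unfolding num_patterns_eq_rect card_rect_rotate case_prod_beta by (simp add: mult.commute)
  moreover have "((\<lambda>(m, n). ln (real (num_patterns m n (rotate_tile ` B))) / (real m * real n)) \<longlongrightarrow>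
      entropy (rotate_tile ` B)) ?F"
    by (rule entropy_tendsto) (simp add: card_rect_rotate pos)
  ultimately show ?thesis
    using tendsto_unique[of ?F] by (simp add: prod_filter_eq_bot)
qed

lemma entropy_pos:
  assumes c: "c > 0" and ge: "\<And>a b. real (card (rect a b B)) \<ge> exp (c * real (a * b))"
  shows "entropy B > 0"
proof -
  let ?F = "sequentially \<times>\<^sub>F sequentially :: (nat \<times> nat) filter"
  have pos: "card (rect a b B) > 0" for a b
    using order_less_le_trans[OF exp_gt_zero ge[of a b]] by simp
  \<comment> \<open>For m, n \<ge> 1 one has (m + 1) (n + 1) \<le> 4 m n: the factor 4 is the price
    of dividing by lattice points instead of tiles.\<close>
  have "c / 4 \<le> entropy B"
  proof (rule tendsto_lowerbound[OF entropy_tendsto[OF pos]])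
    have "eventually (\<lambda>x. fst x \<ge> 2 \<and> snd x \<ge> (2::nat)) ?F"
      using eventually_prodI[OF eventually_ge_at_top[of "2::nat"] eventually_ge_at_top[of "2::nat"]]
      by simp
    then show "\<forall>\<^sub>F x in ?F. c / 4 \<le> (case x of (m, n) \<Rightarrow>
        ln (real (num_patterns m n B)) / (real m * real n))"
    proof eventually_elim
      case (elim x)
      then obtain m n where x: "x = (Suc m, Suc n)" "m \<ge> 1" "n \<ge> 1"
        by (cases x; cases "fst x"; cases "snd x") auto
      have "real (Suc m) * real (Suc n) \<le> (2 * real m) * (2 * real n)"
        using x by (intro mult_mono) auto
      then have "c / 4 * (real (Suc m) * real (Suc n)) \<le> c / 4 * ((2 * real m) * (2 * real n))"
        using c by (intro mult_left_mono) auto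
      also have "\<dots> = ln (exp (c * real (m * n)))" by simp
      also have "\<dots> \<le> ln (real (card (rect m n B)))"
        using ge[of m n] pos[of m n] by (subst ln_le_cancel_iff) auto
      finally have "c / 4 \<le> ln (real (card (rect m n B))) / (real (Suc m) * real (Suc n))"
        by (subst pos_le_divide_eq) simp_all
      then show ?case using x by (simp add: num_patterns_eq_rect)
    qed
  qed (simp add: prod_filter_eq_bot)
  with c show ?thesis by linarith
qed

text \<open>As the double limit exists, it may be computed along the diagonal, so squares suffice.
  The logarithm of the bound is K n ln (16 n^2), negligible against n^2. The base 16 n^2 is the
  number of pairs of a position and a tile.\<close>

lemma entropy_zero:
  assumes le: "\<And>n. n > 0 \<Longrightarrow> card (rect n n B) \<le> (16 * (n * n)) ^ (K * n)"
  shows "entropy B = 0"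
proof (cases "\<exists>a b. card (rect a b B) = 0")
  case True
  then show ?thesis using card_rect_pos_iff by (auto simp: entropy_def)
next
  case False
  then have pos: "card (rect a b B) > 0" for a b by (metis neq0_conv)
  let ?F = "sequentially \<times>\<^sub>F sequentially :: (nat \<times> nat) filter"
  have "filterlim (\<lambda>n. (Suc n, Suc n)) ?F sequentially"
    by (intro filterlim_Pair filterlim_Suc)
  from filterlim_compose[OF entropy_tendsto[OF pos] this]
  have "(\<lambda>n. ln (real (card (rect n n B))) / (real (Suc n) * real (Suc n))) \<longlonglongrightarrow> entropy B"
    by (simp add: num_patterns_eq_rect)
  moreover have "(\<lambda>n. ln (real (card (rect n n B))) / (real (Suc n) * real (Suc n))) \<longlonglongrightarrow> 0"
  proof (rule tendsto_sandwich[OF _ _ tendsto_const])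
    show "\<forall>\<^sub>F n in sequentially. 0 \<le> ln (real (card (rect n n B))) / (real (Suc n) * real (Suc n))"
      using pos by (intro always_eventually) (auto intro!: divide_nonneg_nonneg ln_ge_zero simp: Suc_le_eq)
    show "\<forall>\<^sub>F n in sequentially. ln (real (card (rect n n B))) / (real (Suc n) * real (Suc n)) \<le>
        real K * real n * ln (16 * (real n * real n)) / (real (Suc n) * real (Suc n))"
      using eventually_gt_at_top[of 0]
    proof eventually_elim
      case (elim n)
      have "ln (real (card (rect n n B))) \<le> ln (real ((16 * (n * n)) ^ (K * n)))"
        using le[OF elim] pos[of n n] elim
        by (subst ln_le_cancel_iff) (simp_all only: of_nat_le_iff of_nat_0_less_iff zero_less_power
            nat_0_less_mult_iff zero_less_numeral)
      also have "\<dots> = ln ((16 * (real n * real n)) ^ (K * n))" by simp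
      also have "\<dots> = real (K * n) * ln (16 * (real n * real n))" by (subst ln_realpow) (use elim in auto)
      also have "\<dots> = real K * real n * ln (16 * (real n * real n))" by simp
      finally show ?case by (intro divide_right_mono) auto
    qed
    show "(\<lambda>n. real K * real n * ln (16 * (real n * real n)) / (real (Suc n) * real (Suc n))) \<longlonglongrightarrow> 0"
    proof (rule tendsto_sandwich[OF _ _ tendsto_const])
      \<comment> \<open>Since 16 n^2 = (4 n)^2, the limit of ln x / x is used at x = 4 n.\<close>
      have "filterlim (\<lambda>n::nat. real (4 * n)) at_top sequentially"
        by (intro filterlim_compose[OF filterlim_real_sequentially] filterlim_subseq strict_monoI) simp
      from filterlim_compose[OF ln_x_over_x_tendsto_0 this]
      have "(\<lambda>n. ln (real (4 * n)) / real (4 * n)) \<longlonglongrightarrow> 0" .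
      then show "(\<lambda>n. 8 * K * (ln (real (4 * n)) / real (4 * n))) \<longlonglongrightarrow> 0"
        by (rule tendsto_mult_right_zero)
      show "\<forall>\<^sub>F n in sequentially.
          real K * real n * ln (16 * (real n * real n)) / (real (Suc n) * real (Suc n)) \<le>
          8 * K * (ln (real (4 * n)) / real (4 * n))"
        using eventually_gt_at_top[of 0]
      proof eventually_elim
        case (elim n)
        have "ln (16 * (real n * real n)) = ln ((4 * real n) * (4 * real n))" by simp
        also have "\<dots> = 2 * ln (4 * real n)" using elim by (subst ln_mult) auto
        finally have eq: "real K * real n * ln (16 * (real n * real n)) = 2 * K * n * ln (4 * real n)"
          by simp
        have "2 * K * n * ln (4 * real n) / (real (Suc n) * real (Suc n)) \<le> 2 * K * n * ln (4 * real n) / (real n * real n)"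
          using elim by (intro divide_left_mono mult_mono mult_nonneg_nonneg) auto
        also have "\<dots> = 8 * K * (ln (real (4 * n)) / real (4 * n))" using elim by simp
        finally show ?case unfolding eq .
      qed
      show "\<forall>\<^sub>F n in sequentially.
          0 \<le> real K * real n * ln (16 * (real n * real n)) / (real (Suc n) * real (Suc n))"
        using eventually_gt_at_top[of 0]
      proof eventually_elim
        case (elim n)
        then have "1 \<le> real n * real n" by (simp add: Suc_le_eq flip: of_nat_mult)
        then show ?case by (intro divide_nonneg_nonneg mult_nonneg_nonneg ln_ge_zero) auto
      qed
    qed
  qed
  ultimately show ?thesis by (rule LIMSEQ_unique)
qed

section \<open>Positive and zero entropy\<close>

text \<open>A cell of the block $X$ has its right and upper neighbors in $X$; at the border they wrap
  around into the block $Y$.\<close>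

definition joins :: "nat \<Rightarrow> tile list list \<Rightarrow> tile list list \<Rightarrow> bool" where
  "joins p X Y \<longleftrightarrow>
     list_all2 (\<lambda>r s. length r = p \<and> map right_col r = map left_col (tl r @ [hd s])) X Y \<and>
     list_all2 (\<lambda>r s. map top_col r = map bottom_col s) X (tl X @ [hd Y])"

section \<open>Positive entropy from two interchangeable blocks\<close>

lemma nth_tl_snoc_hd:
  assumes "i < length xs" "length ys = length xs"
  shows "(tl xs @ [hd ys]) ! i = (if Suc i < length xs then xs ! Suc i else ys ! 0)"
  using assms by (cases ys) (auto simp: nth_append nth_tl)

lemma joinsD:
  assumes "joins p X Y" "joins p Y Y" "p > 0" "i < p" "j < length X"
  shows "right_col (X ! j ! i) = left_col (if Suc i < p then X ! j ! Suc i else Y ! j ! 0)"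
    and "top_col (X ! j ! i) = bottom_col ((if Suc j < length X then X ! Suc j else Y ! 0) ! i)"
proof -
  have len: "length Y = length X" using assms(1) by (auto simp: joins_def list_all2_lengthD)
  have l: "length (X ! j) = p" "length (Y ! j) = p"
    using assms len by (auto simp: joins_def list_all2_conv_all_nth)
  have "map right_col (X ! j) = map left_col (tl (X ! j) @ [hd (Y ! j)])"
    using assms(1,5) by (auto simp: joins_def list_all2_conv_all_nth)
  then have "map right_col (X ! j) ! i = map left_col (tl (X ! j) @ [hd (Y ! j)]) ! i" by simp
  then show "right_col (X ! j ! i) = left_col (if Suc i < p then X ! j ! Suc i else Y ! j ! 0)"
    using l assms(3,4) nth_tl_snoc_hd[of i "X ! j" "Y ! j"] by (subst (asm) (1 2) nth_map) auto
  have l': "length X > 0" using assms(5) by auto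
  have "map top_col (X ! j) = map bottom_col ((tl X @ [hd Y]) ! j)"
    using assms(1,5) by (auto simp: joins_def list_all2_conv_all_nth)
  also have "(tl X @ [hd Y]) ! j = (if Suc j < length X then X ! Suc j else Y ! 0)"
    by (rule nth_tl_snoc_hd) (use assms len in auto)
  finally have eq: "map top_col (X ! j) = map bottom_col (if Suc j < length X then X ! Suc j else Y ! 0)" .
  from map_eq_imp_length_eq[OF this] this
  show "top_col (X ! j ! i) = bottom_col ((if Suc j < length X then X ! Suc j else Y ! 0) ! i)"
    using l assms(4) by (metis nth_map)
qed

lemma joins_row_length: "joins p X Y \<Longrightarrow> j < length X \<Longrightarrow> length (X ! j) = p"
  by (auto simp: joins_def list_all2_conv_all_nth)

lemma div_mod_Suc:
  assumes "p > 0"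
  shows "Suc i mod p = (if Suc (i mod p) < p then Suc (i mod p) else 0)"
    and "Suc (i mod p) < p \<Longrightarrow> Suc i div p = i div p"
  using assms mod_less_divisor[OF assms, of i] by (auto simp: mod_Suc div_Suc)

lemma mult_add_less_mult:
  assumes "i < k" "r < p" shows "i * p + r < k * (p :: nat)"
proof -
  have "i * p + r < Suc i * p" using assms(2) by simp
  also have "\<dots> \<le> k * p" using assms(1) by (intro mult_le_mono1) simp
  finally show ?thesis .
qed

lemma card_rect_power1: "card (rect (k * a) b B) \<le> card (rect a b B) ^ k"
proof (induction k)
  case (Suc k)
  have "card (rect (Suc k * a) b B) \<le> card (rect a b B) * card (rect (k * a) b B)"
    using card_rect_add1[of a "k * a" b B] by simp
  also have "\<dots> \<le> card (rect a b B) * card (rect a b B) ^ k" using Suc by (rule mult_le_mono2)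
  finally show ?case by simp
qed simp

lemma card_rect_power2: "card (rect a (k * b) B) \<le> card (rect a b B) ^ k"
  using card_rect_power1[of k b a "rotate_tile ` B"] by (simp add: card_rect_rotate)

text \<open>Every ordered pair of blocks matches both horizontally and vertically, so each of the k
  l places of a grid can be filled with \<open>X\<close> or \<open>Y\<close> independently of the
  others.\<close>

lemma card_rect_blocks_ge:
  assumes "p > 0" "X \<noteq> []" "X \<noteq> Y"
    and j: "joins p X X" "joins p X Y" "joins p Y X" "joins p Y Y"
    and sub: "set (concat X) \<subseteq> B" "set (concat Y) \<subseteq> B"
  shows "2 ^ (k * l) \<le> card (rect (k * p) (l * length X) B)"
proof -
  define q where "q = length X"
  have q: "q > 0" "length Y = q" using assms(2) j(2) by (auto simp: q_def joins_def list_all2_lengthD)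
  let ?Z = "\<lambda>c. if c then X else Y"
  have joins: "joins p (?Z c) (?Z d)" for c d using j by simp
  have len: "length (?Z c) = q" for c using q by (simp add: q_def)
  let ?T = "\<lambda>s. restrict (\<lambda>(i, j). ?Z (s (i div p, j div q)) ! (j mod q) ! (i mod p))
    ({..<k * p} \<times> {..<l * q})"
  let ?D = "({..<k} \<times> {..<l}) \<rightarrow>\<^sub>E (UNIV :: bool set)"
  \<comment> \<open>In a cell where the two blocks differ, the pattern reveals which block was
    chosen.\<close>
  obtain i0 j0 where ij0: "i0 < p" "j0 < q" "X ! j0 ! i0 \<noteq> Y ! j0 ! i0"
  proof -
    obtain j0 where j0: "j0 < q" "X ! j0 \<noteq> Y ! j0"
      using assms(3) q nth_equalityI[of X Y] by (auto simp: q_def)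
    have "length (X ! j0) = p" "length (Y ! j0) = p"
      using joins_row_length j(1,4) j0 q by (auto simp: q_def)
    then show thesis using that j0 nth_equalityI[of "X ! j0" "Y ! j0"] by metis
  qed
  have "card ?D \<le> card (rect (k * p) (l * q) B)"
  proof (rule card_inj_on_le)
    show "inj_on ?T ?D"
    proof (rule inj_onI)
      fix s t assume s: "s \<in> ?D" and t: "t \<in> ?D" and eq: "?T s = ?T t"
      show "s = t"
      proof (rule PiE_ext[OF s t])
        fix x assume x: "x \<in> {..<k} \<times> {..<l}"
        obtain i j where ij: "x = (i, j)" "i < k" "j < l" using x by auto
        have lt: "i * p + i0 < k * p" "j * q + j0 < l * q"
          by (rule mult_add_less_mult, fact, fact)+
        have "?T s (i * p + i0, j * q + j0) = ?T t (i * p + i0, j * q + j0)" using eq by simp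
        then have "?Z (s (i, j)) ! j0 ! i0 = ?Z (t (i, j)) ! j0 ! i0"
          using lt ij0 by simp
        then show "s x = t x" using ij0(3) ij(1) by (auto split: if_splits)
      qed
    qed
    show "?T ` ?D \<subseteq> rect (k * p) (l * q) B"
    proof (rule image_subsetI)
      fix s assume "s \<in> ?D"
      have mem: "?Z c ! j ! i \<in> B" if "i < p" "j < q" for c i j
      proof -
        have "?Z c ! j \<in> set (?Z c)" using that len by (metis nth_mem)
        moreover have "?Z c ! j ! i \<in> set (?Z c ! j)"
          using that len[of c] joins_row_length[OF joins[of c c]] by simp
        ultimately have "?Z c ! j ! i \<in> set (concat (?Z c))" by auto
        then show ?thesis using sub by (cases c) auto
      qed
      show "?T s \<in> rect (k * p) (l * q) B"
      proof (rule rectI, goal_cases)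
        case (1 i j)
        then show ?case using mem assms(1) q by simp
      next
        case (3 i j)
        let ?c = "s (i div p, j div q)" and ?d = "s (Suc i div p, j div q)"
        have "right_col (?Z ?c ! (j mod q) ! (i mod p)) =
            left_col (if Suc (i mod p) < p then ?Z ?c ! (j mod q) ! Suc (i mod p) else ?Z ?d ! (j mod q) ! 0)"
          by (rule joinsD(1)) (use joins assms(1) q len in auto)
        \<comment> \<open>Inside a block \<open>Suc i div p = i div p\<close>, so both choices
          coincide. From the last column one enters column 0 of the next block.\<close>
        also have "\<dots> = left_col (?Z ?d ! (j mod q) ! (Suc i mod p))"
          using div_mod_Suc[OF assms(1), of i] by (simp del: mod_Suc)
        finally show ?case using 3 by simp
      next
        case (4 i j)
        let ?c = "s (i div p, j div q)" and ?d = "s (i div p, Suc j div q)"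
        have "top_col (?Z ?c ! (j mod q) ! (i mod p)) =
            bottom_col ((if Suc (j mod q) < length (?Z ?c) then ?Z ?c ! Suc (j mod q) else ?Z ?d ! 0) ! (i mod p))"
          by (rule joinsD(2)) (use joins assms(1) q len in auto)
        also have "\<dots> = bottom_col (?Z ?d ! (Suc j mod q) ! (i mod p))"
          using div_mod_Suc[OF q(1), of j] unfolding len by simp
        finally show ?case using 4 by simp
      qed auto
    qed
  qed simp
  moreover have "card ?D = 2 ^ (k * l)"
    by (simp add: card_PiE)
  ultimately show ?thesis by (simp add: q_def)
qed

text \<open>A rectangle of a by b blocks can also be cut into p q rectangles of a by b tiles.
  Comparing the two views gives 2^(a b) \<le> card (rect a b B)^(p q) for all a and b, without any
  divisibility condition.\<close>

lemma entropy_pos_if_blocks: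
  assumes "p > 0" "X \<noteq> []" "X \<noteq> Y"
    and j: "joins p X X" "joins p X Y" "joins p Y X" "joins p Y Y"
    and sub: "set (concat X) \<subseteq> B" "set (concat Y) \<subseteq> B"
  shows "entropy B > 0"
proof (rule entropy_pos)
  define q where "q = length X"
  have q: "q > 0" using assms(2) by (simp add: q_def)
  show "0 < ln 2 / real (p * q)" using assms(1) q by simp
  fix a b
  have "2 ^ (a * b) \<le> card (rect (a * p) (b * q) B)"
    unfolding q_def by (rule card_rect_blocks_ge[OF assms])
  also have "\<dots> = card (rect (p * a) (q * b) B)" by (simp add: mult.commute)
  also have "\<dots> \<le> card (rect a (q * b) B) ^ p" by (rule card_rect_power1)
  also have "\<dots> \<le> (card (rect a b B) ^ q) ^ p" by (intro power_mono card_rect_power2) simp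
  finally have le: "2 ^ (a * b) \<le> card (rect a b B) ^ (p * q)" by (simp add: power_mult[symmetric] mult.commute)
  have pos: "card (rect a b B) > 0"
  proof (rule ccontr)
    assume "\<not> card (rect a b B) > 0"
    then have "card (rect a b B) = 0" by simp
    have "(2::nat) ^ (a * b) \<le> 0 ^ (p * q)" using le unfolding \<open>card (rect a b B) = 0\<close> .
    moreover have "(0::nat) ^ (p * q) = 0" using assms(1) q by (intro zero_power) simp
    ultimately show False by simp
  qed
  have "real (a * b) * ln 2 = ln (2 ^ (a * b))" by (simp add: ln_realpow)
  also have "\<dots> \<le> ln (real (card (rect a b B)) ^ (p * q))"
    using le pos by (subst ln_le_cancel_iff) (auto simp flip: of_nat_power)
  also have "\<dots> = real (p * q) * ln (real (card (rect a b B)))"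
    using pos by (subst ln_realpow) auto
  finally have "ln 2 / real (p * q) * real (a * b) \<le> ln (real (card (rect a b B)))"
    using assms(1) q by (simp add: field_simps)
  then have "exp (ln 2 / real (p * q) * real (a * b)) \<le> exp (ln (real (card (rect a b B))))" by simp
  then show "exp (ln 2 / real (p * q) * real (a * b)) \<le> real (card (rect a b B))" using pos by simp
qed

section \<open>Zero entropy when few tiles determine a pattern\<close>

lemma card_UNIV_tile: "card (UNIV :: tile set) = 16"
  by (simp add: card_cartesian_product flip: UNIV_Times_UNIV)

text \<open>Such a set is the set of entries of a list of length exactly M, filled up by repeating
  an element; a nonempty set is needed for that.\<close>

lemma card_bounded_subsets_le:
  assumes "finite A"
  shows "finite {X. X \<subseteq> A \<and> X \<noteq> {} \<and> card X \<le> M}"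
    and "card {X. X \<subseteq> A \<and> X \<noteq> {} \<and> card X \<le> M} \<le> card A ^ M"
proof -
  let ?L = "{xs. set xs \<subseteq> A \<and> length xs = M}"
  have sub: "{X. X \<subseteq> A \<and> X \<noteq> {} \<and> card X \<le> M} \<subseteq> set ` ?L"
  proof clarify
    fix X assume X: "X \<subseteq> A" "X \<noteq> {}" "card X \<le> M"
    obtain x where x: "x \<in> X" using X by blast
    obtain xs where xs: "set xs = X" "length xs = card X"
      using finite_distinct_list[OF finite_subset[OF X(1) assms]] distinct_card by metis
    have "set (xs @ replicate (M - card X) x) = X" using xs x by (auto simp: set_replicate_conv_if)
    moreover have "length (xs @ replicate (M - card X) x) = M" using xs X by simp
    ultimately show "X \<in> set ` ?L" using X by (metis (mono_tags, lifting) image_eqI mem_Collect_eq)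
  qed
  have fin: "finite ?L" by (rule finite_lists_length_eq[OF assms])
  show "finite {X. X \<subseteq> A \<and> X \<noteq> {} \<and> card X \<le> M}"
    by (rule finite_subset[OF sub]) (simp add: fin)
  have "card {X. X \<subseteq> A \<and> X \<noteq> {} \<and> card X \<le> M} \<le> card (set ` ?L)"
    by (rule card_mono[OF _ sub]) (simp add: fin)
  also have "\<dots> \<le> card ?L" by (rule card_image_le[OF fin])
  also have "\<dots> = card A ^ M" by (rule card_lists_length_eq[OF assms])
  finally show "card {X. X \<subseteq> A \<and> X \<noteq> {} \<and> card X \<le> M} \<le> card A ^ M" .
qed

text \<open>The position set may depend on the pattern, so the code of a pattern is its graph over
  that set: at most K n of the 16 n^2 pairs of a position and a tile.\<close>

lemma entropy_zero_if_determined: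
  assumes S: "\<And>n T. n > 0 \<Longrightarrow> T \<in> rect n n B \<Longrightarrow>
      S n T \<subseteq> {..<n} \<times> {..<n} \<and> S n T \<noteq> {} \<and> card (S n T) \<le> K * n"
    and det: "\<And>n T T'. n > 0 \<Longrightarrow> T \<in> rect n n B \<Longrightarrow> T' \<in> rect n n B \<Longrightarrow>
      S n T = S n T' \<Longrightarrow> (\<And>p. p \<in> S n T \<Longrightarrow> T p = T' p) \<Longrightarrow> T = T'"
  shows "entropy B = 0"
proof (rule entropy_zero[of _ K])
  fix n :: nat assume n: "n > 0"
  let ?A = "({..<n} \<times> {..<n}) \<times> (UNIV :: tile set)"
  let ?g = "\<lambda>T. (\<lambda>p. (p, T p)) ` S n T"
  have A: "card ?A = 16 * (n * n)" "finite ?A"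
    by (simp_all add: card_cartesian_product card_UNIV_tile)
  have "card (rect n n B) \<le> card {X. X \<subseteq> ?A \<and> X \<noteq> {} \<and> card X \<le> K * n}"
  proof (rule card_inj_on_le)
    show "inj_on ?g (rect n n B)"
    proof (rule inj_onI)
      fix T T' assume T: "T \<in> rect n n B" "T' \<in> rect n n B" and eq: "?g T = ?g T'"
      have "fst ` ?g T = fst ` ?g T'" using eq by simp
      then have "S n T = S n T'" by (simp add: image_image)
      moreover have "T p = T' p" if "p \<in> S n T" for p
      proof -
        have "(p, T p) \<in> ?g T'" using that eq by blast
        then show ?thesis by auto
      qed
      ultimately show "T = T'" using det[OF n T] by blast
    qed
    show "?g ` rect n n B \<subseteq> {X. X \<subseteq> ?A \<and> X \<noteq> {} \<and> card X \<le> K * n}"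
    proof (rule image_subsetI)
      fix T assume "T \<in> rect n n B"
      note s = S[OF n this]
      moreover have "finite (S n T)" using s finite_subset by blast
      ultimately show "?g T \<in> {X. X \<subseteq> ?A \<and> X \<noteq> {} \<and> card X \<le> K * n}"
        using card_image_le[of "S n T" "\<lambda>p. (p, T p)"] by auto
    qed
  qed (rule card_bounded_subsets_le(1)[OF A(2)])
  also have "\<dots> \<le> card ?A ^ (K * n)" by (rule card_bounded_subsets_le(2)[OF A(2)])
  finally show "card (rect n n B) \<le> (16 * (n * n)) ^ (K * n)" unfolding A(1) .
qed

definition excess :: "int \<Rightarrow> int \<Rightarrow> tile \<Rightarrow> int" where
  "excess \<alpha> \<beta> x = \<alpha> * (of_bool (top_col x) - of_bool (bottom_col x)) +
     \<beta> * (of_bool (right_col x) - of_bool (left_col x))"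

lemma sum_excess:
  assumes "T \<in> rect a b B" "a > 0" "b > 0"
  shows "(\<Sum>i<a. \<Sum>j<b. excess \<alpha> \<beta> (T (i, j))) =
    \<alpha> * (\<Sum>i<a. of_bool (top_col (T (i, b - 1))) - of_bool (bottom_col (T (i, 0)))) +
    \<beta> * (\<Sum>j<b. of_bool (right_col (T (a - 1, j))) - of_bool (left_col (T (0, j))))"
proof -
  note D = rectD[OF assms(1)]
  have v: "(\<Sum>j<m. of_bool (top_col (T (i, j))) - of_bool (bottom_col (T (i, j)))) =
      (of_bool (top_col (T (i, m - 1))) - of_bool (bottom_col (T (i, 0))) :: int)"
    if "i < a" "0 < m" "m \<le> b" for i m
    using that(2,3)
  proof (induction m)
    case (Suc m)
    then show ?case using D(4)[OF that(1), of "m - 1"] by (cases m) auto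
  qed simp
  have h: "(\<Sum>i<m. of_bool (right_col (T (i, j))) - of_bool (left_col (T (i, j)))) =
      (of_bool (right_col (T (m - 1, j))) - of_bool (left_col (T (0, j))) :: int)"
    if "j < b" "0 < m" "m \<le> a" for j m
    using that(2,3)
  proof (induction m)
    case (Suc m)
    then show ?case using D(3)[OF _ that(1), of "m - 1"] by (cases m) auto
  qed simp
  have "(\<Sum>i<a. \<Sum>j<b. excess \<alpha> \<beta> (T (i, j))) =
    \<alpha> * (\<Sum>i<a. \<Sum>j<b. of_bool (top_col (T (i, j))) - of_bool (bottom_col (T (i, j)))) +
    \<beta> * (\<Sum>i<a. \<Sum>j<b. of_bool (right_col (T (i, j))) - of_bool (left_col (T (i, j))))"
    by (simp add: excess_def sum.distrib sum_distrib_left)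
  also have "(\<Sum>i<a. \<Sum>j<b. of_bool (right_col (T (i, j))) - of_bool (left_col (T (i, j)))) =
    (\<Sum>j<b. \<Sum>i<a. of_bool (right_col (T (i, j))) - of_bool (left_col (T (i, j))) :: int)"
    by (rule sum.swap)
  also have "\<dots> = (\<Sum>j<b. of_bool (right_col (T (a - 1, j))) - of_bool (left_col (T (0, j))))"
    using assms(2) by (intro sum.cong h) auto
  also have "(\<Sum>i<a. \<Sum>j<b. of_bool (top_col (T (i, j))) - of_bool (bottom_col (T (i, j)))) =
    (\<Sum>i<a. of_bool (top_col (T (i, b - 1))) - of_bool (bottom_col (T (i, 0))) :: int)"
    using assms(3) by (intro sum.cong v) auto
  finally show ?thesis .
qed

lemma abs_sum_of_bool_diff_le:
  "\<bar>\<Sum>i<n. of_bool (P i) - of_bool (Q i) :: int\<bar> \<le> int n"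
proof -
  have "\<bar>\<Sum>i<n. of_bool (P i) - of_bool (Q i) :: int\<bar> \<le> (\<Sum>i<n. \<bar>of_bool (P i) - of_bool (Q i) :: int\<bar>)"
    by (rule sum_abs)
  also have "\<dots> \<le> (\<Sum>i<n. 1)" by (intro sum_mono) auto
  finally show ?thesis by simp
qed

lemma mult_le_abs_mult:
  fixes c s :: int
  assumes "\<bar>s\<bar> \<le> n" shows "c * s \<le> \<bar>c\<bar> * n"
proof -
  have "c * s \<le> \<bar>c\<bar> * \<bar>s\<bar>" by (metis abs_ge_self abs_mult)
  also have "\<dots> \<le> \<bar>c\<bar> * n" using assms by (intro mult_left_mono) auto
  finally show ?thesis .
qed

text \<open>Integrality matters here: a nonzero excess is at least 1, so the number of such tiles is
  at most the total excess, a boundary term of size at most (|\<alpha>| + |\<beta>|) n.\<close>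

lemma card_excess_le:
  assumes T: "T \<in> rect n n B" and n: "n > 0" and nonneg: "\<And>x. x \<in> B \<Longrightarrow> excess \<alpha> \<beta> x \<ge> 0"
  shows "card {(i, j). i < n \<and> j < n \<and> excess \<alpha> \<beta> (T (i, j)) \<noteq> 0} \<le> nat (\<bar>\<alpha>\<bar> + \<bar>\<beta>\<bar>) * n"
proof -
  let ?E = "{(i, j). i < n \<and> j < n \<and> excess \<alpha> \<beta> (T (i, j)) \<noteq> 0}"
  let ?A = "{..<n} \<times> {..<n}"
  have "int (card ?E) = (\<Sum>p\<in>?E. 1)" by simp
  also have "\<dots> \<le> (\<Sum>p\<in>?E. excess \<alpha> \<beta> (T p))"
  proof (rule sum_mono)
    fix p assume "p \<in> ?E"
    then obtain i j where "p = (i, j)" "i < n" "j < n" "excess \<alpha> \<beta> (T (i, j)) \<noteq> 0" by blast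
    then show "1 \<le> excess \<alpha> \<beta> (T p)" using nonneg[OF rectD(1)[OF T, of i j]] by auto
  qed
  also have "\<dots> \<le> (\<Sum>p\<in>?A. excess \<alpha> \<beta> (T p))"
    using nonneg rectD(1)[OF T] by (intro sum_mono2) auto
  also have "\<dots> = (\<Sum>i<n. \<Sum>j<n. excess \<alpha> \<beta> (T (i, j)))"
    by (simp add: sum.cartesian_product)
  also have "\<dots> \<le> \<bar>\<alpha>\<bar> * int n + \<bar>\<beta>\<bar> * int n"
    unfolding sum_excess[OF T n n]
    by (intro add_mono mult_le_abs_mult abs_sum_of_bool_diff_le)
  also have "\<dots> = int (nat (\<bar>\<alpha>\<bar> + \<bar>\<beta>\<bar>) * n)" by (simp add: algebra_simps)
  finally show ?thesis by linarith
qed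

lemma card_union3_le:
  assumes "card X \<le> a" "card Y \<le> b" "card Z \<le> c"
  shows "card (X \<union> Y \<union> Z) \<le> a + b + c"
  using assms card_Un_le[of X Y] card_Un_le[of "X \<union> Y" Z] by linarith

text \<open>Besides the tiles of nonzero excess, the bottom row and the left column are recorded,
  which accounts for the 2 in \<open>K\<close>. Every other tile follows from its left and lower
  neighbors, by induction on i + j.\<close>

lemma entropy_zero_if_weights:
  assumes nonneg: "\<And>x. x \<in> B \<Longrightarrow> excess \<alpha> \<beta> x \<ge> 0"
    and inj: "\<And>x y. x \<in> B \<Longrightarrow> y \<in> B \<Longrightarrow> excess \<alpha> \<beta> x = 0 \<Longrightarrow> excess \<alpha> \<beta> y = 0 \<Longrightarrow>
      bottom_col x = bottom_col y \<Longrightarrow> left_col x = left_col y \<Longrightarrow> x = y"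
  shows "entropy B = 0"
proof (rule entropy_zero_if_determined[where K = "nat (\<bar>\<alpha>\<bar> + \<bar>\<beta>\<bar>) + 2"])
  let ?E = "\<lambda>n T. {(i, j). i < n \<and> j < n \<and> excess \<alpha> \<beta> (T (i, j)) \<noteq> 0}"
  let ?S = "\<lambda>n T. ?E n T \<union> {..<n} \<times> {0} \<union> {0} \<times> {..<n}"
  show "?S n T \<subseteq> {..<n} \<times> {..<n} \<and> ?S n T \<noteq> {} \<and> card (?S n T) \<le> (nat (\<bar>\<alpha>\<bar> + \<bar>\<beta>\<bar>) + 2) * n"
    if n: "n > 0" and T: "T \<in> rect n n B" for n T
  proof (intro conjI)
    have "card (?S n T) \<le> nat (\<bar>\<alpha>\<bar> + \<bar>\<beta>\<bar>) * n + n + n"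
      by (rule card_union3_le[OF card_excess_le[OF T n nonneg]]) (simp_all add: card_cartesian_product)
    then show "card (?S n T) \<le> (nat (\<bar>\<alpha>\<bar> + \<bar>\<beta>\<bar>) + 2) * n" by (simp add: algebra_simps)
  qed (use n in auto)
  fix n :: nat and T T' assume n: "n > 0" and T: "T \<in> rect n n B" and T': "T' \<in> rect n n B"
    and S: "?S n T = ?S n T'" and eq: "\<And>p. p \<in> ?S n T \<Longrightarrow> T p = T' p"
  have "i < n \<Longrightarrow> j < n \<Longrightarrow> T (i, j) = T' (i, j)" for i j
  proof (induction "i + j" arbitrary: i j rule: less_induct)
    case less
    show ?case
    proof (cases "(i, j) \<in> ?S n T")
      case True
      then show ?thesis by (rule eq)
    next
      case False
      \<comment> \<open>Both patterns have the same recorded positions, so both have excess zero at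
        this one.\<close>
      then have "(i, j) \<notin> ?S n T'" unfolding S .
      with False have *: "0 < i" "0 < j" "excess \<alpha> \<beta> (T (i, j)) = 0" "excess \<alpha> \<beta> (T' (i, j)) = 0"
        using less.prems by auto
      have l: "left_col (T (i, j)) = left_col (T' (i, j))"
        using less.hyps[of "i - 1" j] less.prems *(1)
          rectD(3)[OF T, of "i - 1" j] rectD(3)[OF T', of "i - 1" j] by simp
      have b: "bottom_col (T (i, j)) = bottom_col (T' (i, j))"
        using less.hyps[of i "j - 1"] less.prems *(2)
          rectD(4)[OF T, of i "j - 1"] rectD(4)[OF T', of i "j - 1"] by simp
      show ?thesis
        using inj rectD(1)[OF T] rectD(1)[OF T'] less.prems * l b by blast
    qed
  qed
  then show "T = T'" by (rule rect_eqI[OF T T'])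
qed

text \<open>Here a tile (0,0,1,1) forces the next tile on its diagonal to be (0,0,1,1) as well, so
  a pattern is determined by its boundary and the first such tile on every diagonal.\<close>

lemma entropy_zero_diagonal:
  defines "A \<equiv> (False, False, True, True) :: tile"
  assumes B: "B \<subseteq> {A, (False, True, False, False), (False, True, False, True), (True, False, False, False)}"
  shows "entropy B = 0"
proof (rule entropy_zero_if_determined[where K = 5])
  let ?E = "\<lambda>n T. {(i, j). i < n \<and> j < n \<and> T (i, j) = A \<and> (i = 0 \<or> j = 0 \<or> T (i - 1, j - 1) \<noteq> A)}"
  \<comment> \<open>Away from row 0 a bottom color is the top color of the tile below, which is 1
    only for \<open>A\<close>. Away from the last column a right color is the left color of the next
    tile, which is 0 exactly for \<open>A\<close> and for tiles with bottom color 1. So knowing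
    where \<open>A\<close> stands, row 0 and the last column suffices.\<close>
  let ?S = "\<lambda>n T. ?E n T \<union> {..<n} \<times> {0} \<union> ({n - 1} \<times> {..<n})"
  \<comment> \<open>The right neighbor of \<open>A\<close> has left color 1, hence top color 0; the
    upper neighbor has bottom color 1, hence right color 0. Bottom and left colors 0 leave only
    \<open>A\<close> for the diagonal successor.\<close>
  have diag: "T (Suc i, Suc j) = A"
    if T: "T \<in> rect n n B" and "T (i, j) = A" "Suc i < n" "Suc j < n" for T n i j
  proof -
    have "T (Suc i, j) \<in> B" "T (i, Suc j) \<in> B" "T (Suc i, Suc j) \<in> B"
      using rectD(1)[OF T] that by auto
    then show ?thesis
      using B rectD(3)[OF T, of i j] rectD(4)[OF T, of i j] rectD(3)[OF T, of i "Suc j"]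
        rectD(4)[OF T, of "Suc i" j] that unfolding A_def by auto
  qed
  have diag': "T (i + k, j + k) = A"
    if T: "T \<in> rect n n B" and "T (i, j) = A" "i + k < n" "j + k < n" for T n i j k
    using that(3,4)
  proof (induction k)
    case (Suc k)
    then show ?case using diag[OF T, of "i + k" "j + k"] by simp
  qed (use that in simp)
  show "?S n T \<subseteq> {..<n} \<times> {..<n} \<and> ?S n T \<noteq> {} \<and> card (?S n T) \<le> 5 * n"
    if n: "n > 0" and T: "T \<in> rect n n B" for n T
  proof (intro conjI)
    have "card (?E n T) \<le> card {..<2 * n}"
    \<comment> \<open>The number i + (n - j) < 2 n identifies the diagonal. Each diagonal has at
      most one first \<open>A\<close>, because an \<open>A\<close> is followed by \<open>A\<close>
      as far as the square reaches.\<close>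
    proof (rule card_inj_on_le[of "\<lambda>(i, j). i + (n - j)"])
      have no: "\<not> (i < i' \<and> i' - i = j' - j \<and> j < j')"
        if "(i, j) \<in> ?E n T" "(i', j') \<in> ?E n T" for i j i' j'
      proof
        assume *: "i < i' \<and> i' - i = j' - j \<and> j < j'"
        then have "T (i + (i' - 1 - i), j + (i' - 1 - i)) = A"
          using that by (intro diag'[OF T]) auto
        moreover have "i + (i' - 1 - i) = i' - 1" "j + (i' - 1 - i) = j' - 1" using * by auto
        ultimately show False using that(2) * by auto
      qed
      show "inj_on (\<lambda>(i, j). i + (n - j)) (?E n T)"
      proof (rule inj_onI)
        fix p p' assume p: "p \<in> ?E n T" "p' \<in> ?E n T"
          and eq: "(case p of (i, j) \<Rightarrow> i + (n - j)) = (case p' of (i, j) \<Rightarrow> i + (n - j))"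
        obtain i j i' j' where [simp]: "p = (i, j)" "p' = (i', j')" by (cases p; cases p') auto
        have jn: "j < n" "j' < n" using p by auto
        have "\<not> (i < i' \<and> i' - i = j' - j \<and> j < j')" "\<not> (i' < i \<and> i - i' = j - j' \<and> j' < j)"
          using no[of i j i' j'] no[of i' j' i j] p by simp_all
        moreover have "i + j' = i' + j" using eq jn by simp
        moreover from this have "i' - i = j' - j" "i - i' = j - j'" "i < i' \<longleftrightarrow> j < j'" "i' < i \<longleftrightarrow> j' < j"
          by linarith+
        ultimately show "p = p'" by auto
      qed
    qed auto
    then have "card (?S n T) \<le> 2 * n + n + n"
      by (intro card_union3_le) (simp_all add: card_cartesian_product)
    then show "card (?S n T) \<le> 5 * n" by simp
  qed (use n in auto)
  fix n :: nat and T T' assume n: "n > 0" and T: "T \<in> rect n n B" and T': "T' \<in> rect n n B"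
    and S: "?S n T = ?S n T'" and eq: "\<And>p. p \<in> ?S n T \<Longrightarrow> T p = T' p"
  \<comment> \<open>Going back along the diagonal in \<open>U\<close> ends at a first
    \<open>A\<close>, where \<open>U'\<close> has \<open>A\<close> too; from there \<open>A\<close>
    propagates forward in \<open>U'\<close>.\<close>
  have A: "U' (i, j) = A"
    if U': "U' \<in> rect n n B" and "i < n" "j < n" "U (i, j) = A"
      and first: "\<And>i j. i < n \<Longrightarrow> j < n \<Longrightarrow> U (i, j) = A \<Longrightarrow>
        i = 0 \<or> j = 0 \<or> U (i - 1, j - 1) \<noteq> A \<Longrightarrow> U' (i, j) = A" for U U' i j
    using that(2-4)
  proof (induction i arbitrary: j)
    case 0
    then show ?case using first by blast
  next
    case (Suc i)
    show ?case
    proof (cases "j = 0 \<or> U (i, j - 1) \<noteq> A")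
      case True
      then show ?thesis using first[of "Suc i" j] Suc.prems by simp
    next
      case False
      then obtain j' where j: "j = Suc j'" "U (i, j') = A" by (cases j) auto
      then have "U' (i, j') = A" using Suc by simp
      then show ?thesis using diag[OF U', of i j'] Suc.prems j by simp
    qed
  qed
  have E: "(i, j) \<in> ?S n U" if "i < n" "j < n" "U (i, j) = A" "i = 0 \<or> j = 0 \<or> U (i - 1, j - 1) \<noteq> A"
    for U i j
    using that by simp
  have "T' (i, j) = A" if "i < n" "j < n" "T (i, j) = A" for i j
  proof (rule A[of T' i j T, OF T' that])
    fix i j assume *: "i < n" "j < n" "T (i, j) = A" "i = 0 \<or> j = 0 \<or> T (i - 1, j - 1) \<noteq> A"
    show "T' (i, j) = A" using eq[OF E[of i j T, OF *]] *(3) by simp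
  qed
  moreover have "T (i, j) = A" if "i < n" "j < n" "T' (i, j) = A" for i j
  proof (rule A[of T i j T', OF T that])
    fix i j assume *: "i < n" "j < n" "T' (i, j) = A" "i = 0 \<or> j = 0 \<or> T' (i - 1, j - 1) \<noteq> A"
    have "(i, j) \<in> ?S n T" unfolding S by (rule E[OF *])
    from eq[OF this] show "T (i, j) = A" using *(3) by simp
  qed
  ultimately have A_iff: "T (i, j) = A \<longleftrightarrow> T' (i, j) = A" if "i < n" "j < n" for i j
    using that by blast
  have D_iff: "bottom_col (T (i, j)) \<longleftrightarrow> bottom_col (T' (i, j))" if "i < n" "j < n" for i j
  proof (cases j)
    case 0
    then show ?thesis using eq[of "(i, j)"] that by auto
  next
    case (Suc j')
    have "top_col (T (i, j')) = (T (i, j') = A)" "top_col (T' (i, j')) = (T' (i, j') = A)"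
      using B rectD(1)[OF T, of i j'] rectD(1)[OF T', of i j'] that Suc unfolding A_def by auto
    then show ?thesis
      using A_iff[of i j'] rectD(4)[OF T, of i j'] rectD(4)[OF T', of i j'] that Suc by simp
  qed
  have B_cases: "x = y" if "x \<in> B" "y \<in> B" "x = A \<longleftrightarrow> y = A" "bottom_col x = bottom_col y"
    "right_col x = right_col y" for x y
    using subsetD[OF B that(1)] subsetD[OF B that(2)] that(3-5) unfolding A_def by auto
  have left_iff: "left_col x \<longleftrightarrow> \<not> (x = A \<or> bottom_col x)" if "x \<in> B" for x
    using subsetD[OF B that] unfolding A_def by auto
  show "T = T'"
  proof (rule rect_eqI[OF T T'])
    fix i j assume ij: "i < n" "j < n"
    note mem = rectD(1)[OF T] rectD(1)[OF T']
    show "T (i, j) = T' (i, j)"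
    proof (cases "Suc i < n")
      case False
      then show ?thesis using ij by (intro eq) auto
    next
      case True
      then have "right_col (T (i, j)) = right_col (T' (i, j))"
        using rectD(3)[OF T True ij(2)] rectD(3)[OF T' True ij(2)] left_iff mem ij
          A_iff[OF True ij(2)] D_iff[OF True ij(2)] by simp
      then show ?thesis using B_cases mem ij A_iff D_iff by metis
    qed
  qed
qed

section \<open>Symmetries and periodic patterns\<close>

lemma entropy_reflect: "entropy (reflect_tile ` B) = entropy B"
  by (rule entropy_cong) (rule card_rect_reflect)

lemma entropy_permute:
  assumes "bij \<eta>"
  shows "entropy (permute_h \<eta> ` B) = entropy B" "entropy (permute_v \<eta> ` B) = entropy B"
  by (rule entropy_cong, rule card_rect_permute_h[OF assms],
      rule entropy_cong, rule card_rect_permute_v[OF assms])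

lemma entropy_nonneg: "entropy B \<ge> 0"
proof (cases "\<exists>a b. card (rect a b B) = 0")
  case True
  then show ?thesis using card_rect_pos_iff by (auto simp: entropy_def)
next
  case False
  then have pos: "card (rect a b B) > 0" for a b by (metis neq0_conv)
  have "0 \<le> (case x of (m, n) \<Rightarrow> ln (real (num_patterns m n B)) / (real m * real n))" for x
    using pos[of "fst x - 1" "snd x - 1"]
    by (auto simp: num_patterns_eq_rect case_prod_beta Suc_le_eq simp del: card_gt_0_iff
        intro!: divide_nonneg_nonneg ln_ge_zero)
  then show ?thesis
    by (intro tendsto_lowerbound[OF entropy_tendsto[OF pos]] always_eventually)
      (auto simp: prod_filter_eq_bot)
qed

lemma entropy_mono:
  assumes "A \<subseteq> B" shows "entropy A \<le> entropy B"
proof (cases "\<exists>a b. card (rect a b A) = 0")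
  case True
  then have "entropy A = 0" using card_rect_pos_iff by (auto simp: entropy_def)
  then show ?thesis using entropy_nonneg by simp
next
  case False
  then have posA: "card (rect a b A) > 0" for a b by (metis neq0_conv)
  have le: "card (rect a b A) \<le> card (rect a b B)" for a b
    by (intro card_mono rect_mono assms) simp
  have posB: "card (rect a b B) > 0" for a b using posA[of a b] le[of a b] by linarith
  have "ln (real (num_patterns m n A)) \<le> ln (real (num_patterns m n B))" for m n
    unfolding num_patterns_eq_rect
    by (intro ln_mono) (use posA[of "m - 1" "n - 1"] le[of "m - 1" "n - 1"] in linarith)+
  then show ?thesis
    by (intro tendsto_le[OF _ entropy_tendsto[OF posB] entropy_tendsto[OF posA]] always_eventually)
      (auto simp: prod_filter_eq_bot intro!: divide_right_mono)
qed

lemma entropy_pos_iff: "entropy B > 0 \<longleftrightarrow> entropy B \<noteq> 0"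
  using entropy_nonneg[of B] by linarith

section \<open>The symmetry group in normal form\<close>

lemma rotate_permute:
  "rotate_tile (permute_v \<eta> x) = permute_h \<eta> (rotate_tile x)"
  "rotate_tile (permute_h \<eta> x) = permute_v \<eta> (rotate_tile x)"
  and permute_commute: "permute_h \<eta> (permute_v \<eta>' x) = permute_v \<eta>' (permute_h \<eta> x)"
  by (cases x; simp)+

lemma reflect_permute:
  "reflect_tile (permute_v \<eta> x) = permute_v \<eta> (reflect_tile x)"
  "reflect_tile (permute_h \<eta> x) = permute_h \<eta> (reflect_tile x)"
  by (cases x; simp)+

lemma reflect_comp: "reflect_tile \<circ> rotate_tile = rotate_tile ^^ 3 \<circ> reflect_tile"
  by (auto simp: fun_eq_iff numeral_3_eq_3)

lemma permute_comp:
  "permute_h \<eta> \<circ> permute_v \<eta>' = permute_v \<eta>' \<circ> permute_h \<eta>"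
  "permute_v \<eta> \<circ> permute_v \<eta>' = permute_v (\<eta> \<circ> \<eta>')"
  "permute_h \<eta> \<circ> permute_h \<eta>' = permute_h (\<eta> \<circ> \<eta>')"
  by (auto simp: fun_eq_iff)

lemma rotate_funpow_mod: "rotate_tile ^^ (k mod 4) = rotate_tile ^^ k"
proof -
  have 4: "rotate_tile ^^ 4 = id" by (auto simp: fun_eq_iff numeral_eq_Suc)
  have "rotate_tile ^^ k = (rotate_tile ^^ 4) ^^ (k div 4) \<circ> rotate_tile ^^ (k mod 4)"
    by (simp add: funpow_mult flip: funpow_add)
  then show ?thesis by (simp add: 4)
qed

lemma reflect_funpow_mod: "reflect_tile ^^ (e mod 2) = reflect_tile ^^ e"
proof -
  have 2: "reflect_tile ^^ 2 = id" by (auto simp: fun_eq_iff numeral_eq_Suc)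
  have "reflect_tile ^^ e = (reflect_tile ^^ 2) ^^ (e div 2) \<circ> reflect_tile ^^ (e mod 2)"
    by (simp add: funpow_mult flip: funpow_add)
  then show ?thesis by (simp add: 2)
qed

definition symmetries :: "(tile \<Rightarrow> tile) list" where
  "symmetries = [permute_v v \<circ> permute_h h \<circ> (rotate_tile ^^ k) \<circ> (reflect_tile ^^ e).
     v \<leftarrow> [id, Not], h \<leftarrow> [id, Not], k \<leftarrow> [0, 1, 2, 3], e \<leftarrow> [0, 1]]"

lemma bij_bool_iff: "bij \<eta> \<longleftrightarrow> \<eta> = id \<or> \<eta> = Not"
proof
  assume "bij \<eta>"
  then have "\<eta> True \<noteq> \<eta> False" by (auto simp: bij_def inj_def)
  then show "\<eta> = id \<or> \<eta> = Not"
    by (cases "\<eta> True") (auto simp: fun_eq_iff all_bool_eq)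
next
  show "\<eta> = id \<or> \<eta> = Not \<Longrightarrow> bij \<eta>"
    by (auto simp: bij_def inj_def surj_def all_bool_eq ex_bool_eq)
qed

text \<open>With unrestricted exponents and arbitrary bijections, products need no reduction modulo
  4 and 2.\<close>

lemma in_symmetries_iff:
  "s \<in> set symmetries \<longleftrightarrow> (\<exists>v h k e. bij v \<and> bij h \<and>
     s = permute_v v \<circ> permute_h h \<circ> (rotate_tile ^^ k) \<circ> (reflect_tile ^^ e))"
  (is "?L \<longleftrightarrow> ?R")
proof
  assume ?L
  then show ?R unfolding symmetries_def bij_bool_iff
    by (simp only: set_concat set_map list.set UN_iff image_iff bex_simps) blast
next
  assume ?R
  then obtain v h k e where "bij v" "bij h"
    and s: "s = permute_v v \<circ> permute_h h \<circ> (rotate_tile ^^ (k mod 4)) \<circ> (reflect_tile ^^ (e mod 2))"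
    unfolding rotate_funpow_mod reflect_funpow_mod by blast
  moreover have "k mod 4 \<in> set [0, 1, 2, 3]" "e mod 2 \<in> set [0, 1]" by auto
  ultimately show ?L unfolding symmetries_def bij_bool_iff by fastforce
qed

lemma equiv_class_eq: "equiv_class A = (\<lambda>s. s ` A) ` set symmetries"
proof -
  have "X \<in> equiv_class A \<longleftrightarrow> X \<in> (\<lambda>s. s ` A) ` set symmetries" for X
  proof
    assume "X \<in> equiv_class A"
    then obtain \<tau> h v where "X = permute_v v ` permute_h h ` \<tau> ` A" "\<tau> \<in> D4" "bij h" "bij v"
      unfolding equiv_class_def by blast
    then obtain k e where "X = permute_v v ` permute_h h ` ((rotate_tile ^^ k) \<circ> (reflect_tile ^^ e)) ` A"
      unfolding D4_def by blast
    then have "X = (permute_v v \<circ> permute_h h \<circ> (rotate_tile ^^ k) \<circ> (reflect_tile ^^ e)) ` A"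
      by (simp add: image_comp o_assoc)
    moreover have "permute_v v \<circ> permute_h h \<circ> (rotate_tile ^^ k) \<circ> (reflect_tile ^^ e) \<in> set symmetries"
      unfolding in_symmetries_iff using \<open>bij h\<close> \<open>bij v\<close> by blast
    ultimately show "X \<in> (\<lambda>s. s ` A) ` set symmetries" by (rule image_eqI)
  next
    assume "X \<in> (\<lambda>s. s ` A) ` set symmetries"
    then obtain v h k e where *: "bij v" "bij h"
      "X = (permute_v v \<circ> permute_h h \<circ> (rotate_tile ^^ k) \<circ> (reflect_tile ^^ e)) ` A"
      by (auto simp: in_symmetries_iff)
    have "(rotate_tile ^^ (k mod 4)) \<circ> (reflect_tile ^^ (e mod 2)) \<in> D4"
      unfolding D4_def by (intro CollectI exI conjI refl) auto
    then have "(rotate_tile ^^ k) \<circ> (reflect_tile ^^ e) \<in> D4"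
      by (simp only: rotate_funpow_mod reflect_funpow_mod)
    moreover have "X = permute_v v ` permute_h h ` ((rotate_tile ^^ k) \<circ> (reflect_tile ^^ e)) ` A"
      using *(3) by (simp add: image_comp o_assoc)
    ultimately show "X \<in> equiv_class A" unfolding equiv_class_def using *(1,2) by blast
  qed
  then show ?thesis by blast
qed

lemma bij_symmetry:
  assumes "s \<in> set symmetries" shows "bij s"
proof -
  have "bij rotate_tile" "bij reflect_tile"
    using inj_rotate_tile inj_reflect_tile by (simp_all add: bij_def finite_UNIV_inj_surj)
  moreover have "bij (permute_h \<eta>)" "bij (permute_v \<eta>)" if "bij \<eta>" for \<eta>
    using inj_permute[OF that] by (simp_all add: bij_def finite_UNIV_inj_surj)
  ultimately show ?thesis
    using assms unfolding in_symmetries_iff by (auto intro!: bij_comp bij_fn)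
qed

text \<open>A generator is moved from the left to its place in the normal form. A quarter turn
  exchanges the two color permutations; a reflection inverts rotations, and the inverse of a quarter
  turn is its third power, whence the exponent 3 k.\<close>

lemma symmetry_comp_generator:
  assumes "s \<in> set symmetries"
  shows "bij \<eta> \<Longrightarrow> permute_v \<eta> \<circ> s \<in> set symmetries"
    and "bij \<eta> \<Longrightarrow> permute_h \<eta> \<circ> s \<in> set symmetries"
    and "rotate_tile \<circ> s \<in> set symmetries"
    and "reflect_tile \<circ> s \<in> set symmetries"
proof -
  obtain v h k e where vh: "bij v" "bij h"
    and s: "s = permute_v v \<circ> permute_h h \<circ> (rotate_tile ^^ k) \<circ> (reflect_tile ^^ e)"
    using assms unfolding in_symmetries_iff by blast
  show "permute_v \<eta> \<circ> s \<in> set symmetries" if "bij \<eta>"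
  proof -
    have "permute_v \<eta> \<circ> s = permute_v (\<eta> \<circ> v) \<circ> permute_h h \<circ> (rotate_tile ^^ k) \<circ> (reflect_tile ^^ e)"
      unfolding s by (simp only: o_assoc permute_comp)
    then show ?thesis unfolding in_symmetries_iff using bij_comp[OF vh(1) that] vh(2) by blast
  qed
  show "permute_h \<eta> \<circ> s \<in> set symmetries" if "bij \<eta>"
  proof -
    have "permute_h \<eta> \<circ> s = permute_v v \<circ> (permute_h \<eta> \<circ> permute_h h) \<circ> (rotate_tile ^^ k) \<circ> (reflect_tile ^^ e)"
      unfolding s by (simp only: o_assoc permute_comp(1))
    then have "permute_h \<eta> \<circ> s = permute_v v \<circ> permute_h (\<eta> \<circ> h) \<circ> (rotate_tile ^^ k) \<circ> (reflect_tile ^^ e)"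
      by (simp only: permute_comp(3))
    then show ?thesis unfolding in_symmetries_iff using bij_comp[OF vh(2) that] vh(1) by blast
  qed
  show "rotate_tile \<circ> s \<in> set symmetries"
  proof -
    have "rotate_tile \<circ> s = permute_v h \<circ> permute_h v \<circ> (rotate_tile ^^ Suc k) \<circ> (reflect_tile ^^ e)"
      unfolding s by (rule ext) (simp only: o_apply rotate_permute permute_commute funpow.simps)
    then show ?thesis unfolding in_symmetries_iff using vh by blast
  qed
  have ref: "reflect_tile \<circ> rotate_tile ^^ k = rotate_tile ^^ (3 * k) \<circ> reflect_tile" for k
  proof (induction k)
    case (Suc k)
    have "reflect_tile \<circ> rotate_tile ^^ Suc k = (reflect_tile \<circ> rotate_tile) \<circ> rotate_tile ^^ k"
      by (simp add: o_assoc)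
    also have "\<dots> = rotate_tile ^^ 3 \<circ> (reflect_tile \<circ> rotate_tile ^^ k)"
      unfolding reflect_comp by (simp add: o_assoc)
    also have "\<dots> = rotate_tile ^^ (3 + 3 * k) \<circ> reflect_tile"
      unfolding Suc funpow_add by (simp only: o_assoc)
    finally show ?case by (simp only: mult_Suc_right)
  qed simp
  show "reflect_tile \<circ> s \<in> set symmetries"
  proof -
    have "reflect_tile ((rotate_tile ^^ k) x) = (rotate_tile ^^ (3 * k)) (reflect_tile x)" for x
      using ref[of k] by (metis comp_apply)
    then have "reflect_tile \<circ> s = permute_v v \<circ> permute_h h \<circ> (rotate_tile ^^ (3 * k)) \<circ> (reflect_tile ^^ Suc e)"
      unfolding s by (intro ext) (simp only: o_apply reflect_permute funpow.simps)
    then show ?thesis unfolding in_symmetries_iff using vh by blast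
  qed
qed

lemma symmetry_comp:
  assumes "s \<in> set symmetries" "t \<in> set symmetries"
  shows "s \<circ> t \<in> set symmetries"
proof -
  obtain v h k e where vh: "bij v" "bij h"
    and s: "s = permute_v v \<circ> permute_h h \<circ> (rotate_tile ^^ k) \<circ> (reflect_tile ^^ e)"
    using assms(1) unfolding in_symmetries_iff by blast
  have "reflect_tile ^^ e \<circ> t \<in> set symmetries"
    using assms(2) symmetry_comp_generator(4) by (induction e) (auto simp: o_assoc[symmetric])
  then have "rotate_tile ^^ k \<circ> (reflect_tile ^^ e \<circ> t) \<in> set symmetries"
    using symmetry_comp_generator(3) by (induction k) (auto simp: o_assoc[symmetric])
  then have "permute_v v \<circ> (permute_h h \<circ> (rotate_tile ^^ k \<circ> (reflect_tile ^^ e \<circ> t))) \<in> set symmetries"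
    by (intro symmetry_comp_generator(1,2) vh)
  then show ?thesis unfolding s by (simp only: o_assoc)
qed

lemma id_symmetry: "id \<in> set symmetries"
proof -
  have "id = permute_v id \<circ> permute_h id \<circ> (rotate_tile ^^ 0) \<circ> (reflect_tile ^^ 0)"
    by (auto simp: fun_eq_iff)
  then show ?thesis unfolding in_symmetries_iff using bij_id by blast
qed

text \<open>A finite set of bijections closed under composition is a group: composing with s is an
  injective map of the set into itself, so it hits the identity.\<close>

lemma symmetry_inverse:
  assumes s: "s \<in> set symmetries"
  obtains t where "t \<in> set symmetries" "s \<circ> t = id" "t \<circ> s = id"
proof -
  have inj: "inj_on (\<lambda>t. s \<circ> t) (set symmetries)"
    using bij_symmetry[OF s] by (auto intro!: inj_onI simp: fun_eq_iff bij_def inj_eq)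
  have "(\<lambda>t. s \<circ> t) ` set symmetries = set symmetries"
    by (rule endo_inj_surj[OF _ _ inj]) (use symmetry_comp[OF s] in auto)
  then obtain t where t: "t \<in> set symmetries" "s \<circ> t = id" using id_symmetry by (metis imageE)
  moreover have "t \<circ> s = id"
    using t(2) bij_symmetry[OF s] by (metis bij_def inj_iff left_right_inverse_eq)
  ultimately show thesis by (rule that)
qed

lemma symmetry_vimage_image:
  assumes "s \<in> set symmetries"
  shows "s ` (s -` A) = A" "s -` (s ` A) = A"
  using bij_symmetry[OF assms] by (simp_all add: bij_def surj_image_vimage_eq inj_vimage_image_eq)

text \<open>Preimages are handier than images, since the flag of x in the preimage under s is the
  flag of the set at \<open>s x\<close>. Inversion in the group makes both descriptions of the class
  agree.\<close>

lemma equiv_class_vimage: "equiv_class A = (\<lambda>s. s -` A) ` set symmetries"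
proof -
  have *: "\<exists>t\<in>set symmetries. s ` A = t -` A" "\<exists>t\<in>set symmetries. s -` A = t ` A"
    if s: "s \<in> set symmetries" for s
  proof -
    obtain t where t: "t \<in> set symmetries" "s \<circ> t = id" "t \<circ> s = id"
      using symmetry_inverse[OF s] .
    have st: "s (t x) = x" "t (s x) = x" for x using t(2,3) by (metis comp_apply id_apply)+
    have "s ` A = t -` A" "s -` A = t ` A"
      by (auto simp: st image_iff) (metis st)+
    then show "\<exists>t\<in>set symmetries. s ` A = t -` A" "\<exists>t\<in>set symmetries. s -` A = t ` A"
      using t(1) by blast+
  qed
  show ?thesis unfolding equiv_class_eq
  proof (intro equalityI image_subsetI)
    fix s assume "s \<in> set symmetries"
    from *(1)[OF this] show "s ` A \<in> (\<lambda>s. s -` A) ` set symmetries" by (auto intro: image_eqI)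
  next
    fix s assume "s \<in> set symmetries"
    from *(2)[OF this] show "s -` A \<in> (\<lambda>s. s ` A) ` set symmetries" by (auto intro: image_eqI)
  qed
qed

lemma entropy_symmetry_image: "s \<in> set symmetries \<Longrightarrow> entropy (s ` A) = entropy A"
proof -
  assume "s \<in> set symmetries"
  then obtain v h k e where vh: "bij v" "bij h"
    and s: "s = permute_v v \<circ> permute_h h \<circ> (rotate_tile ^^ k) \<circ> (reflect_tile ^^ e)"
    unfolding in_symmetries_iff by blast
  have "entropy ((rotate_tile ^^ k) ` B) = entropy B" for B
    by (induction k) (simp_all only: funpow.simps image_id[unfolded id_def] id_def image_ident image_comp[symmetric] entropy_rotate)
  moreover have "entropy ((reflect_tile ^^ e) ` B) = entropy B" for B
    by (induction e) (simp_all only: funpow.simps image_id[unfolded id_def] id_def image_ident image_comp[symmetric] entropy_reflect)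
  ultimately show ?thesis unfolding s
    by (simp only: image_comp[symmetric] entropy_permute[OF vh(1)] entropy_permute[OF vh(2)])
qed

lemma entropy_symmetry: "s \<in> set symmetries \<Longrightarrow> entropy (s -` A) = entropy A"
  using entropy_symmetry_image[of s "s -` A"] by (simp only: symmetry_vimage_image)

lemma equiv_class_symmetry:
  assumes "s \<in> set symmetries" shows "equiv_class (s -` A) = equiv_class A"
proof -
  have *: "equiv_class (s -` A) \<subseteq> equiv_class A" if "s \<in> set symmetries" for s A
    unfolding equiv_class_vimage
    using symmetry_comp[OF that] by (auto simp: vimage_comp)
  obtain t where t: "t \<in> set symmetries" "s \<circ> t = id" using symmetry_inverse[OF assms] .
  have "equiv_class (t -` (s -` A)) \<subseteq> equiv_class (s -` A)" by (rule *[OF t(1)])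
  then show ?thesis using *[OF assms, of A] t(2) by (simp add: vimage_comp)
qed

lemma mem_equiv_class: "A \<in> equiv_class A"
  unfolding equiv_class_vimage by (rule image_eqI[OF _ id_symmetry]) simp

section \<open>Periodic patterns and minimal cycle generators\<close>

lemma no_periodic_pattern:
  assumes pos: "\<And>x. x \<in> D \<Longrightarrow> excess \<alpha> \<beta> x > 0"
  shows "periodic_patterns D = {}"
proof (rule ccontr)
  assume "periodic_patterns D \<noteq> {}"
  then obtain T where "T \<in> periodic_patterns D" by blast
  then have T: "T (i, j) \<in> D" "right_col (T (i, j)) = left_col (T (i + 1, j))"
      "top_col (T (i, j)) = bottom_col (T (i, j + 1))"
    and per: "\<exists>p\<ge>1. \<exists>q\<ge>1. \<forall>i j. T (i + p, j) = T (i, j) \<and> T (i, j + q) = T (i, j)" for i j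
    by (auto simp: periodic_patterns_def)
  obtain p where p: "1 \<le> p"
    and "\<exists>q\<ge>1. \<forall>i j. T (i + p, j) = T (i, j) \<and> T (i, j + q) = T (i, j)"
    using per by blast
  then obtain q where "1 \<le> q" "\<forall>i j. T (i + p, j) = T (i, j) \<and> T (i, j + q) = T (i, j)"
    by blast
  then have pq: "p \<ge> 1" "q \<ge> 1" "T (i + p, j) = T (i, j)" "T (i, j + q) = T (i, j)" for i j
    using p by auto
  define a b where "a = nat p" and "b = nat q"
  have ab: "a > 0" "b > 0" "int a = p" "int b = q" using pq(1,2) by (auto simp: a_def b_def)
  define V where "V = restrict (\<lambda>(i, j). T (int i, int j)) ({..<a} \<times> {..<b})"
  have V: "V \<in> rect a b D"
    unfolding V_def by (rule rectI) (use T in \<open>auto simp: add.commute\<close>)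
  have t: "top_col (V (i, b - 1)) = bottom_col (V (i, 0))" if "i < a" for i
    using that ab T(3)[of "int i" "int b - 1"] pq(4)[of "int i" 0] by (simp add: V_def of_nat_diff)
  have r: "right_col (V (a - 1, j)) = left_col (V (0, j))" if "j < b" for j
    using that ab T(2)[of "int a - 1" "int j"] pq(3)[of 0 "int j"] by (simp add: V_def of_nat_diff)
  have "(\<Sum>i<a. \<Sum>j<b. excess \<alpha> \<beta> (V (i, j))) = 0"
    unfolding sum_excess[OF V ab(1,2)] by (simp add: t r del: One_nat_def)
  moreover have "(\<Sum>i<a. \<Sum>j<b. excess \<alpha> \<beta> (V (i, j))) > 0"
    using ab rectD(1)[OF V] pos by (intro sum_pos) auto
  ultimately show False by simp
qed

lemma periodic_patterns_block:
  assumes "p > 0" "X \<noteq> []" "joins p X X" "set (concat X) \<subseteq> D"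
  shows "periodic_patterns D \<noteq> {}"
proof -
  define q where "q = length X"
  have q: "q > 0" using assms(2) by (simp add: q_def)
  define T where "T = (\<lambda>(i, j). X ! nat (j mod int q) ! nat (i mod int p))"
  have m: "nat (i mod int n) < n" if "n > 0" for i n using that by (simp add: nat_less_iff)
  have step: "nat ((i + 1) mod int n) = (if Suc (nat (i mod int n)) < n then Suc (nat (i mod int n)) else 0)"
    if "n > 0" for i n
  proof -
    define k where "k = nat (i mod int n)"
    have k: "i mod int n = int k" "k < n" using that by (auto simp: k_def nat_less_iff)
    have "(i + 1) mod int n = (i mod int n + 1) mod int n" by (simp add: mod_add_left_eq)
    also have "\<dots> = int (Suc k mod n)" by (simp add: k zmod_int add.commute)
    finally have "nat ((i + 1) mod int n) = Suc k mod n" by simp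
    then show ?thesis using k(2) unfolding k_def[symmetric] by (auto simp: mod_Suc)
  qed
  have "T \<in> periodic_patterns D"
    unfolding periodic_patterns_def
  proof (intro CollectI conjI allI)
    fix i j
    have "X ! nat (j mod int q) \<in> set X" using m[OF q] by (simp add: q_def)
    moreover have "T (i, j) \<in> set (X ! nat (j mod int q))"
      using m[OF assms(1), of i] joins_row_length[OF assms(3), of "nat (j mod int q)"] m[OF q, of j]
      by (simp add: T_def q_def)
    ultimately show "T (i, j) \<in> D" using assms(4) by auto
    show "right_col (T (i, j)) = left_col (T (i + 1, j))"
      using joinsD(1)[OF assms(3,3,1) m[OF assms(1), of i], of "nat (j mod int q)"] m[OF q, of j]
      by (simp add: T_def step[OF assms(1)] q_def)
    show "top_col (T (i, j)) = bottom_col (T (i, j + 1))"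
      using joinsD(2)[OF assms(3,3,1) m[OF assms(1), of i], of "nat (j mod int q)"] m[OF q, of j]
      by (simp add: T_def step[OF q] flip: q_def)
  next
    show "\<exists>p\<ge>1. \<exists>q\<ge>1. \<forall>i j. T (i + p, j) = T (i, j) \<and> T (i, j + q) = T (i, j)"
      using assms(1) q by (intro exI[of _ "int p"] exI[of _ "int q"] conjI allI) (auto simp: T_def)
  qed
  then show ?thesis by blast
qed

text \<open>An antichain inside a family that reaches below every member of the family consists of
  its minimal elements. This reduces minimality to finite checks on a list.\<close>

lemma min_cycle_gen_iff:
  assumes per: "\<And>C. C \<in> G \<Longrightarrow> periodic_patterns C \<noteq> {}"
    and ex: "\<And>D. periodic_patterns D \<noteq> {} \<Longrightarrow> \<exists>C\<in>G. C \<subseteq> D"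
    and anti: "\<And>C D. C \<in> G \<Longrightarrow> D \<in> G \<Longrightarrow> C \<subseteq> D \<Longrightarrow> C = D"
  shows "min_cycle_gen C \<longleftrightarrow> C \<in> G"
proof
  assume C: "min_cycle_gen C"
  then obtain D where D: "D \<in> G" "D \<subseteq> C" using ex[of C] unfolding min_cycle_gen_def by auto
  have "\<not> D \<subset> C" using C per[OF D(1)] unfolding min_cycle_gen_def by auto
  then show "C \<in> G" using D by auto
next
  assume C: "C \<in> G"
  have "periodic_patterns C' = {}" if "C' \<subset> C" for C'
  proof (rule ccontr)
    assume "periodic_patterns C' \<noteq> {}"
    then obtain D where "D \<in> G" "D \<subseteq> C'" using ex by blast
    then show False using anti[of D C] C that by blast
  qed
  then show "min_cycle_gen C" unfolding min_cycle_gen_def using per[OF C] by blast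
qed

lemma unions_upto_5_iff:
  "A \<in> unions_upto_5 \<longleftrightarrow> (\<exists>S. finite S \<and> S \<noteq> {} \<and> card S \<le> 5 \<and> (\<forall>C\<in>S. min_cycle_gen C) \<and> A = \<Union>S)"
proof
  assume "A \<in> unions_upto_5"
  then obtain k C where *: "1 \<le> k" "k \<le> 5" "different_min_cycle_gens k C" "A = (\<Union>i\<in>{1..k}. C i)"
    unfolding unions_upto_5_def by blast
  then have "card (C ` {1..k}) = k" by (simp add: card_image different_min_cycle_gens_def)
  with * show "\<exists>S. finite S \<and> S \<noteq> {} \<and> card S \<le> 5 \<and> (\<forall>C\<in>S. min_cycle_gen C) \<and> A = \<Union>S"
    by (intro exI[of _ "C ` {1..k}"]) (auto simp: different_min_cycle_gens_def)
next
  assume "\<exists>S. finite S \<and> S \<noteq> {} \<and> card S \<le> 5 \<and> (\<forall>C\<in>S. min_cycle_gen C) \<and> A = \<Union>S"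
  then obtain S where S: "finite S" "S \<noteq> {}" "card S \<le> 5" "\<forall>C\<in>S. min_cycle_gen C" "A = \<Union>S"
    by blast
  obtain C where C: "bij_betw C {1..card S} S" using ex_bij_betw_nat_finite_1[OF S(1)] by blast
  then have "different_min_cycle_gens (card S) C" "A = (\<Union>i\<in>{1..card S}. C i)"
    using S(4,5) by (auto simp: different_min_cycle_gens_def bij_betw_def)
  moreover have "1 \<le> card S" using S(1,2) by (simp add: Suc_le_eq card_gt_0_iff)
  ultimately show "A \<in> unions_upto_5" unfolding unions_upto_5_def using S(3) by blast
qed

section \<open>Search for canonical tile sets\<close>

text \<open>Tile sets are coded by flags for excluded and included tiles; \<open>U\<close> marks the undecided tiles of
  a partial set. The search decides the tiles from the end of the list \<open>tiles\<close>. The four tiles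
  that are minimal cycle generators by themselves come first, where the covering test starts.\<close>

datatype flag = E | I | U

definition tiles :: "tile list" where
  "tiles = [(True, True, True, True), (True, False, True, False),
    (False, True, False, True), (False, False, False, False),
    (True, True, True, False), (True, True, False, True),
    (True, True, False, False), (True, False, True, True),
    (True, False, False, True), (True, False, False, False),
    (False, True, True, True), (False, True, True, False),
    (False, True, False, False), (False, False, True, True),
    (False, False, True, False), (False, False, False, True)]"

lemma length_tiles [simp]: "length tiles = 16" by (simp add: tiles_def)

lemma set_tiles: "set tiles = UNIV"
proof -
  have "x \<in> set tiles" for x
  proof -
    obtain b l t r where "x = (b, l, t, r)" by (cases x)
    then show ?thesis by (cases b; cases l; cases t; cases r) (simp_all add: tiles_def)
  qed
  then show ?thesis by blast
qed

lemma distinct_tiles: "distinct tiles"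
  by (simp add: card_distinct set_tiles card_UNIV_tile)

definition lookup :: "flag list \<Rightarrow> tile \<Rightarrow> flag" where
  "lookup fs x = the (map_of (zip tiles fs) x)"

lemma lookup_nth: "length fs = 16 \<Longrightarrow> i < 16 \<Longrightarrow> lookup fs (tiles ! i) = fs ! i"
  by (simp add: lookup_def map_of_zip_nth distinct_tiles)

lemma tile_nth_cases: obtains i where "i < 16" "x = tiles ! i"
proof -
  have "x \<in> set tiles" by (simp add: set_tiles)
  then show thesis using that by (auto simp: in_set_conv_nth)
qed

lemma lookup_map: "lookup (map \<chi> tiles) x = \<chi> x"
  by (rule tile_nth_cases[of x]) (simp add: lookup_nth)

definition enc :: "tile set \<Rightarrow> flag list" where
  "enc A = map (\<lambda>x. if x \<in> A then I else E) tiles"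

lemma length_enc [simp]: "length (enc A) = 16" by (simp add: enc_def)

lemma lookup_enc: "lookup (enc A) x = (if x \<in> A then I else E)"
  unfolding enc_def by (rule lookup_map)

lemma inj_enc: "inj enc"
proof (rule injI)
  fix A B assume "enc A = enc B"
  then have "lookup (enc A) x = lookup (enc B) x" for x by simp
  then have "x \<in> A \<longleftrightarrow> x \<in> B" for x unfolding lookup_enc by (metis flag.distinct(1))
  then show "A = B" by blast
qed

lemma range_enc: "range enc = {fs. length fs = 16 \<and> U \<notin> set fs}"
proof (intro equalityI subsetI)
  fix fs assume "fs \<in> {fs. length fs = 16 \<and> U \<notin> set fs}"
  then have len: "length fs = 16" and U: "U \<notin> set fs" by auto
  have "fs ! i = (if tiles ! i \<in> {x. lookup fs x = I} then I else E)" if "i < 16" for i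
    using that len U by (cases "fs ! i") (auto simp: lookup_nth in_set_conv_nth)
  then have "fs = enc {x. lookup fs x = I}"
    by (intro nth_equalityI) (simp_all add: enc_def len)
  then show "fs \<in> range enc" by blast
qed (auto simp: enc_def)

text \<open>\<open>U\<close> obstructs on neither side: in \<open>cov\<close> a generator may use
  tiles that are already covered, and these carry \<open>U\<close>.\<close>

fun sub :: "flag list \<Rightarrow> flag list \<Rightarrow> bool" where
  "sub (I # fs) (E # gs) = False"
| "sub (_ # fs) (_ # gs) = sub fs gs"
| "sub _ _ = True"

lemma sub_iff:
  "length fs = length gs \<Longrightarrow> sub fs gs \<longleftrightarrow> (\<forall>i<length gs. fs ! i = I \<longrightarrow> gs ! i \<noteq> E)"
  by (induction fs gs rule: sub.induct) (auto simp: All_less_Suc2)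

lemma sub_enc: "sub (enc A) (enc B) \<longleftrightarrow> A \<subseteq> B"
proof -
  have "sub (enc A) (enc B) \<longleftrightarrow> (\<forall>x\<in>set tiles. x \<in> A \<longrightarrow> x \<in> B)"
    unfolding all_set_conv_all_nth by (subst sub_iff) (auto simp: enc_def)
  then show ?thesis by (auto simp: set_tiles)
qed

section \<open>Tests for containment and for covering by generators\<close>

definition any_sub :: "flag list list \<Rightarrow> flag list \<Rightarrow> bool" where
  "any_sub fss gs \<longleftrightarrow> (\<exists>fs\<in>set fss. sub fs gs)"

definition any_sup :: "flag list list \<Rightarrow> flag list \<Rightarrow> bool" where
  "any_sup fss gs \<longleftrightarrow> (\<exists>fs\<in>set fss. sub gs fs)"

fun pick :: "'a list list \<Rightarrow> flag list \<Rightarrow> 'a list" where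
  "pick (c # cs) (I # fs) = c"
| "pick (c # cs) (_ # fs) = pick cs fs"
| "pick _ _ = []"

lemma pick_nth:
  "length cs = length fs \<Longrightarrow> I \<in> set fs \<Longrightarrow> \<exists>i<length fs. fs ! i = I \<and> pick cs fs = cs ! i"
  by (induction cs fs rule: pick.induct) (auto simp: Ex_less_Suc2)

fun mark :: "flag list \<Rightarrow> flag list \<Rightarrow> flag list" where
  "mark (I # gs) (_ # fs) = U # mark gs fs"
| "mark (_ # gs) (f # fs) = f # mark gs fs"
| "mark _ fs = fs"

lemma length_mark [simp]: "length (mark gs fs) = length fs"
  by (induction gs fs rule: mark.induct) auto

lemma mark_nth:
  "length gs = length fs \<Longrightarrow> i < length fs \<Longrightarrow> mark gs fs ! i = (if gs ! i = I then U else fs ! i)"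
  by (induction gs fs arbitrary: i rule: mark.induct) (auto simp: less_Suc_eq_0_disj)

text \<open>In the second argument of \<open>cov\<close>, \<open>I\<close> marks the elements still to be covered, \<open>U\<close> those
  already covered, and \<open>E\<close> those which may not be covered.\<close>

primrec cov :: "nat \<Rightarrow> flag list list list \<Rightarrow> flag list \<Rightarrow> bool" where
  "cov 0 tab fs \<longleftrightarrow> I \<notin> set fs"
| "cov (Suc k) tab fs \<longleftrightarrow> (if I \<notin> set fs then True else
     (\<exists>g\<in>set (pick tab fs). sub g fs \<and> cov k tab (mark g fs)))"

fun all_done :: "flag list \<Rightarrow> bool" where
  "all_done (I # fs) = False"
| "all_done (_ # fs) = all_done fs"
| "all_done [] = True"

lemma all_done_iff: "all_done fs \<longleftrightarrow> I \<notin> set fs"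
  by (induction fs rule: all_done.induct) auto

text \<open>One list of candidates per tile: \<open>pick\<close> selects the list for the first
  uncovered tile, so \<open>cov\<close> branches only over generators that contain it.\<close>

definition cover_table :: "flag list list \<Rightarrow> flag list list list" where
  "cover_table gs = map (\<lambda>i. filter (\<lambda>g. g ! i = I) gs) [0..<16]"

text \<open>Every cover has a member through the first uncovered tile, so branching over the
  generators through that tile is exhaustive. Marking tiles with \<open>U\<close> instead of
  excluding them leaves them available to later generators.\<close>

lemma cov_iff:
  assumes gs: "\<And>g. g \<in> set gs \<Longrightarrow> length g = 16"
  shows "length fs = 16 \<Longrightarrow> cov k (cover_table gs) fs \<longleftrightarrow>
    (\<exists>S\<subseteq>set gs. card S \<le> k \<and> (\<forall>g\<in>S. sub g fs) \<and> (\<forall>i<16. fs ! i = I \<longrightarrow> (\<exists>g\<in>S. g ! i = I)))"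
    (is "_ \<Longrightarrow> _ \<longleftrightarrow> ?R k fs")
proof (induction k arbitrary: fs)
  case 0
  have fin: "S \<subseteq> set gs \<Longrightarrow> card S \<le> 0 \<longleftrightarrow> S = {}" for S
    using finite_subset[of S "set gs"] by auto
  have "?R 0 fs \<longleftrightarrow> (\<forall>i<16. fs ! i \<noteq> I)" by (metis fin card.empty empty_iff empty_subsetI)
  then show ?case using 0 by (auto simp: in_set_conv_nth)
next
  case (Suc k)
  show ?case
  proof (cases "I \<in> set fs")
    case False
    then have "?R (Suc k) fs" using Suc.prems by (intro exI[of _ "{}"]) (auto simp: in_set_conv_nth)
    then show ?thesis using False by simp
  next
    case True
    have lt: "length (cover_table gs) = length fs" using Suc.prems by (simp add: cover_table_def)
    obtain i0 where i0: "i0 < 16" "fs ! i0 = I" "pick (cover_table gs) fs = cover_table gs ! i0"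
      using pick_nth[OF lt True] Suc.prems by auto
    have pick: "set (pick (cover_table gs) fs) = {g \<in> set gs. g ! i0 = I}"
      using i0 by (auto simp: cover_table_def)
    have mark: "mark g fs ! i = (if g ! i = I then U else fs ! i)" if "g \<in> set gs" "i < 16" for g i
      using that mark_nth[of g fs i] gs Suc.prems by simp
    have sub: "sub g fs \<longleftrightarrow> (\<forall>i<16. g ! i = I \<longrightarrow> fs ! i \<noteq> E)"
      if "g \<in> set gs" "length fs = 16" for g fs
      using that gs by (simp add: sub_iff)
    have step: "(\<exists>g\<in>set gs. g ! i0 = I \<and> sub g fs \<and> ?R k (mark g fs)) \<longleftrightarrow> ?R (Suc k) fs"
    proof
      assume "\<exists>g\<in>set gs. g ! i0 = I \<and> sub g fs \<and> ?R k (mark g fs)"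
      then obtain g S where g: "g \<in> set gs" "sub g fs" and S: "S \<subseteq> set gs" "card S \<le> k"
        "\<forall>h\<in>S. sub h (mark g fs)" "\<forall>i<16. mark g fs ! i = I \<longrightarrow> (\<exists>h\<in>S. h ! i = I)"
        by blast
      have "sub h fs" if "h \<in> S" for h
      proof (subst sub)
        show "\<forall>i<16. h ! i = I \<longrightarrow> fs ! i \<noteq> E"
        proof (intro allI impI)
          fix i :: nat assume i: "i < 16" "h ! i = I"
          have "mark g fs ! i \<noteq> E" using S(1,3) that i sub[of h "mark g fs"] Suc.prems by auto
          then show "fs ! i \<noteq> E" using mark[OF g(1) i(1)] g sub[OF g(1) Suc.prems] i(1)
            by (auto split: if_splits)
        qed
      qed (use S that Suc.prems in auto)
      moreover have "\<forall>i<16. fs ! i = I \<longrightarrow> (\<exists>h\<in>insert g S. h ! i = I)"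
      proof (intro allI impI)
        fix i :: nat assume i: "i < 16" "fs ! i = I"
        then show "\<exists>h\<in>insert g S. h ! i = I" using S(4) mark[OF g(1) i(1)] by (cases "g ! i = I") auto
      qed
      moreover have "card (insert g S) \<le> Suc k"
        using S(2) card_insert_le_m1[of "Suc k" S g] by simp
      ultimately show "?R (Suc k) fs" using g S(1) by (intro exI[of _ "insert g S"]) auto
    next
      assume "?R (Suc k) fs"
      then obtain S where S: "S \<subseteq> set gs" "card S \<le> Suc k" "\<forall>g\<in>S. sub g fs"
        "\<forall>i<16. fs ! i = I \<longrightarrow> (\<exists>g\<in>S. g ! i = I)" by blast
      then obtain g where g: "g \<in> S" "g ! i0 = I" using i0 by blast
      have gs': "g \<in> set gs" using g S by blast
      have "finite S" using S(1) finite_subset by blast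
      then have "card (S - {g}) \<le> k" using S(2) g(1) by simp
      moreover have "sub h (mark g fs)" if "h \<in> S - {g}" for h
      proof (subst sub)
        show "\<forall>i<16. h ! i = I \<longrightarrow> mark g fs ! i \<noteq> E"
          using S(1,3) that sub[of h fs] Suc.prems mark[OF gs'] by auto
      qed (use S that Suc.prems in auto)
      moreover have "\<forall>i<16. mark g fs ! i = I \<longrightarrow> (\<exists>h\<in>S - {g}. h ! i = I)"
      proof (intro allI impI)
        fix i :: nat assume i: "i < 16" "mark g fs ! i = I"
        then have "g ! i \<noteq> I" "fs ! i = I" using mark[OF gs' i(1)] by (auto split: if_splits)
        then show "\<exists>h\<in>S - {g}. h ! i = I" using S(4) i(1) by blast
      qed
      ultimately have "?R k (mark g fs)" using S(1) by (intro exI[of _ "S - {g}"]) auto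
      then show "\<exists>g\<in>set gs. g ! i0 = I \<and> sub g fs \<and> ?R k (mark g fs)"
        using g gs' S(3) by blast
    qed
    show ?thesis
      unfolding step[symmetric] using True Suc.IH Suc.prems pick by auto
  qed
qed

lemma cov_enc_iff:
  "cov k (cover_table (map enc Cs)) (enc A) \<longleftrightarrow> (\<exists>S\<subseteq>set Cs. card S \<le> k \<and> A = \<Union>S)"
proof -
  have "cov k (cover_table (map enc Cs)) (enc A) \<longleftrightarrow>
    (\<exists>S\<subseteq>enc ` set Cs. card S \<le> k \<and> (\<forall>g\<in>S. sub g (enc A)) \<and>
      (\<forall>i<16. enc A ! i = I \<longrightarrow> (\<exists>g\<in>S. g ! i = I)))"
    by (subst cov_iff) auto
  also have "\<dots> \<longleftrightarrow> (\<exists>S\<subseteq>set Cs. card S \<le> k \<and> (\<forall>g\<in>enc ` S. sub g (enc A)) \<and>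
      (\<forall>i<16. enc A ! i = I \<longrightarrow> (\<exists>g\<in>enc ` S. g ! i = I)))"
  proof -
    have "(\<exists>S\<subseteq>enc ` set Cs. Q S) \<longleftrightarrow> (\<exists>S\<subseteq>set Cs. Q (enc ` S))" for Q
      by (auto simp: subset_image_iff)
    then show ?thesis by (simp only: card_image[OF inj_on_subset[OF inj_enc subset_UNIV]])
  qed
  also have "\<dots> \<longleftrightarrow> (\<exists>S\<subseteq>set Cs. card S \<le> k \<and> A = \<Union>S)"
  proof -
    have "(\<forall>g\<in>enc ` S. sub g (enc A)) \<and> (\<forall>i<16. enc A ! i = I \<longrightarrow> (\<exists>g\<in>enc ` S. g ! i = I)) \<longleftrightarrow>
        A = \<Union>S" for S
    proof -
      have "(\<forall>i<16. enc A ! i = I \<longrightarrow> (\<exists>g\<in>enc ` S. g ! i = I)) \<longleftrightarrow>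
          (\<forall>i<length tiles. tiles ! i \<in> A \<longrightarrow> (\<exists>C\<in>S. tiles ! i \<in> C))"
        by (auto simp: enc_def)
      also have "\<dots> \<longleftrightarrow> (\<forall>x\<in>set tiles. x \<in> A \<longrightarrow> (\<exists>C\<in>S. x \<in> C))"
        unfolding all_set_conv_all_nth ..
      finally show ?thesis by (auto simp: sub_enc set_tiles)
    qed
    then show ?thesis by simp
  qed
  finally show ?thesis .
qed

text \<open>The comparison stops with \<open>True\<close> at the first undecided flag, so that \<open>canonical\<close> never rejects
  a partial set that has a canonical completion.\<close>

fun ge :: "flag list \<Rightarrow> flag list \<Rightarrow> bool" where
  "ge (E # fs) (I # gs) = False"
| "ge (E # fs) (E # gs) = ge fs gs"
| "ge (I # fs) (I # gs) = ge fs gs"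
| "ge _ _ = True"

section \<open>Canonical representatives of the orbits\<close>

lemma ge_refine:
  "list_all2 (\<lambda>p q. p = U \<or> p = q) fs fs' \<Longrightarrow> list_all2 (\<lambda>p q. p = U \<or> p = q) gs gs' \<Longrightarrow>
     ge fs' gs' \<Longrightarrow> ge fs gs"
  by (induction fs' gs' arbitrary: fs gs rule: ge.induct) (auto simp: list_all2_Cons2)

text \<open>The flags as a binary number with the first flag most significant. Lexicographic
  comparison becomes comparison of numbers, and \<open>Max\<close> then yields a canonical set in
  every orbit.\<close>

primrec weight :: "flag list \<Rightarrow> nat" where
  "weight [] = 0"
| "weight (f # fs) = (if f = I then 2 ^ length fs else 0) + weight fs"

lemma weight_less: "weight fs < 2 ^ length fs"
  by (induction fs) auto

lemma ge_iff_weight: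
  "length fs = length gs \<Longrightarrow> U \<notin> set fs \<Longrightarrow> U \<notin> set gs \<Longrightarrow> ge fs gs \<longleftrightarrow> weight gs \<le> weight fs"
proof (induction fs gs rule: list_induct2)
  case (Cons f fs g gs)
  then show ?case
    using weight_less[of fs] weight_less[of gs] by (cases f; cases g) auto
qed simp

lemma ge_antisym:
  "length fs = length gs \<Longrightarrow> U \<notin> set fs \<Longrightarrow> U \<notin> set gs \<Longrightarrow> ge fs gs \<Longrightarrow> ge gs fs \<Longrightarrow> fs = gs"
proof (induction fs gs rule: list_induct2)
  case (Cons f fs g gs)
  then show ?case by (cases f; cases g) auto
qed simp

text \<open>The tiles are listed in the order in which the search decides them, so that the flags
  compared first are known early and comparisons fail early.\<close>

definition images :: "flag list \<Rightarrow> flag list list" where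
  "images fs = map (\<lambda>s. map (\<lambda>x. lookup fs (s x)) (rev tiles)) symmetries"

definition canonical :: "flag list \<Rightarrow> bool" where
  "canonical fs \<longleftrightarrow> (\<forall>gs\<in>set (images fs). ge (map (lookup fs) (rev tiles)) gs)"

fun all_ge :: "flag list \<Rightarrow> flag list list \<Rightarrow> bool" where
  "all_ge fs [] = True"
| "all_ge fs (gs # gss) = (if ge fs gs then all_ge fs gss else False)"

lemma all_ge_iff: "all_ge fs gss \<longleftrightarrow> (\<forall>gs\<in>set gss. ge fs gs)"
  by (induction gss) auto

lemma map_lookup_enc: "map (\<lambda>x. lookup (enc A) (s x)) (rev tiles) = rev (enc (s -` A))"
  by (simp only: lookup_enc) (simp add: enc_def rev_map)

lemma set_images_enc: "set (images (enc A)) = (\<lambda>s. rev (enc (s -` A))) ` set symmetries"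
  by (simp add: images_def map_lookup_enc)

lemma canonical_enc_iff:
  "canonical (enc A) \<longleftrightarrow> (\<forall>s\<in>set symmetries. ge (rev (enc A)) (rev (enc (s -` A))))"
  using map_lookup_enc[of A "\<lambda>x. x"] by (simp add: canonical_def set_images_enc vimage_def)

lemma rev_enc_props: "length (rev (enc A)) = 16" "U \<notin> set (rev (enc A))"
  by (auto simp: enc_def)

text \<open>Each of the two sets is the greatest in the orbit that they share.\<close>

lemma canonical_unique:
  assumes "s \<in> set symmetries" "canonical (enc A)" "canonical (enc (s -` A))"
  shows "s -` A = A"
proof -
  obtain t where t: "t \<in> set symmetries" "s \<circ> t = id" using symmetry_inverse[OF assms(1)] .
  have "t -` (s -` A) = A" using t(2) by (simp add: vimage_comp)
  then have "ge (rev (enc (s -` A))) (rev (enc A))"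
    using assms(3) t(1) unfolding canonical_enc_iff by metis
  moreover have "ge (rev (enc A)) (rev (enc (s -` A)))"
    using assms(1,2) unfolding canonical_enc_iff by blast
  ultimately have "rev (enc (s -` A)) = rev (enc A)"
    by (intro ge_antisym) (auto simp: rev_enc_props simp del: set_rev)
  then show ?thesis using inj_enc by (simp add: inj_eq)
qed

lemma canonical_exists: "\<exists>s\<in>set symmetries. canonical (enc (s -` A))"
proof -
  let ?w = "\<lambda>s. weight (rev (enc (s -` A)))"
  have ne: "?w ` set symmetries \<noteq> {}" using id_symmetry by (simp only: image_is_empty) force
  have "Max (?w ` set symmetries) \<in> ?w ` set symmetries" by (rule Max_in[OF _ ne]) simp
  then obtain s where s: "s \<in> set symmetries" "?w s = Max (?w ` set symmetries)" by auto
  have "ge (rev (enc (s -` A))) (rev (enc (t -` (s -` A))))" if "t \<in> set symmetries" for t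
  proof -
    have "?w (s \<circ> t) \<le> ?w s"
      unfolding s(2) by (rule Max_ge) (use symmetry_comp[OF s(1) that] in auto)
    then show ?thesis by (subst ge_iff_weight) (simp_all add: vimage_comp rev_enc_props del: set_rev)
  qed
  then show ?thesis using s(1) unfolding canonical_enc_iff by blast
qed

text \<open>The canonical sets are a system of representatives of the orbits, and \<open>P\<close>
  is constant on each orbit.\<close>

lemma card_equiv_classes:
  assumes inv: "\<And>s A. s \<in> set symmetries \<Longrightarrow> P A \<Longrightarrow> P (s -` A)"
  shows "card {equiv_class A | A. P A} = card {A. P A \<and> canonical (enc A)}"
proof -
  have "{equiv_class A | A. P A} = equiv_class ` {A. P A \<and> canonical (enc A)}"
  proof (intro equalityI subsetI)
    fix X assume "X \<in> {equiv_class A | A. P A}"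
    then obtain A where A: "P A" "X = equiv_class A" by blast
    obtain s where s: "s \<in> set symmetries" "canonical (enc (s -` A))" using canonical_exists by blast
    show "X \<in> equiv_class ` {A. P A \<and> canonical (enc A)}"
      by (rule image_eqI[of _ _ "s -` A"]) (use A s inv equiv_class_symmetry in auto)
  qed auto
  moreover have "inj_on equiv_class {A. P A \<and> canonical (enc A)}"
  proof (rule inj_onI)
    fix A B assume A: "A \<in> {A. P A \<and> canonical (enc A)}" and B: "B \<in> {A. P A \<and> canonical (enc A)}"
      and eq: "equiv_class A = equiv_class B"
    have "B \<in> equiv_class A" using mem_equiv_class eq by simp
    then obtain s where "s \<in> set symmetries" "B = s -` A" unfolding equiv_class_vimage by blast
    then show "A = B" using canonical_unique A B by blast
  qed
  ultimately show ?thesis by (simp add: card_image)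
qed

text \<open>The specification of \<open>search\<close> below, which visits the same sets in the same
  order but never forms the list.\<close>

primrec leaves :: "flag list \<Rightarrow> flag list \<Rightarrow> flag list list" where
  "leaves [] fs = (if canonical fs then [fs] else [])"
| "leaves (u # us) fs = (if canonical (u # us @ fs) then leaves us (I # fs) @ leaves us (E # fs) else [])"

text \<open>Cutting a branch loses no canonical set: replacing the decisions \<open>ds\<close> by
  \<open>U\<close> can only end a comparison earlier, and then with \<open>True\<close>.\<close>

lemma canonical_prefix:
  assumes "n + length fs = 16" "length ds = n" "canonical (ds @ fs)"
  shows "canonical (replicate n U @ fs)"
proof -
  have ref: "lookup (replicate n U @ fs) x = U \<or> lookup (replicate n U @ fs) x = lookup (ds @ fs) x" for x
    by (rule tile_nth_cases[of x]) (use assms in \<open>auto simp: lookup_nth nth_append\<close>)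
  have "ge (map (lookup (replicate n U @ fs)) (rev tiles)) (map (\<lambda>x. lookup (replicate n U @ fs) (s x)) (rev tiles))"
    if "s \<in> set symmetries" for s
  proof (rule ge_refine)
    show "ge (map (lookup (ds @ fs)) (rev tiles)) (map (\<lambda>x. lookup (ds @ fs) (s x)) (rev tiles))"
      using assms(3) that unfolding canonical_def images_def by simp
  qed (simp_all only: list_all2_map1 list_all2_map2 ref list.rel_refl)
  then show ?thesis unfolding canonical_def images_def by simp
qed

lemma set_leaves:
  "n + length fs = 16 \<Longrightarrow> set (leaves (replicate n U) fs) =
     {ds @ fs | ds. length ds = n \<and> U \<notin> set ds \<and> canonical (ds @ fs)}"
proof (induction n arbitrary: fs)
  case (Suc n)
  have split: "length ds = Suc n \<and> U \<notin> set ds \<longleftrightarrow>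
      (\<exists>d ds'. ds = ds' @ [d] \<and> length ds' = n \<and> U \<notin> set ds' \<and> (d = I \<or> d = E))" for ds
    by (cases ds rule: rev_cases) (auto, metis flag.exhaust)
  have "{ds @ fs | ds. length ds = Suc n \<and> U \<notin> set ds \<and> canonical (ds @ fs)} =
      {ds @ I # fs | ds. length ds = n \<and> U \<notin> set ds \<and> canonical (ds @ I # fs)} \<union>
      {ds @ E # fs | ds. length ds = n \<and> U \<notin> set ds \<and> canonical (ds @ E # fs)}" (is "?L = ?R")
    unfolding conj_assoc[symmetric] split by auto
  moreover have "?L = {}" if "\<not> canonical (U # replicate n U @ fs)"
    using that canonical_prefix[of "Suc n" fs] Suc.prems by auto
  ultimately show ?case using Suc by auto
qed auto

lemma distinct_leaves: "n + length fs = 16 \<Longrightarrow> distinct (leaves (replicate n U) fs)"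
proof (induction n arbitrary: fs)
  case (Suc n)
  have "set (leaves (replicate n U) (I # fs)) \<inter> set (leaves (replicate n U) (E # fs)) = {}"
    using Suc.prems set_leaves[of n "I # fs"] set_leaves[of n "E # fs"] by auto
  then show ?case using Suc by auto
qed auto

lemma set_leaves_all: "set (leaves (replicate 16 U) []) = enc ` {A. canonical (enc A)}"
proof -
  have "set (leaves (replicate 16 U) []) = {fs \<in> range enc. canonical fs}"
    by (subst set_leaves) (auto simp: range_enc)
  then show ?thesis by auto
qed

primrec search :: "(flag list \<Rightarrow> 'a \<Rightarrow> 'a) \<Rightarrow> flag list \<Rightarrow> flag list \<Rightarrow> 'a \<Rightarrow> 'a" where
  "search f [] fs acc = (if canonical fs then f fs acc else acc)"
| "search f (u # us) fs acc =
     (if canonical (u # us @ fs) then search f us (E # fs) (search f us (I # fs) acc) else acc)"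

lemma search_eq_fold: "search f us fs acc = fold f (leaves us fs) acc"
  by (induction us arbitrary: fs acc) auto

text \<open>The counters for positive and zero entropy start at 1, since \<^typ>\<open>num\<close> has no zero. The Boolean
  records whether every set visited has a certificate.\<close>

fun tally :: "bool \<Rightarrow> num \<times> num \<times> bool \<Rightarrow> num \<times> num \<times> bool" where
  "tally True (p, z, ok) = (Num.inc p, z, ok)"
| "tally False (p, z, ok) = (p, Num.inc z, ok)"

fun discard :: "num \<times> num \<times> bool \<Rightarrow> num \<times> num \<times> bool" where
  "discard (p, z, ok) = (p, z, False)"

text \<open>Every set must have a certificate, as the first claim concerns arbitrary tile sets, but
  only unions of at most five generators are tallied. The bound is written with \<open>Suc\<close>
  to match the equations of \<open>cov\<close>.\<close>

definition visit :: "flag list list \<Rightarrow> flag list list \<Rightarrow> flag list list list \<Rightarrow> flag list \<Rightarrow>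
    num \<times> num \<times> bool \<Rightarrow> num \<times> num \<times> bool" where
  "visit zs ps tab fs acc =
     (if any_sup zs fs then if cov (Suc (Suc (Suc (Suc (Suc 0))))) tab fs then tally False acc else acc
      else if any_sub ps fs then if cov (Suc (Suc (Suc (Suc (Suc 0))))) tab fs then tally True acc else acc
      else discard acc)"

lemma fold_visit:
  assumes "fold (visit zs ps tab) L (p, z, ok) = (p', z', True)"
  shows "\<forall>fs\<in>set L. any_sup zs fs \<or> any_sub ps fs"
    and "nat_of_num p' = nat_of_num p + length (filter (\<lambda>fs. cov 5 tab fs \<and> \<not> any_sup zs fs) L)"
    and "nat_of_num z' = nat_of_num z + length (filter (\<lambda>fs. cov 5 tab fs \<and> any_sup zs fs) L)"
proof -
  have five: "Suc (Suc (Suc (Suc (Suc 0)))) = 5" by simp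
  \<comment> \<open>A discarded set leaves a permanent \<open>False\<close>, so a final
    \<open>True\<close> vouches for every set visited.\<close>
  have bad: "fold (visit zs ps tab) L (p, z, False) \<noteq> (p', z', True)" for L p z p' z'
    by (induction L arbitrary: p z) (auto simp: visit_def)
  have "(\<forall>fs\<in>set L. any_sup zs fs \<or> any_sub ps fs) \<and>
    nat_of_num p' = nat_of_num p + length (filter (\<lambda>fs. cov 5 tab fs \<and> \<not> any_sup zs fs) L) \<and>
    nat_of_num z' = nat_of_num z + length (filter (\<lambda>fs. cov 5 tab fs \<and> any_sup zs fs) L)"
    using assms
  proof (induction L arbitrary: p z ok)
    case (Cons fs L)
    show ?case
      using Cons.prems Cons.IH bad
      unfolding fold_Cons comp_apply visit_def five
      by (auto simp: nat_of_num_inc split: if_splits)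
  qed simp
  then show "\<forall>fs\<in>set L. any_sup zs fs \<or> any_sub ps fs"
    and "nat_of_num p' = nat_of_num p + length (filter (\<lambda>fs. cov 5 tab fs \<and> \<not> any_sup zs fs) L)"
    and "nat_of_num z' = nat_of_num z + length (filter (\<lambda>fs. cov 5 tab fs \<and> any_sup zs fs) L)"
    by blast+
qed

lemma length_filter_leaves:
  "length (filter P (leaves (replicate 16 U) [])) = card {A. canonical (enc A) \<and> P (enc A)}"
proof -
  have "length (filter P (leaves (replicate 16 U) [])) = card (set (filter P (leaves (replicate 16 U) [])))"
    by (rule distinct_card[symmetric]) (simp add: distinct_leaves)
  also have "set (filter P (leaves (replicate 16 U) [])) = enc ` {A. canonical (enc A) \<and> P (enc A)}"
    unfolding set_filter set_leaves_all by auto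
  also have "card \<dots> = card {A. canonical (enc A) \<and> P (enc A)}"
    by (rule card_image) (rule inj_on_subset[OF inj_enc subset_UNIV])
  finally show ?thesis .
qed

section \<open>Evaluation on explicit flag lists\<close>

lemma lookup_literal:
  "lookup [x0, x1, x2, x3, x4, x5, x6, x7, x8, x9, x10, x11, x12, x13, x14, x15] (True, True, True, True) = x0"
  "lookup [x0, x1, x2, x3, x4, x5, x6, x7, x8, x9, x10, x11, x12, x13, x14, x15] (True, False, True, False) = x1"
  "lookup [x0, x1, x2, x3, x4, x5, x6, x7, x8, x9, x10, x11, x12, x13, x14, x15] (False, True, False, True) = x2"
  "lookup [x0, x1, x2, x3, x4, x5, x6, x7, x8, x9, x10, x11, x12, x13, x14, x15] (False, False, False, False) = x3"
  "lookup [x0, x1, x2, x3, x4, x5, x6, x7, x8, x9, x10, x11, x12, x13, x14, x15] (True, True, True, False) = x4"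
  "lookup [x0, x1, x2, x3, x4, x5, x6, x7, x8, x9, x10, x11, x12, x13, x14, x15] (True, True, False, True) = x5"
  "lookup [x0, x1, x2, x3, x4, x5, x6, x7, x8, x9, x10, x11, x12, x13, x14, x15] (True, True, False, False) = x6"
  "lookup [x0, x1, x2, x3, x4, x5, x6, x7, x8, x9, x10, x11, x12, x13, x14, x15] (True, False, True, True) = x7"
  "lookup [x0, x1, x2, x3, x4, x5, x6, x7, x8, x9, x10, x11, x12, x13, x14, x15] (True, False, False, True) = x8"
  "lookup [x0, x1, x2, x3, x4, x5, x6, x7, x8, x9, x10, x11, x12, x13, x14, x15] (True, False, False, False) = x9"
  "lookup [x0, x1, x2, x3, x4, x5, x6, x7, x8, x9, x10, x11, x12, x13, x14, x15] (False, True, True, True) = x10"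
  "lookup [x0, x1, x2, x3, x4, x5, x6, x7, x8, x9, x10, x11, x12, x13, x14, x15] (False, True, True, False) = x11"
  "lookup [x0, x1, x2, x3, x4, x5, x6, x7, x8, x9, x10, x11, x12, x13, x14, x15] (False, True, False, False) = x12"
  "lookup [x0, x1, x2, x3, x4, x5, x6, x7, x8, x9, x10, x11, x12, x13, x14, x15] (False, False, True, True) = x13"
  "lookup [x0, x1, x2, x3, x4, x5, x6, x7, x8, x9, x10, x11, x12, x13, x14, x15] (False, False, True, False) = x14"
  "lookup [x0, x1, x2, x3, x4, x5, x6, x7, x8, x9, x10, x11, x12, x13, x14, x15] (False, False, False, True) = x15"
  by (simp_all add: lookup_def tiles_def)

text \<open>The group action as 32 explicit permutations of 16 positions; after this no symmetry has
  to be applied to a tile during the search.\<close>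

lemma images_literal:
  "images [x0, x1, x2, x3, x4, x5, x6, x7, x8, x9, x10, x11, x12, x13, x14, x15] =
    [[x15, x14, x13, x12, x11, x10, x9, x8, x7, x6, x5, x4, x3, x2, x1, x0],
     [x12, x14, x11, x15, x13, x10, x9, x6, x4, x8, x5, x7, x3, x2, x1, x0],
     [x14, x12, x11, x9, x6, x4, x15, x13, x10, x8, x7, x5, x3, x1, x2, x0],
     [x9, x12, x6, x14, x11, x4, x15, x8, x5, x13, x7, x10, x3, x1, x2, x0],
     [x12, x9, x6, x15, x8, x5, x14, x11, x4, x13, x10, x7, x3, x2, x1, x0],
     [x15, x9, x8, x12, x6, x5, x14, x13, x7, x11, x10, x4, x3, x2, x1, x0],
     [x9, x15, x8, x14, x13, x7, x12, x6, x5, x11, x4, x10, x3, x1, x2, x0],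
     [x14, x15, x13, x9, x8, x7, x12, x11, x10, x6, x4, x5, x3, x1, x2, x0],
     [x7, x9, x8, x4, x6, x5, x14, x13, x15, x11, x10, x12, x1, x0, x3, x2],
     [x4, x9, x6, x7, x8, x5, x14, x11, x12, x13, x10, x15, x1, x0, x3, x2],
     [x9, x4, x6, x14, x11, x12, x7, x8, x5, x13, x15, x10, x1, x3, x0, x2],
     [x14, x4, x11, x9, x6, x12, x7, x13, x10, x8, x15, x5, x1, x3, x0, x2],
     [x4, x14, x11, x7, x13, x10, x9, x6, x12, x8, x5, x15, x1, x0, x3, x2],
     [x7, x14, x13, x4, x11, x10, x9, x8, x15, x6, x5, x12, x1, x0, x3, x2],
     [x14, x7, x13, x9, x8, x15, x4, x11, x10, x6, x12, x5, x1, x3, x0, x2],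
     [x9, x7, x8, x14, x13, x15, x4, x6, x5, x11, x12, x10, x1, x3, x0, x2],
     [x12, x10, x11, x15, x13, x14, x5, x6, x4, x8, x9, x7, x2, x3, x0, x1],
     [x15, x10, x13, x12, x11, x14, x5, x8, x7, x6, x9, x4, x2, x3, x0, x1],
     [x10, x15, x13, x5, x8, x7, x12, x11, x14, x6, x4, x9, x2, x0, x3, x1],
     [x5, x15, x8, x10, x13, x7, x12, x6, x9, x11, x4, x14, x2, x0, x3, x1],
     [x15, x5, x8, x12, x6, x9, x10, x13, x7, x11, x14, x4, x2, x3, x0, x1],
     [x12, x5, x6, x15, x8, x9, x10, x11, x4, x13, x14, x7, x2, x3, x0, x1],
     [x5, x12, x6, x10, x11, x4, x15, x8, x9, x13, x7, x14, x2, x0, x3, x1],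
     [x10, x12, x11, x5, x6, x4, x15, x13, x14, x8, x7, x9, x2, x0, x3, x1],
     [x4, x5, x6, x7, x8, x9, x10, x11, x12, x13, x14, x15, x0, x1, x2, x3],
     [x7, x5, x8, x4, x6, x9, x10, x13, x15, x11, x14, x12, x0, x1, x2, x3],
     [x5, x7, x8, x10, x13, x15, x4, x6, x9, x11, x12, x14, x0, x2, x1, x3],
     [x10, x7, x13, x5, x8, x15, x4, x11, x14, x6, x12, x9, x0, x2, x1, x3],
     [x7, x10, x13, x4, x11, x14, x5, x8, x15, x6, x9, x12, x0, x1, x2, x3],
     [x4, x10, x11, x7, x13, x14, x5, x6, x12, x8, x9, x15, x0, x1, x2, x3],
     [x10, x4, x11, x5, x6, x12, x7, x13, x14, x8, x15, x9, x0, x2, x1, x3],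
     [x5, x4, x6, x10, x11, x12, x7, x8, x9, x13, x15, x14, x0, x2, x1, x3]]"
  unfolding images_def symmetries_def
  by (simp only: list.map concat.simps append.simps o_apply id_apply numeral_2_eq_2 numeral_3_eq_3
      One_nat_def funpow.simps rotate_tile.simps reflect_tile.simps permute_h.simps permute_v.simps
      tiles_def rev.simps lookup_literal not_True_eq_False not_False_eq_True id_comp comp_id)

text \<open>Equality by pattern matching on constructors. It also rejects equal lists containing
  \<open>U\<close>, but for certificates only the implication from \<open>same\<close> to equality
  matters.\<close>

fun same :: "flag list \<Rightarrow> flag list \<Rightarrow> bool" where
  "same [] [] = True"
| "same (E # fs) (E # gs) = same fs gs"
| "same (I # fs) (I # gs) = same fs gs"
| "same _ _ = False"

lemma same_imp_eq: "same fs gs \<Longrightarrow> fs = gs"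
  by (induction fs gs rule: same.induct) auto

fun member :: "flag list \<Rightarrow> flag list list \<Rightarrow> bool" where
  "member fs [] = False"
| "member fs (gs # gss) = (if same fs gs then True else member fs gss)"

lemma member_imp_in_set: "member fs gss \<Longrightarrow> fs \<in> set gss"
  by (induction gss) (auto dest: same_imp_eq split: if_splits)

fun all_member :: "flag list list \<Rightarrow> flag list list \<Rightarrow> bool" where
  "all_member [] gss = True"
| "all_member (fs # fss) gss = (if member fs gss then all_member fss gss else False)"

lemma all_member_imp_subset: "all_member fss gss \<Longrightarrow> set fss \<subseteq> set gss"
  by (induction fss) (auto dest: member_imp_in_set split: if_splits)

fun closed_under_images :: "flag list list \<Rightarrow> flag list list \<Rightarrow> bool" where
  "closed_under_images [] gss = True"
| "closed_under_images (fs # fss) gss =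
     (if all_member (images fs) gss then closed_under_images fss gss else False)"

lemma closed_under_imagesD:
  "closed_under_images fss gss \<Longrightarrow> fs \<in> set fss \<Longrightarrow> set (images fs) \<subseteq> set gss"
  by (induction fss) (auto dest: all_member_imp_subset split: if_splits)

lemma canonical_literal:
  "canonical [x0, x1, x2, x3, x4, x5, x6, x7, x8, x9, x10, x11, x12, x13, x14, x15] = all_ge [x15, x14, x13, x12, x11, x10, x9, x8, x7, x6, x5, x4, x3, x2, x1, x0] (images [x0, x1, x2, x3, x4, x5, x6, x7, x8, x9, x10, x11, x12, x13, x14, x15])"
  by (simp only: canonical_def all_ge_iff tiles_def rev.simps append.simps list.map lookup_literal)

text \<open>Rewriting with the following equations is lazy: the simplifier evaluates the Boolean first
  argument of a step function before it unfolds the continuation, without the re-normalization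
  that conditional expressions and their congruence rule would cause.\<close>

definition "any_sub_step b fss gs \<longleftrightarrow> b \<or> any_sub fss gs"
definition "any_sup_step b fss gs \<longleftrightarrow> b \<or> any_sup fss gs"
definition "all_ge_step b fs gss \<longleftrightarrow> b \<and> all_ge fs gss"
definition "cov_any k tab fs gs \<longleftrightarrow> (\<exists>g\<in>set gs. sub g fs \<and> cov k tab (mark g fs))"
definition "cov_done b k tab fs \<longleftrightarrow> b \<or> cov_any k tab fs (pick tab fs)"
definition "cov_sub b k tab fs g gs \<longleftrightarrow> b \<and> cov k tab (mark g fs) \<or> cov_any k tab fs gs"
definition "cov_or b k tab fs gs \<longleftrightarrow> b \<or> cov_any k tab fs gs"
definition "tally_if b c acc = (if b then tally c acc else acc)"
definition "visit_pos b tab fs acc =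
  (if b then tally_if (cov (Suc (Suc (Suc (Suc (Suc 0))))) tab fs) True acc else discard acc)"
definition "visit_zero b ps tab fs acc =
  (if b then tally_if (cov (Suc (Suc (Suc (Suc (Suc 0))))) tab fs) False acc
   else visit_pos (any_sub ps fs) tab fs acc)"
definition "search_leaf b f fs acc = (if b then f fs acc else acc)"
definition "search_node b f us fs acc =
  (if b then search f us (E # fs) (search f us (I # fs) acc) else acc)"
definition "member_step b fs gss \<longleftrightarrow> b \<or> member fs gss"
definition "all_member_step b fss gss \<longleftrightarrow> b \<and> all_member fss gss"
definition "closed_step b fss gss \<longleftrightarrow> b \<and> closed_under_images fss gss"

lemma eval_simps:
  "any_sub [] gs = False" "any_sub (fs # fss) gs = any_sub_step (sub fs gs) fss gs"
  "any_sub_step True fss gs = True" "any_sub_step False fss gs = any_sub fss gs"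
  "any_sup [] gs = False" "any_sup (fs # fss) gs = any_sup_step (sub gs fs) fss gs"
  "any_sup_step True fss gs = True" "any_sup_step False fss gs = any_sup fss gs"
  "all_ge fs [] = True" "all_ge fs (gs # gss) = all_ge_step (ge fs gs) fs gss"
  "all_ge_step True fs gss = all_ge fs gss" "all_ge_step False fs gss = False"
  "cov 0 tab fs = all_done fs" "cov (Suc k) tab fs = cov_done (all_done fs) k tab fs"
  "cov_done True k tab fs = True" "cov_done False k tab fs = cov_any k tab fs (pick tab fs)"
  "cov_any k tab fs [] = False" "cov_any k tab fs (h # hs) = cov_sub (sub h fs) k tab fs h hs"
  "cov_sub True k tab fs h hs = cov_or (cov k tab (mark h fs)) k tab fs hs"
  "cov_sub False k tab fs h hs = cov_any k tab fs hs"
  "cov_or True k tab fs hs = True" "cov_or False k tab fs hs = cov_any k tab fs hs"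
  "tally_if True c acc = tally c acc" "tally_if False c acc = acc"
  "visit zs ps tab fs acc = visit_zero (any_sup zs fs) ps tab fs acc"
  "visit_zero True ps tab fs acc = tally_if (cov (Suc (Suc (Suc (Suc (Suc 0))))) tab fs) False acc"
  "visit_zero False ps tab fs acc = visit_pos (any_sub ps fs) tab fs acc"
  "visit_pos True tab fs acc = tally_if (cov (Suc (Suc (Suc (Suc (Suc 0))))) tab fs) True acc"
  "visit_pos False tab fs acc = discard acc"
  "search f [] fs acc = search_leaf (canonical fs) f fs acc"
  "search f (u # us) fs acc = search_node (canonical (u # us @ fs)) f us fs acc"
  "search_leaf True f fs acc = f fs acc" "search_leaf False f fs acc = acc"
  "search_node True f us fs acc = search f us (E # fs) (search f us (I # fs) acc)"
  "search_node False f us fs acc = acc"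
  "member fs [] = False" "member fs (gs # gss) = member_step (same fs gs) fs gss"
  "member_step True fs gss = True" "member_step False fs gss = member fs gss"
  "all_member [] gss = True" "all_member (fs # fss) gss = all_member_step (member fs gss) fss gss"
  "all_member_step True fss gss = all_member fss gss" "all_member_step False fss gss = False"
  "closed_under_images [] gss = True"
  "closed_under_images (fs # fss) gss = closed_step (all_member (images fs) gss) fss gss"
  "closed_step True fss gss = closed_under_images fss gss" "closed_step False fss gss = False"
  by (auto simp: any_sub_def any_sup_def any_sub_step_def any_sup_step_def all_ge_step_def cov_any_def
      cov_done_def cov_sub_def cov_or_def tally_if_def visit_def visit_pos_def visit_zero_def
      search_leaf_def search_node_def member_step_def all_member_step_def closed_step_def all_done_iff)

section \<open>Certificates\<close>

abbreviation (input) t0000 :: tile where "t0000 \<equiv> (False, False, False, False)"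
abbreviation (input) t0001 :: tile where "t0001 \<equiv> (False, False, False, True)"
abbreviation (input) t0010 :: tile where "t0010 \<equiv> (False, False, True, False)"
abbreviation (input) t0011 :: tile where "t0011 \<equiv> (False, False, True, True)"
abbreviation (input) t0100 :: tile where "t0100 \<equiv> (False, True, False, False)"
abbreviation (input) t0101 :: tile where "t0101 \<equiv> (False, True, False, True)"
abbreviation (input) t0110 :: tile where "t0110 \<equiv> (False, True, True, False)"
abbreviation (input) t0111 :: tile where "t0111 \<equiv> (False, True, True, True)"
abbreviation (input) t1000 :: tile where "t1000 \<equiv> (True, False, False, False)"
abbreviation (input) t1001 :: tile where "t1001 \<equiv> (True, False, False, True)"
abbreviation (input) t1010 :: tile where "t1010 \<equiv> (True, False, True, False)"
abbreviation (input) t1011 :: tile where "t1011 \<equiv> (True, False, True, True)"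
abbreviation (input) t1100 :: tile where "t1100 \<equiv> (True, True, False, False)"
abbreviation (input) t1101 :: tile where "t1101 \<equiv> (True, True, False, True)"
abbreviation (input) t1110 :: tile where "t1110 \<equiv> (True, True, True, False)"
abbreviation (input) t1111 :: tile where "t1111 \<equiv> (True, True, True, True)"

text \<open>Rows are listed from the bottom up; each block matches itself across its borders and so
  fills a torus. The 24 triangles come first, then the 10 opposite pairs, and at the end the 4 tiles
  with vector zero.\<close>

definition cycle_blocks :: "tile list list list" where
  "cycle_blocks =
    [[[t0011, t1101, t1110], [t1110, t0011, t1101], [t1101, t1110, t0011]],
     [[t0011, t1110, t1000], [t1110, t1000, t0011], [t1000, t0011, t1110]],
     [[t0010, t1001, t1110], [t1110, t0010, t1001], [t1001, t1110, t0010]],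
     [[t0011, t1110], [t1001, t1110]],
     [[t0010, t0001, t1100], [t1100, t0010, t0001], [t0001, t1100, t0010]],
     [[t0001, t0111, t1100], [t0111, t1100, t0001], [t1100, t0001, t0111]],
     [[t0111, t0100, t1001], [t1001, t0111, t0100], [t0100, t1001, t0111]],
     [[t0100, t0010, t1001], [t0010, t1001, t0100], [t1001, t0100, t0010]],
     [[t0111, t1110, t1001], [t1110, t1001, t0111], [t1001, t0111, t1110]],
     [[t0111, t0111], [t1001, t1100]],
     [[t0100, t0011, t1101], [t0011, t1101, t0100], [t1101, t0100, t0011]],
     [[t0011, t0100, t1000], [t1000, t0011, t0100], [t0100, t1000, t0011]],
     [[t0011, t0100], [t1001, t0100]],
     [[t0010, t0010], [t1001, t1100]],
     [[t0110, t1011, t1101], [t1011, t1101, t0110], [t1101, t0110, t1011]],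
     [[t0110, t0001, t1101], [t1101, t0110, t0001], [t0001, t1101, t0110]],
     [[t0001, t0110, t1000], [t0110, t1000, t0001], [t1000, t0001, t0110]],
     [[t0110, t1000, t1011], [t1011, t0110, t1000], [t1000, t1011, t0110]],
     [[t0001, t0110], [t0001, t1100]],
     [[t0110, t1011], [t1100, t1011]],
     [[t0111, t1100, t1011], [t1011, t0111, t1100], [t1100, t1011, t0111]],
     [[t0011, t0110], [t1101, t1101]],
     [[t0011, t0110], [t1000, t1000]],
     [[t0010, t1011, t1100], [t1011, t1100, t0010], [t1100, t0010, t1011]],
     [[t0001, t1110]],
     [[t0010], [t1101]],
     [[t0111], [t1101]],
     [[t0010], [t1000]],
     [[t0111], [t1000]],
     [[t1011, t1110]],
     [[t0011, t1100], [t1100, t0011]],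
     [[t0100, t1011]],
     [[t0001, t0100]],
     [[t0110, t1001], [t1001, t0110]],
     [[t1111]],
     [[t0000]],
     [[t1010]],
     [[t0101]]]"

definition generators :: "tile set list" where
  "generators = map (\<lambda>X. set (concat X)) cycle_blocks"

definition generator_flags :: "flag list list" where
  "generator_flags =
    [[E, E, E, E, I, I, E, E, E, E, E, E, E, I, E, E],
     [E, E, E, E, I, E, E, E, E, I, E, E, E, I, E, E],
     [E, E, E, E, I, E, E, E, I, E, E, E, E, E, I, E],
     [E, E, E, E, I, E, E, E, I, E, E, E, E, I, E, E],
     [E, E, E, E, E, E, I, E, E, E, E, E, E, E, I, I],
     [E, E, E, E, E, E, I, E, E, E, I, E, E, E, E, I],
     [E, E, E, E, E, E, E, E, I, E, I, E, I, E, E, E],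
     [E, E, E, E, E, E, E, E, I, E, E, E, I, E, I, E],
     [E, E, E, E, I, E, E, E, I, E, I, E, E, E, E, E],
     [E, E, E, E, E, E, I, E, I, E, I, E, E, E, E, E],
     [E, E, E, E, E, I, E, E, E, E, E, E, I, I, E, E],
     [E, E, E, E, E, E, E, E, E, I, E, E, I, I, E, E],
     [E, E, E, E, E, E, E, E, I, E, E, E, I, I, E, E],
     [E, E, E, E, E, E, I, E, I, E, E, E, E, E, I, E],
     [E, E, E, E, E, I, E, I, E, E, E, I, E, E, E, E],
     [E, E, E, E, E, I, E, E, E, E, E, I, E, E, E, I],
     [E, E, E, E, E, E, E, E, E, I, E, I, E, E, E, I],
     [E, E, E, E, E, E, E, I, E, I, E, I, E, E, E, E],
     [E, E, E, E, E, E, I, E, E, E, E, I, E, E, E, I],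
     [E, E, E, E, E, E, I, I, E, E, E, I, E, E, E, E],
     [E, E, E, E, E, E, I, I, E, E, I, E, E, E, E, E],
     [E, E, E, E, E, I, E, E, E, E, E, I, E, I, E, E],
     [E, E, E, E, E, E, E, E, E, I, E, I, E, I, E, E],
     [E, E, E, E, E, E, I, I, E, E, E, E, E, E, I, E],
     [E, E, E, E, I, E, E, E, E, E, E, E, E, E, E, I],
     [E, E, E, E, E, I, E, E, E, E, E, E, E, E, I, E],
     [E, E, E, E, E, I, E, E, E, E, I, E, E, E, E, E],
     [E, E, E, E, E, E, E, E, E, I, E, E, E, E, I, E],
     [E, E, E, E, E, E, E, E, E, I, I, E, E, E, E, E],
     [E, E, E, E, I, E, E, I, E, E, E, E, E, E, E, E],
     [E, E, E, E, E, E, I, E, E, E, E, E, E, I, E, E],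
     [E, E, E, E, E, E, E, I, E, E, E, E, I, E, E, E],
     [E, E, E, E, E, E, E, E, E, E, E, E, I, E, E, I],
     [E, E, E, E, E, E, E, E, I, E, E, I, E, E, E, E],
     [I, E, E, E, E, E, E, E, E, E, E, E, E, E, E, E],
     [E, E, E, I, E, E, E, E, E, E, E, E, E, E, E, E],
     [E, I, E, E, E, E, E, E, E, E, E, E, E, E, E, E],
     [E, E, I, E, E, E, E, E, E, E, E, E, E, E, E, E]]"

lemma generator_flags_eq: "map enc generators = generator_flags"
  by code_simp

lemma cover_table_literal: "cover_table generator_flags =
    [[[I, E, E, E, E, E, E, E, E, E, E, E, E, E, E, E]],
     [[E, I, E, E, E, E, E, E, E, E, E, E, E, E, E, E]],
     [[E, E, I, E, E, E, E, E, E, E, E, E, E, E, E, E]],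
     [[E, E, E, I, E, E, E, E, E, E, E, E, E, E, E, E]],
     [[E, E, E, E, I, I, E, E, E, E, E, E, E, I, E, E],
      [E, E, E, E, I, E, E, E, E, I, E, E, E, I, E, E],
      [E, E, E, E, I, E, E, E, I, E, E, E, E, E, I, E],
      [E, E, E, E, I, E, E, E, I, E, E, E, E, I, E, E],
      [E, E, E, E, I, E, E, E, I, E, I, E, E, E, E, E],
      [E, E, E, E, I, E, E, E, E, E, E, E, E, E, E, I],
      [E, E, E, E, I, E, E, I, E, E, E, E, E, E, E, E]],
     [[E, E, E, E, I, I, E, E, E, E, E, E, E, I, E, E],
      [E, E, E, E, E, I, E, E, E, E, E, E, I, I, E, E],
      [E, E, E, E, E, I, E, I, E, E, E, I, E, E, E, E],
      [E, E, E, E, E, I, E, E, E, E, E, I, E, E, E, I],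
      [E, E, E, E, E, I, E, E, E, E, E, I, E, I, E, E],
      [E, E, E, E, E, I, E, E, E, E, E, E, E, E, I, E],
      [E, E, E, E, E, I, E, E, E, E, I, E, E, E, E, E]],
     [[E, E, E, E, E, E, I, E, E, E, E, E, E, E, I, I],
      [E, E, E, E, E, E, I, E, E, E, I, E, E, E, E, I],
      [E, E, E, E, E, E, I, E, I, E, I, E, E, E, E, E],
      [E, E, E, E, E, E, I, E, I, E, E, E, E, E, I, E],
      [E, E, E, E, E, E, I, E, E, E, E, I, E, E, E, I],
      [E, E, E, E, E, E, I, I, E, E, E, I, E, E, E, E],
      [E, E, E, E, E, E, I, I, E, E, I, E, E, E, E, E],
      [E, E, E, E, E, E, I, I, E, E, E, E, E, E, I, E],
      [E, E, E, E, E, E, I, E, E, E, E, E, E, I, E, E]],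
     [[E, E, E, E, E, I, E, I, E, E, E, I, E, E, E, E],
      [E, E, E, E, E, E, E, I, E, I, E, I, E, E, E, E],
      [E, E, E, E, E, E, I, I, E, E, E, I, E, E, E, E],
      [E, E, E, E, E, E, I, I, E, E, I, E, E, E, E, E],
      [E, E, E, E, E, E, I, I, E, E, E, E, E, E, I, E],
      [E, E, E, E, I, E, E, I, E, E, E, E, E, E, E, E],
      [E, E, E, E, E, E, E, I, E, E, E, E, I, E, E, E]],
     [[E, E, E, E, I, E, E, E, I, E, E, E, E, E, I, E],
      [E, E, E, E, I, E, E, E, I, E, E, E, E, I, E, E],
      [E, E, E, E, E, E, E, E, I, E, I, E, I, E, E, E],
      [E, E, E, E, E, E, E, E, I, E, E, E, I, E, I, E],
      [E, E, E, E, I, E, E, E, I, E, I, E, E, E, E, E],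
      [E, E, E, E, E, E, I, E, I, E, I, E, E, E, E, E],
      [E, E, E, E, E, E, E, E, I, E, E, E, I, I, E, E],
      [E, E, E, E, E, E, I, E, I, E, E, E, E, E, I, E],
      [E, E, E, E, E, E, E, E, I, E, E, I, E, E, E, E]],
     [[E, E, E, E, I, E, E, E, E, I, E, E, E, I, E, E],
      [E, E, E, E, E, E, E, E, E, I, E, E, I, I, E, E],
      [E, E, E, E, E, E, E, E, E, I, E, I, E, E, E, I],
      [E, E, E, E, E, E, E, I, E, I, E, I, E, E, E, E],
      [E, E, E, E, E, E, E, E, E, I, E, I, E, I, E, E],
      [E, E, E, E, E, E, E, E, E, I, E, E, E, E, I, E],
      [E, E, E, E, E, E, E, E, E, I, I, E, E, E, E, E]],
     [[E, E, E, E, E, E, I, E, E, E, I, E, E, E, E, I],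
      [E, E, E, E, E, E, E, E, I, E, I, E, I, E, E, E],
      [E, E, E, E, I, E, E, E, I, E, I, E, E, E, E, E],
      [E, E, E, E, E, E, I, E, I, E, I, E, E, E, E, E],
      [E, E, E, E, E, E, I, I, E, E, I, E, E, E, E, E],
      [E, E, E, E, E, I, E, E, E, E, I, E, E, E, E, E],
      [E, E, E, E, E, E, E, E, E, I, I, E, E, E, E, E]],
     [[E, E, E, E, E, I, E, I, E, E, E, I, E, E, E, E],
      [E, E, E, E, E, I, E, E, E, E, E, I, E, E, E, I],
      [E, E, E, E, E, E, E, E, E, I, E, I, E, E, E, I],
      [E, E, E, E, E, E, E, I, E, I, E, I, E, E, E, E],
      [E, E, E, E, E, E, I, E, E, E, E, I, E, E, E, I],
      [E, E, E, E, E, E, I, I, E, E, E, I, E, E, E, E],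
      [E, E, E, E, E, I, E, E, E, E, E, I, E, I, E, E],
      [E, E, E, E, E, E, E, E, E, I, E, I, E, I, E, E],
      [E, E, E, E, E, E, E, E, I, E, E, I, E, E, E, E]],
     [[E, E, E, E, E, E, E, E, I, E, I, E, I, E, E, E],
      [E, E, E, E, E, E, E, E, I, E, E, E, I, E, I, E],
      [E, E, E, E, E, I, E, E, E, E, E, E, I, I, E, E],
      [E, E, E, E, E, E, E, E, E, I, E, E, I, I, E, E],
      [E, E, E, E, E, E, E, E, I, E, E, E, I, I, E, E],
      [E, E, E, E, E, E, E, I, E, E, E, E, I, E, E, E],
      [E, E, E, E, E, E, E, E, E, E, E, E, I, E, E, I]],
     [[E, E, E, E, I, I, E, E, E, E, E, E, E, I, E, E],
      [E, E, E, E, I, E, E, E, E, I, E, E, E, I, E, E],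
      [E, E, E, E, I, E, E, E, I, E, E, E, E, I, E, E],
      [E, E, E, E, E, I, E, E, E, E, E, E, I, I, E, E],
      [E, E, E, E, E, E, E, E, E, I, E, E, I, I, E, E],
      [E, E, E, E, E, E, E, E, I, E, E, E, I, I, E, E],
      [E, E, E, E, E, I, E, E, E, E, E, I, E, I, E, E],
      [E, E, E, E, E, E, E, E, E, I, E, I, E, I, E, E],
      [E, E, E, E, E, E, I, E, E, E, E, E, E, I, E, E]],
     [[E, E, E, E, I, E, E, E, I, E, E, E, E, E, I, E],
      [E, E, E, E, E, E, I, E, E, E, E, E, E, E, I, I],
      [E, E, E, E, E, E, E, E, I, E, E, E, I, E, I, E],
      [E, E, E, E, E, E, I, E, I, E, E, E, E, E, I, E],
      [E, E, E, E, E, E, I, I, E, E, E, E, E, E, I, E],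
      [E, E, E, E, E, I, E, E, E, E, E, E, E, E, I, E],
      [E, E, E, E, E, E, E, E, E, I, E, E, E, E, I, E]],
     [[E, E, E, E, E, E, I, E, E, E, E, E, E, E, I, I],
      [E, E, E, E, E, E, I, E, E, E, I, E, E, E, E, I],
      [E, E, E, E, E, I, E, E, E, E, E, I, E, E, E, I],
      [E, E, E, E, E, E, E, E, E, I, E, I, E, E, E, I],
      [E, E, E, E, E, E, I, E, E, E, E, I, E, E, E, I],
      [E, E, E, E, I, E, E, E, E, E, E, E, E, E, E, I],
      [E, E, E, E, E, E, E, E, E, E, E, E, I, E, E, I]]]"
  by code_simp

lemma cycle_blocks_ok:
  "\<forall>X\<in>set cycle_blocks. X \<noteq> [] \<and> length (hd X) > 0 \<and> joins (length (hd X)) X X"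
  by code_simp

lemma generators_antichain: "\<forall>f\<in>set generator_flags. \<forall>g\<in>set generator_flags. sub f g \<longrightarrow> f = g"
  by code_simp

text \<open>This makes minimal cycle generators invariant under the symmetries without transporting
  periodic patterns. The reversal is there because \<open>images\<close> lists the tiles
  backwards.\<close>

lemma generators_symmetric: "closed_under_images generator_flags (map rev generator_flags)"
  unfolding generator_flags_def
  by (simp only: list.map rev.simps append.simps eval_simps same.simps images_literal)

text \<open>Enough minimal tile sets of positive entropy to meet all canonical ones, each with two blocks
  that have the same periodic border.\<close>

definition pos_certs :: "(flag list \<times> tile list list \<times> tile list list) list" where
  "pos_certs =
    [([E, E, E, I, E, E, E, E, E, E, E, E, I, E, E, I],
      [[t0000, t0000]],
      [[t0001, t0100]]),
     ([E, E, E, E, E, E, E, E, I, E, E, E, I, E, I, I],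
      [[t0001, t0100, t0010, t1001, t0100], [t0001, t0100, t1001, t0100, t0010], [t0100, t0001, t0100, t0010, t1001]],
      [[t0010, t0001, t0100, t1001, t0100], [t1001, t0100, t0001, t0100, t0010], [t0100, t0001, t0100, t0010, t1001]]),
     ([E, E, E, I, E, E, I, E, E, E, E, E, E, E, I, I],
      [[t0000, t0000], [t0000, t0000]],
      [[t0000, t0010], [t0001, t1100]]),
     ([E, E, E, E, E, E, E, E, E, I, E, E, I, E, I, I],
      [[t0001, t0100], [t0001, t0100]],
      [[t0010, t0010], [t1000, t1000]]),
     ([E, E, E, E, E, I, E, E, E, E, E, I, E, I, I, E],
      [[t0010, t0010], [t1101, t1101]],
      [[t0011, t0110], [t1101, t1101]]),
     ([E, E, I, E, E, E, E, E, E, E, E, E, I, E, E, I],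
      [[t0100, t0001]],
      [[t0101, t0101]]),
     ([E, E, I, I, E, E, E, E, I, E, E, I, E, E, E, E],
      [[t1001, t0101, t0110], [t0110, t0000, t1001]],
      [[t1001, t0110, t0000], [t0110, t1001, t0101]]),
     ([E, E, E, E, E, E, I, E, E, E, E, E, I, I, E, I],
      [[t0001, t0100], [t0100, t0001]],
      [[t0011, t0100], [t1100, t0001]]),
     ([E, I, E, I, I, E, E, E, E, E, E, E, E, E, E, I],
      [[t0000, t1010]],
      [[t0001, t1110]]),
     ([E, E, E, I, E, E, I, E, E, E, E, I, E, E, E, I],
      [[t0000, t0000], [t0000, t0000]],
      [[t0001, t0110], [t0001, t1100]]),
     ([E, E, E, E, E, E, I, E, E, E, E, I, E, I, I, I],
      [[t0001, t1100, t0001, t1100, t0010], [t0010, t0001, t0110, t0001, t1100], [t1100, t0011, t1100, t0010, t0001]],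
      [[t0001, t1100, t0011, t1100, t0010], [t0010, t0001, t1100, t0001, t1100], [t1100, t0010, t0001, t0110, t0001]]),
     ([E, E, E, E, I, E, E, E, I, E, E, E, E, I, E, I],
      [[t0001, t1110], [t0001, t1110]],
      [[t0011, t1110], [t1001, t1110]]),
     ([I, I, E, E, E, I, E, E, E, E, E, E, E, E, I, E],
      [[t1101], [t0010]],
      [[t1111], [t1010]]),
     ([E, E, E, E, I, I, E, E, E, E, E, E, E, I, I, I],
      [[t1101, t1110, t0001], [t0001, t1110, t0010], [t0011, t1101, t1110], [t1110, t0011, t1101]],
      [[t1101, t1110, t0011], [t0001, t1101, t1110], [t0010, t0001, t1110], [t1110, t0011, t1101]]),
     ([I, I, E, E, E, E, E, E, I, E, E, I, E, E, E, E],
      [[t1001, t1111, t0110], [t0110, t1010, t1001]],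
      [[t1010, t1001, t0110], [t1111, t0110, t1001]]),
     ([E, E, I, I, E, I, E, E, E, E, E, E, E, E, I, E],
      [[t0000], [t0101]],
      [[t0010], [t1101]]),
     ([E, E, E, E, E, I, E, E, E, E, E, E, I, E, I, I],
      [[t0001, t0100], [t0100, t0001]],
      [[t0010, t0010], [t1101, t1101]]),
     ([E, E, E, E, E, E, E, E, I, E, E, E, I, I, E, I],
      [[t0001, t0100], [t0001, t0100]],
      [[t0011, t0100], [t1001, t0100]]),
     ([E, E, I, I, E, E, I, E, E, E, E, E, E, I, E, E],
      [[t0000, t0011, t1100], [t0101, t1100, t0011]],
      [[t0011, t0101, t1100], [t1100, t0000, t0011]]),
     ([E, E, I, E, E, E, I, E, E, E, E, I, E, E, E, I],
      [[t0101, t0101], [t0101, t0101]],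
      [[t0110, t0001], [t1100, t0001]]),
     ([E, I, E, E, E, E, I, E, E, E, I, E, E, E, I, I],
      [[t0001, t0111, t1100, t1010], [t0010, t1010, t0001, t1100], [t1100, t1010, t0001, t0111], [t0001, t1100, t0010, t1010]],
      [[t0001, t0111, t1100, t1010], [t0010, t1010, t0001, t1100], [t1100, t1010, t0010, t0001], [t0001, t1100, t1010, t0010]]),
     ([I, I, E, E, E, E, E, I, E, E, E, E, I, E, E, E],
      [[t1010, t1011, t0100]],
      [[t1011, t1111, t0100]]),
     ([E, E, I, I, I, E, E, E, E, E, E, E, E, E, E, I],
      [[t0000, t0001, t1110]],
      [[t0001, t0101, t1110]]),
     ([E, E, I, E, E, E, I, E, E, E, E, E, E, I, I, I],
      [[t0010, t0001, t1100], [t1100, t0010, t0001], [t0001, t1100, t0010]],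
      [[t0010, t0001, t1100], [t1100, t0011, t0101], [t0001, t1100, t0010]]),
     ([E, E, E, E, E, I, E, I, E, E, E, I, E, E, I, I],
      [[t0001, t0110], [t0110, t1011], [t1101, t1101], [t0010, t0010], [t1101, t1101]],
      [[t0010, t0010], [t1101, t1101], [t0110, t0001], [t1011, t0110], [t1101, t1101]]),
     ([I, I, E, E, I, E, E, E, E, E, E, E, E, E, E, I],
      [[t0001, t1110, t1010]],
      [[t0001, t1111, t1110]]),
     ([E, I, E, I, E, E, E, E, I, E, E, I, E, E, E, E],
      [[t0110, t1001], [t1001, t0110], [t0000, t1010]],
      [[t0110, t1001], [t1010, t0000], [t1001, t0110]]),
     ([E, E, E, E, E, E, I, E, E, E, I, I, E, E, I, I],
      [[t0001, t1100, t0001, t0111, t1100], [t0001, t0110, t0001, t1100, t0010]],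
      [[t0001, t1100, t0010, t0001, t1100], [t0001, t0111, t1100, t0001, t0110]]),
     ([E, I, E, E, E, I, E, E, E, E, E, I, E, E, I, I],
      [[t0001, t0110], [t0010, t1010], [t1101, t1101]],
      [[t0010, t0010], [t1010, t1010], [t1101, t1101]]),
     ([E, E, E, E, E, E, I, E, E, E, I, E, E, I, I, I],
      [[t0011, t1100, t0001, t1100], [t1100, t0010, t0001, t0111]],
      [[t0011, t1100, t0011, t1100], [t1100, t0011, t1100, t0011]]),
     ([E, E, E, E, E, E, I, E, I, E, E, I, E, I, E, I],
      [[t0001, t0110], [t0001, t1100]],
      [[t0011, t0110], [t1001, t1100]]),
     ([E, I, E, I, E, E, I, E, E, E, E, E, E, I, E, E],
      [[t0000, t1010], [t0011, t1100], [t1100, t0011]],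
      [[t0011, t1100], [t1010, t0000], [t1100, t0011]]),
     ([E, E, E, E, E, I, I, E, E, E, E, E, E, I, I, I],
      [[t0001, t1100, t0010], [t0010, t0001, t1100], [t1100, t0010, t0001], [t0011, t1100, t0010], [t1100, t0011, t1101]],
      [[t0001, t1100, t0010], [t0010, t0001, t1100], [t1100, t0010, t0011], [t0011, t1101, t1100], [t1100, t0010, t0001]]),
     ([I, E, E, E, E, E, I, E, E, E, E, I, E, E, I, I],
      [[t0001, t0110, t0001, t0110], [t0001, t1100, t0001, t1100], [t0001, t0110, t0001, t0110], [t0001, t1100, t0001, t1100]],
      [[t0001, t0110, t0010, t0010], [t0001, t1111, t1111, t1100], [t0001, t1111, t1100, t0010], [t0001, t1100, t0001, t1100]]),
     ([I, E, E, E, E, I, E, E, E, E, E, I, E, E, I, I],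
      [[t0001, t1101, t1101, t0110], [t0110, t0010, t0001, t1101], [t1101, t1111, t0110, t0001]],
      [[t0001, t1101, t1111, t0110], [t0110, t0001, t1101, t1101], [t1101, t0110, t0010, t0001]]),
     ([E, E, E, I, E, E, I, E, I, E, E, I, E, I, E, E],
      [[t0000, t0000], [t0000, t0000]],
      [[t0011, t0110], [t1001, t1100]]),
     ([E, I, I, E, E, E, I, E, E, E, E, E, E, E, I, I],
      [[t0010, t0001, t0101, t1100], [t1100, t0010, t0001, t0101], [t0001, t1100, t0010, t0010], [t0001, t0101, t1100, t1010]],
      [[t0010, t0001, t0101, t1100], [t1100, t0010, t0010, t0001], [t0001, t1100, t1010, t0010], [t0001, t0101, t1100, t1010]]),
     ([E, I, E, E, E, E, I, E, E, E, E, I, E, I, E, I],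
      [[t0001, t1100, t1010], [t0001, t0110, t1010], [t0011, t1100, t1010], [t1010, t0011, t1100], [t1100, t1010, t0011]],
      [[t0011, t1100, t1010], [t1010, t0001, t1100], [t1010, t0001, t0110], [t1010, t0011, t1100], [t1100, t1010, t0011]]),
     ([E, I, E, I, E, I, E, E, E, E, E, E, E, E, I, E],
      [[t0000], [t0010], [t1101]],
      [[t0010], [t1010], [t1101]]),
     ([E, E, E, I, I, E, I, E, E, E, E, E, E, I, E, I],
      [[t0000, t0001, t1110], [t0000, t0011, t1100], [t0011, t1100, t0000], [t1100, t0000, t0011]],
      [[t0000, t0011, t1100], [t0001, t1110, t0000], [t0011, t1100, t0000], [t1100, t0000, t0011]]),
     ([E, E, E, I, I, I, E, E, E, E, E, E, E, E, I, I],
      [[t0010, t0000, t0001, t1110], [t1110, t0010, t0001, t1101], [t1101, t1110, t0000, t0001], [t0001, t1110, t0010, t0010], [t0001, t1101, t1101, t1110]],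
      [[t0010, t0000, t0001, t1110], [t1110, t0010, t0001, t1101], [t1101, t1110, t0010, t0001], [t0001, t1101, t1110, t0010], [t0000, t0001, t1101, t1110]]),
     ([I, E, I, E, E, E, E, E, I, E, E, I, E, E, E, E],
      [[t1001, t0110], [t0101, t1111], [t0110, t1001]],
      [[t1001, t0110], [t0110, t1001], [t1111, t0101]]),
     ([E, E, E, E, E, E, I, E, I, E, E, I, E, E, I, I],
      [[t0001, t0110], [t0001, t1100]],
      [[t0010, t0010], [t1001, t1100]]),
     ([E, I, E, E, E, E, I, E, E, E, E, I, E, E, I, I],
      [[t0001, t0110, t1010], [t0001, t1100, t1010], [t0010, t0001, t1100], [t1100, t0010, t0001], [t0001, t1100, t0010]],
      [[t0010, t0001, t1100], [t1010, t0001, t0110], [t1010, t0001, t1100], [t1100, t0010, t0001], [t0001, t1100, t0010]]),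
     ([E, E, E, E, E, E, I, I, E, E, E, I, E, E, I, I],
      [[t0001, t0110], [t0001, t1100], [t0010, t0010], [t1011, t1100], [t1100, t0001]],
      [[t0010, t0010], [t1011, t1100], [t1011, t0110], [t1011, t1100], [t1100, t0001]]),
     ([E, E, E, E, E, E, I, I, E, E, E, I, E, I, E, I],
      [[t0001, t0110], [t0011, t1100], [t1100, t0001]],
      [[t0011, t0110], [t1011, t1100], [t1100, t0001]]),
     ([E, E, E, E, E, E, I, I, E, E, I, E, E, E, I, I],
      [[t0001, t0111, t0111, t1100], [t0010, t1011, t1100, t0010], [t1011, t1100, t0001, t1100], [t1100, t0010, t0001, t0111], [t0111, t1100, t0010, t1011], [t1100, t0001, t1100, t1011]],
      [[t0001, t0111, t0111, t1100], [t0010, t1011, t1100, t0010], [t1011, t1100, t0001, t1100], [t1100, t0010, t0010, t0001], [t0111, t1100, t1011, t0111], [t1100, t0001, t1100, t1011]]),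
     ([E, E, E, I, E, I, E, E, E, E, E, I, E, E, I, I],
      [[t0110, t0000, t0001, t1101], [t1101, t0110, t0010, t0001], [t0001, t1101, t1101, t0110]],
      [[t0110, t0010, t0001, t1101], [t1101, t1101, t0110, t0001], [t0000, t0001, t1101, t0110]]),
     ([E, E, I, E, E, I, E, E, E, E, E, I, E, E, E, I],
      [[t0101, t0101], [t0101, t0101]],
      [[t0110, t0001], [t1101, t0101]]),
     ([E, E, E, E, E, I, I, E, E, E, E, I, E, E, I, I],
      [[t0010, t0001, t0110], [t1100, t0001, t1101]],
      [[t0010, t0010, t0010], [t1101, t1101, t1101]]),
     ([I, E, E, E, E, E, I, E, E, E, E, E, E, I, I, I],
      [[t0011, t1111, t1100], [t1111, t1100, t0001], [t1100, t0010, t0011]],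
      [[t0011, t1111, t1100], [t1111, t1100, t0011], [t1100, t0011, t1111]]),
     ([I, E, I, E, E, E, I, E, E, E, E, E, E, E, I, I],
      [[t0010, t0001, t1100], [t1100, t0010, t0001], [t0101, t1111, t0101], [t0001, t1100, t0010]],
      [[t0010, t0001, t1100], [t1111, t0101, t0101], [t1100, t0010, t0001], [t0001, t1100, t0010]]),
     ([I, I, E, E, E, E, I, E, E, E, E, E, E, I, E, E],
      [[t0011, t1100, t1010], [t1100, t0011, t1111]],
      [[t0011, t1111, t1100], [t1100, t1010, t0011]]),
     ([I, I, E, E, E, E, I, E, E, E, E, I, E, E, E, I],
      [[t0001, t1100, t1010], [t0001, t0110, t1010]],
      [[t0001, t1111, t1100], [t0001, t1111, t0110]]),
     ([I, E, I, E, E, I, E, E, E, E, E, E, E, E, I, E],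
      [[t0010], [t1101], [t0101]],
      [[t0010], [t1111], [t1101]]),
     ([I, E, I, E, I, E, E, E, E, E, E, E, E, E, E, I],
      [[t1110, t0001]],
      [[t1111, t0101]])]"

lemma pos_certs_ok:
  "\<forall>(f, X, Y)\<in>set pos_certs. X \<noteq> [] \<and> X \<noteq> Y \<and> length (hd X) > 0 \<and>
     (\<forall>Z\<in>{X, Y}. \<forall>W\<in>{X, Y}. joins (length (hd X)) Z W)"
  by code_simp

lemma pos_certs_flags:
  "\<forall>(f, X, Y)\<in>set pos_certs. \<forall>x\<in>set (concat (X @ Y)). lookup f x = I"
  unfolding pos_certs_def
  by (simp only: list.set ball_simps prod.case concat.simps append.simps lookup_literal simp_thms)

text \<open>Each certificate is thus a union of minimal cycle generators, which is what carries
  positive entropy from a set over to the generators inside it.\<close>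

lemma pos_certs_covered: "\<forall>f\<in>set (map fst pos_certs). cov 5 (cover_table generator_flags) f"
  unfolding cover_table_literal pos_certs_def numeral_eq_Suc pred_numeral_simps BitM.simps
  by (simp only: list.map fst_conv list.set ball_simps eval_simps sub.simps pick.simps mark.simps
      all_done.simps simp_thms)

text \<open>In each set, at most one tile of excess zero belongs to each pair of bottom and left
  colors. With weights 0, 0 every excess is zero, so those sets consist of just four tiles, one for
  each pair of colors.\<close>

definition zero_weights :: "(int \<times> int \<times> tile list) list" where
  "zero_weights =
    [(2, 1, [t0000, t0001, t0010, t0011, t0101, t0110, t0111, t1010, t1011, t1111]),
     (0, 1, [t0001, t0010, t0011, t0111, t1000, t1001, t1011, t1101]),
     (1, 1, [t0000, t0001, t0010, t0011, t0110, t0111, t1001, t1011, t1111]),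
     (0, 1, [t0000, t0001, t0011, t0111, t1001, t1010, t1011, t1101]),
     (0, 1, [t0001, t0010, t0011, t0101, t1001, t1010, t1011, t1101]),
     (0, 1, [t0001, t0010, t0011, t0101, t1000, t1001, t1011, t1101]),
     (0, 0, [t0001, t0110, t1000, t1100]),
     (0, 0, [t0011, t0100, t1000, t1100]),
     (0, 0, [t0011, t0110, t1000, t1100]),
     (0, 0, [t0001, t0111, t1011, t1100]),
     (0, 0, [t0011, t0110, t1001, t1100]),
     (0, 0, [t0010, t0101, t1001, t1100]),
     (0, 0, [t0010, t0111, t1001, t1100]),
     (0, 0, [t0001, t0111, t1000, t1100]),
     (0, 0, [t0011, t0111, t1000, t1100]),
     (0, 0, [t0010, t0100, t1011, t1101]),
     (0, 0, [t0001, t0111, t1010, t1100])]"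

definition zero_weight_flags :: "flag list list" where
  "zero_weight_flags =
    [[I, I, I, I, E, E, E, I, E, E, I, I, E, I, I, I],
     [E, E, E, E, E, I, E, I, I, I, I, E, E, I, I, I],
     [I, E, E, I, E, E, E, I, I, E, I, I, E, I, I, I],
     [E, I, E, I, E, I, E, I, I, E, I, E, E, I, E, I],
     [E, I, I, E, E, I, E, I, I, E, E, E, E, I, I, I],
     [E, E, I, E, E, I, E, I, I, I, E, E, E, I, I, I],
     [E, E, E, E, E, E, I, E, E, I, E, I, E, E, E, I],
     [E, E, E, E, E, E, I, E, E, I, E, E, I, I, E, E],
     [E, E, E, E, E, E, I, E, E, I, E, I, E, I, E, E],
     [E, E, E, E, E, E, I, I, E, E, I, E, E, E, E, I],
     [E, E, E, E, E, E, I, E, I, E, E, I, E, I, E, E],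
     [E, E, I, E, E, E, I, E, I, E, E, E, E, E, I, E],
     [E, E, E, E, E, E, I, E, I, E, I, E, E, E, I, E],
     [E, E, E, E, E, E, I, E, E, I, I, E, E, E, E, I],
     [E, E, E, E, E, E, I, E, E, I, I, E, E, I, E, E],
     [E, E, E, E, E, I, E, I, E, E, E, E, I, E, I, E],
     [E, I, E, E, E, E, I, E, E, E, I, E, E, E, E, I]]"

lemma zero_weight_flags_eq: "map (\<lambda>(\<alpha>, \<beta>, ts). enc (set ts)) zero_weights = zero_weight_flags"
  by code_simp

lemma zero_weights_ok:
  "\<forall>(\<alpha>, \<beta>, ts)\<in>set zero_weights. (\<forall>x\<in>set ts. excess \<alpha> \<beta> x \<ge> 0) \<and>
     distinct (map (\<lambda>x. (bottom_col x, left_col x)) (filter (\<lambda>x. excess \<alpha> \<beta> x = 0) ts))"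
  by code_simp

text \<open>No weights serve this set. The vectors (1, 1), (0, -1) and (-1, 0) of
  \<open>t0011\<close>, \<open>t0100\<close> and \<open>t1000\<close> add up to zero, so nonnegative
  excess forces both weights to be 0; and at each of the four corners of the square two of its tiles
  agree in both colors.\<close>

definition diagonal_flags :: "flag list" where
  "diagonal_flags = [E, E, I, E, E, E, E, E, E, I, E, E, I, I, E, E]"

lemma diagonal_flags_eq: "enc {t0011, t0100, t0101, t1000} = diagonal_flags"
  by (simp add: enc_def tiles_def diagonal_flags_def)

text \<open>Maximal tile sets of zero entropy, each with a symmetric image for which there are weights or
  which is the exceptional set.\<close>

definition zero_pairs :: "(flag list \<times> flag list) list" where
  "zero_pairs =
    [([I, I, I, I, E, E, E, I, E, E, I, I, E, I, I, I],
      [I, I, I, I, E, E, E, I, E, E, I, I, E, I, I, I]),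
     ([E, E, E, E, I, E, E, I, E, E, I, I, I, I, I, I],
      [E, E, E, E, E, I, E, I, I, I, I, E, E, I, I, I]),
     ([I, E, E, I, E, E, E, I, I, E, I, I, E, I, I, I],
      [I, E, E, I, E, E, E, I, I, E, I, I, E, I, I, I]),
     ([I, I, E, E, E, E, E, E, E, E, I, I, I, I, I, I],
      [E, I, E, I, E, I, E, I, I, E, I, E, E, I, E, I]),
     ([I, E, E, I, I, E, E, E, E, E, I, I, E, I, I, I],
      [E, I, I, E, E, I, E, I, I, E, E, E, E, I, I, I]),
     ([I, I, I, I, E, E, E, I, I, E, I, E, E, I, I, I],
      [I, I, I, I, E, E, E, I, E, E, I, I, E, I, I, I]),
     ([E, I, E, E, E, E, E, I, E, E, I, I, I, I, I, I],
      [E, E, I, E, E, I, E, I, I, I, E, E, E, I, I, I]),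
     ([I, E, E, I, E, I, I, I, I, I, E, E, E, I, E, I],
      [I, E, E, I, E, E, E, I, I, E, I, I, E, I, I, I]),
     ([E, I, I, E, E, E, E, I, I, E, I, I, E, I, I, I],
      [I, E, E, I, E, E, E, I, I, E, I, I, E, I, I, I]),
     ([I, E, E, I, E, I, E, I, I, E, E, E, E, I, I, I],
      [E, I, I, E, E, I, E, I, I, E, E, E, E, I, I, I]),
     ([E, I, E, E, I, E, E, E, E, E, I, I, I, I, I, I],
      [E, E, I, E, E, I, E, I, I, I, E, E, E, I, I, I]),
     ([E, I, I, E, E, I, E, I, I, E, E, E, E, I, I, I],
      [E, I, I, E, E, I, E, I, I, E, E, E, E, I, I, I]),
     ([E, E, E, E, E, E, I, E, E, E, E, I, E, E, I, I],
      [E, E, E, E, E, E, I, E, E, I, E, I, E, E, E, I]),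
     ([I, E, E, E, E, E, E, I, E, E, I, I, I, I, I, I],
      [E, E, I, E, E, I, E, I, I, I, E, E, E, I, I, I]),
     ([E, E, E, E, E, E, I, E, E, E, E, E, E, I, I, I],
      [E, E, E, E, E, E, I, E, E, I, E, E, I, I, E, E]),
     ([E, E, I, E, E, E, I, E, E, E, E, E, E, E, I, I],
      [E, E, I, E, E, E, E, E, E, I, E, E, I, I, E, E]),
     ([E, E, E, E, E, E, I, E, E, E, E, I, E, I, E, I],
      [E, E, E, E, E, E, I, E, E, I, E, I, E, I, E, E]),
     ([E, E, E, E, E, E, I, E, E, E, I, E, E, E, I, I],
      [E, E, E, E, E, E, I, I, E, E, I, E, E, E, E, I]),
     ([E, E, E, E, E, E, I, E, I, E, E, I, E, I, E, E],
      [E, E, E, E, E, E, I, E, I, E, E, I, E, I, E, E]),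
     ([E, I, E, E, E, E, I, E, E, E, E, I, E, E, E, I],
      [E, E, I, E, E, E, I, E, I, E, E, E, E, E, I, E]),
     ([E, E, E, E, E, E, I, I, E, E, E, I, E, E, E, I],
      [E, E, E, E, E, E, I, E, I, E, I, E, E, E, I, E]),
     ([E, E, E, E, E, I, E, E, E, E, E, I, E, E, I, I],
      [E, E, E, E, E, E, I, E, E, I, I, E, E, E, E, I]),
     ([E, I, I, E, E, I, I, I, I, I, E, E, E, I, E, I],
      [I, E, E, I, E, E, E, I, I, E, I, I, E, I, I, I]),
     ([E, I, I, E, I, E, E, E, E, E, I, I, E, I, I, I],
      [E, I, I, E, E, I, E, I, I, E, E, E, E, I, I, I]),
     ([E, E, E, E, I, E, I, E, E, E, E, E, E, I, E, I],
      [E, E, E, E, E, E, I, E, E, I, I, E, E, I, E, E]),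
     ([E, E, E, E, I, I, E, E, E, E, E, E, E, E, I, I],
      [E, E, E, E, E, I, E, I, E, E, E, E, I, E, I, E]),
     ([I, E, E, E, E, E, I, E, E, E, E, E, E, E, I, I],
      [E, I, E, E, E, E, I, E, E, E, I, E, E, E, E, I]),
     ([I, E, E, E, I, E, E, E, E, E, I, I, I, I, I, I],
      [E, E, I, E, E, I, E, I, I, I, E, E, E, I, I, I])]"

fun pairs_ok :: "(flag list \<times> flag list) list \<Rightarrow> flag list list \<Rightarrow> bool" where
  "pairs_ok [] gss = True"
| "pairs_ok ((fs, gs) # ps) gss = (if member (rev gs) (images fs) then
     if member gs gss then pairs_ok ps gss else False else False)"

lemma zero_pairs_ok: "pairs_ok zero_pairs (diagonal_flags # zero_weight_flags)"
  unfolding zero_pairs_def zero_weight_flags_def diagonal_flags_def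
  by (simp only: rev.simps append.simps pairs_ok.simps
      eval_simps same.simps images_literal if_True)

text \<open>The binary numerals are 1188 and 33, each one more than the number of sets
  tallied.\<close>

lemma search_eval:
  "search (visit (map fst zero_pairs) (map fst pos_certs) (cover_table generator_flags)) (replicate 16 U) []
     (num.One, num.One, True) = (num.Bit0 (num.Bit0 (num.Bit1 (num.Bit0 (num.Bit0 (num.Bit1 (num.Bit0 (num.Bit1 (num.Bit0 (num.Bit0 num.One))))))))), num.Bit1 (num.Bit0 (num.Bit0 (num.Bit0 (num.Bit0 num.One)))), True)"
  unfolding cover_table_literal zero_pairs_def pos_certs_def numeral_eq_Suc pred_numeral_simps
    replicate.simps BitM.simps
  by (simp only: list.map fst_conv eval_simps sub.simps pick.simps mark.simps
      all_done.simps tally.simps discard.simps inc.simps append.simps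
      canonical_literal images_literal ge.simps)

section \<open>Classification\<close>

lemma positive_weights_conv:
  "(\<forall>x\<in>D. excess \<alpha> \<beta> x > 0) \<longleftrightarrow> (\<forall>x\<in>set tiles. x \<in> D \<longrightarrow> excess \<alpha> \<beta> x > 0)"
  unfolding set_tiles by blast

text \<open>The four lines of weights orthogonal to some nonzero vector (t - b, r - l) cut the plane
  of weights into eight open sectors, on each of which the signs of all excesses are constant. The
  eight weights represent these sectors; each excludes the four tiles with vector zero and the six
  with negative excess.\<close>

lemma positive_weights_iff:
  shows "(\<forall>x\<in>D. excess 2 1 x > 0) \<longleftrightarrow>
      t0000 \<notin> D \<and> t0100 \<notin> D \<and> t0101 \<notin> D \<and> t1000 \<notin> D \<and> t1001 \<notin> D \<and>
      t1010 \<notin> D \<and> t1100 \<notin> D \<and> t1101 \<notin> D \<and> t1110 \<notin> D \<and> t1111 \<notin> D"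
    "(\<forall>x\<in>D. excess 1 2 x > 0) \<longleftrightarrow>
      t0000 \<notin> D \<and> t0100 \<notin> D \<and> t0101 \<notin> D \<and> t0110 \<notin> D \<and> t1000 \<notin> D \<and>
      t1010 \<notin> D \<and> t1100 \<notin> D \<and> t1101 \<notin> D \<and> t1110 \<notin> D \<and> t1111 \<notin> D"
    "(\<forall>x\<in>D. excess (- 1) 2 x > 0) \<longleftrightarrow>
      t0000 \<notin> D \<and> t0010 \<notin> D \<and> t0100 \<notin> D \<and> t0101 \<notin> D \<and> t0110 \<notin> D \<and>
      t0111 \<notin> D \<and> t1010 \<notin> D \<and> t1100 \<notin> D \<and> t1110 \<notin> D \<and> t1111 \<notin> D"
    "(\<forall>x\<in>D. excess (- 2) 1 x > 0) \<longleftrightarrow>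
      t0000 \<notin> D \<and> t0010 \<notin> D \<and> t0011 \<notin> D \<and> t0100 \<notin> D \<and> t0101 \<notin> D \<and>
      t0110 \<notin> D \<and> t0111 \<notin> D \<and> t1010 \<notin> D \<and> t1110 \<notin> D \<and> t1111 \<notin> D"
    "(\<forall>x\<in>D. excess (- 2) (- 1) x > 0) \<longleftrightarrow>
      t0000 \<notin> D \<and> t0001 \<notin> D \<and> t0010 \<notin> D \<and> t0011 \<notin> D \<and> t0101 \<notin> D \<and>
      t0110 \<notin> D \<and> t0111 \<notin> D \<and> t1010 \<notin> D \<and> t1011 \<notin> D \<and> t1111 \<notin> D"
    "(\<forall>x\<in>D. excess (- 1) (- 2) x > 0) \<longleftrightarrow>
      t0000 \<notin> D \<and> t0001 \<notin> D \<and> t0010 \<notin> D \<and> t0011 \<notin> D \<and> t0101 \<notin> D \<and>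
      t0111 \<notin> D \<and> t1001 \<notin> D \<and> t1010 \<notin> D \<and> t1011 \<notin> D \<and> t1111 \<notin> D"
    "(\<forall>x\<in>D. excess 1 (- 2) x > 0) \<longleftrightarrow>
      t0000 \<notin> D \<and> t0001 \<notin> D \<and> t0011 \<notin> D \<and> t0101 \<notin> D \<and> t1000 \<notin> D \<and>
      t1001 \<notin> D \<and> t1010 \<notin> D \<and> t1011 \<notin> D \<and> t1101 \<notin> D \<and> t1111 \<notin> D"
    "(\<forall>x\<in>D. excess 2 (- 1) x > 0) \<longleftrightarrow>
      t0000 \<notin> D \<and> t0001 \<notin> D \<and> t0101 \<notin> D \<and> t1000 \<notin> D \<and> t1001 \<notin> D \<and>
      t1010 \<notin> D \<and> t1011 \<notin> D \<and> t1100 \<notin> D \<and> t1101 \<notin> D \<and> t1111 \<notin> D"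
  unfolding positive_weights_conv tiles_def by (simp_all add: excess_def conj_ac)

text \<open>Gordan's alternative in the plane: if zero is not in the convex hull of the vectors,
  some linear form is positive on all of them, and it may be moved into one of the eight open
  sectors. Over sixteen tiles this is a propositional tautology about membership in
  \<open>D\<close>.\<close>

lemma generator_or_positive_weights:
  assumes "\<forall>C\<in>set generators. \<not> C \<subseteq> D"
  shows "\<exists>\<alpha> \<beta>. \<forall>x\<in>D. excess \<alpha> \<beta> x > 0"
proof -
  have "(\<forall>x\<in>D. excess 2 1 x > 0) \<or> (\<forall>x\<in>D. excess 1 2 x > 0) \<or>
    (\<forall>x\<in>D. excess (- 1) 2 x > 0) \<or> (\<forall>x\<in>D. excess (- 2) 1 x > 0) \<or>
    (\<forall>x\<in>D. excess (- 2) (- 1) x > 0) \<or> (\<forall>x\<in>D. excess (- 1) (- 2) x > 0) \<or>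
    (\<forall>x\<in>D. excess 1 (- 2) x > 0) \<or> (\<forall>x\<in>D. excess 2 (- 1) x > 0)"
    using assms unfolding generators_def cycle_blocks_def positive_weights_iff
    by (simp only: list.map list.set ball_simps concat.simps append.simps insert_subset
        empty_subsetI simp_thms) argo
  then show ?thesis by blast
qed

lemma min_cycle_gen_iff_generator: "min_cycle_gen C \<longleftrightarrow> C \<in> set generators"
proof (rule min_cycle_gen_iff)
  fix C assume "C \<in> set generators"
  then obtain X where X: "X \<in> set cycle_blocks" "C = set (concat X)" by (auto simp: generators_def)
  then show "periodic_patterns C \<noteq> {}"
    using cycle_blocks_ok by (intro periodic_patterns_block[of "length (hd X)" X]) auto
next
  fix D assume "periodic_patterns D \<noteq> {}"
  then have "\<not> (\<exists>\<alpha> \<beta>. \<forall>x\<in>D. excess \<alpha> \<beta> x > 0)" using no_periodic_pattern[of D] by metis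
  then show "\<exists>C\<in>set generators. C \<subseteq> D" using generator_or_positive_weights[of D] by metis
next
  fix C D assume "C \<in> set generators" "D \<in> set generators" "C \<subseteq> D"
  moreover have "enc C \<in> set generator_flags" if "C \<in> set generators" for C
    using that unfolding generator_flags_eq[symmetric] by simp
  ultimately have "enc C = enc D" using generators_antichain by (simp add: sub_enc)
  then show "C = D" using inj_enc by (simp add: inj_eq)
qed

lemma min_cycle_gen_symmetry:
  assumes "min_cycle_gen C" "s \<in> set symmetries"
  shows "min_cycle_gen (s -` C)"
proof -
  have "enc C \<in> set generator_flags"
    using assms(1) unfolding generator_flags_eq[symmetric] min_cycle_gen_iff_generator by simp
  from closed_under_imagesD[OF generators_symmetric this]
  have "rev (enc (s -` C)) \<in> set (map rev generator_flags)"
    unfolding set_images_enc using assms(2) by blast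
  then have "enc (s -` C) \<in> enc ` set generators"
    unfolding generator_flags_eq[symmetric] by auto
  then show ?thesis unfolding min_cycle_gen_iff_generator by (simp add: inj_image_mem_iff[OF inj_enc])
qed

lemma unions_upto_5_symmetry:
  assumes "s \<in> set symmetries" "A \<in> unions_upto_5"
  shows "s -` A \<in> unions_upto_5"
proof -
  obtain S where S: "finite S" "S \<noteq> {}" "card S \<le> 5" "\<forall>C\<in>S. min_cycle_gen C" "A = \<Union>S"
    using assms(2) unfolding unions_upto_5_iff by blast
  have "card ((\<lambda>C. s -` C) ` S) \<le> 5" using card_image_le[OF S(1)] S(3) by (rule order.trans)
  then show ?thesis
    unfolding unions_upto_5_iff using S min_cycle_gen_symmetry[OF _ assms(1)]
    by (intro exI[of _ "(\<lambda>C. s -` C) ` S"]) auto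
qed

lemma flags_encoded:
  "\<forall>f\<in>set (map fst pos_certs). length f = 16 \<and> U \<notin> set f"
  "\<forall>f\<in>set (map fst zero_pairs). length f = 16 \<and> U \<notin> set f"
  unfolding pos_certs_def zero_pairs_def by simp_all

text \<open>The conclusion concerns generators inside \<open>A\<close> and not merely
  \<open>A\<close> itself; in this form it can be pulled back by a symmetry and compared with a
  given union of generators.\<close>

lemma entropy_pos_if_cert:
  assumes "any_sub (map fst pos_certs) (enc A)"
  obtains S where "\<forall>C\<in>S. min_cycle_gen C" "\<Union>S \<subseteq> A" "entropy (\<Union>S) > 0"
proof -
  obtain f X Y where c: "(f, X, Y) \<in> set pos_certs" "sub f (enc A)"
    using assms unfolding any_sub_def by auto
  then have f: "f \<in> set (map fst pos_certs)" by force
  then have "f \<in> range enc" using flags_encoded(1) unfolding range_enc by auto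
  then obtain P where P: "f = enc P" by blast
  have "\<forall>x\<in>set (concat (X @ Y)). x \<in> P"
    using pos_certs_flags c(1) unfolding P by (fastforce simp: lookup_enc split: if_splits)
  then have sub: "set (concat X) \<subseteq> P" "set (concat Y) \<subseteq> P" by auto
  have ok: "X \<noteq> []" "X \<noteq> Y" "length (hd X) > 0" "\<forall>Z\<in>{X, Y}. \<forall>W\<in>{X, Y}. joins (length (hd X)) Z W"
    using pos_certs_ok c(1) by fastforce+
  have pos: "entropy P > 0"
    by (rule entropy_pos_if_blocks[OF ok(3,1,2) _ _ _ _ sub]) (use ok(4) in blast)+
  have "cov 5 (cover_table (map enc generators)) (enc P)"
    using pos_certs_covered f unfolding generator_flags_eq P by blast
  then obtain S where S: "S \<subseteq> set generators" "P = \<Union>S" unfolding cov_enc_iff by blast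
  have "P \<subseteq> A" using c(2) by (simp only: P sub_enc)
  then show thesis
    using that[of S] pos S by (auto simp only: min_cycle_gen_iff_generator)
qed

lemma pairs_okD:
  "pairs_ok ps gss \<Longrightarrow> (f, g) \<in> set ps \<Longrightarrow> rev g \<in> set (images f) \<and> g \<in> set gss"
  by (induction ps gss rule: pairs_ok.induct) (auto dest: member_imp_in_set split: if_splits)

lemma entropy_zero_if_cert:
  assumes "any_sup (map fst zero_pairs) (enc A)"
  shows "entropy A = 0"
proof -
  obtain f g where c: "(f, g) \<in> set zero_pairs" "sub (enc A) f"
    using assms unfolding any_sup_def by auto
  then have "f \<in> set (map fst zero_pairs)" by force
  then have "f \<in> range enc" using flags_encoded(2) unfolding range_enc by auto
  then obtain Z where Z: "f = enc Z" by blast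
  have g: "rev g \<in> set (images f)" "g \<in> set (diagonal_flags # zero_weight_flags)"
    using pairs_okD[OF zero_pairs_ok c(1)] by auto
  obtain s where s: "s \<in> set symmetries" "g = enc (s -` Z)"
    using g(1) unfolding Z set_images_enc by auto
  have "entropy (s -` Z) = 0"
  proof (cases "g = diagonal_flags")
    case True
    then have "s -` Z = {t0011, t0100, t0101, t1000}"
      using s(2) injD[OF inj_enc] by (simp only: diagonal_flags_eq[symmetric])
    then show ?thesis by (intro entropy_zero_diagonal) simp
  next
    case False
    then have "g \<in> set zero_weight_flags" using g(2) by simp
    then obtain \<alpha> \<beta> ts where ts: "(\<alpha>, \<beta>, ts) \<in> set zero_weights" "g = enc (set ts)"
      unfolding zero_weight_flags_eq[symmetric] by auto
    then have "s -` Z = set ts" using s(2) inj_enc by (simp add: inj_eq)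
    moreover have "entropy (set ts) = 0"
    proof (rule entropy_zero_if_weights[of _ \<alpha> \<beta>])
      have ok: "\<forall>x\<in>set ts. excess \<alpha> \<beta> x \<ge> 0"
        "distinct (map (\<lambda>x. (bottom_col x, left_col x)) (filter (\<lambda>x. excess \<alpha> \<beta> x = 0) ts))"
        using zero_weights_ok ts(1) by fastforce+
      show "excess \<alpha> \<beta> x \<ge> 0" if "x \<in> set ts" for x using ok(1) that by blast
      show "x = y" if "x \<in> set ts" "y \<in> set ts" "excess \<alpha> \<beta> x = 0" "excess \<alpha> \<beta> y = 0"
        "bottom_col x = bottom_col y" "left_col x = left_col y" for x y
        using inj_onD[OF conjunct2[OF iffD1[OF distinct_map ok(2)]], of x y] that by simp
    qed
    ultimately show ?thesis by simp
  qed
  then have "entropy Z = 0" using entropy_symmetry[OF s(1)] by simp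
  moreover have "A \<subseteq> Z" using c(2) by (simp add: Z sub_enc)
  ultimately show ?thesis using entropy_mono[of A Z] entropy_nonneg[of A] by simp
qed

lemma canonical_classification:
  shows "canonical (enc A) \<Longrightarrow>
      any_sup (map fst zero_pairs) (enc A) \<or> any_sub (map fst pos_certs) (enc A)"
    and "card {A. canonical (enc A) \<and> cov 5 (cover_table (map enc generators)) (enc A) \<and>
      \<not> any_sup (map fst zero_pairs) (enc A)} = 1187"
    and "card {A. canonical (enc A) \<and> cov 5 (cover_table (map enc generators)) (enc A) \<and>
      any_sup (map fst zero_pairs) (enc A)} = 32"
proof -
  note fold = fold_visit[OF search_eval[unfolded search_eq_fold]]
  have "enc A \<in> set (leaves (replicate 16 U) [])" if "canonical (enc A)" for A
    using that unfolding set_leaves_all by blast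
  then show "canonical (enc A) \<Longrightarrow>
      any_sup (map fst zero_pairs) (enc A) \<or> any_sub (map fst pos_certs) (enc A)"
    using fold(1) by blast
  show "card {A. canonical (enc A) \<and> cov 5 (cover_table (map enc generators)) (enc A) \<and>
      \<not> any_sup (map fst zero_pairs) (enc A)} = 1187"
    using fold(2) unfolding length_filter_leaves generator_flags_eq nat_of_num_numeral by simp
  show "card {A. canonical (enc A) \<and> cov 5 (cover_table (map enc generators)) (enc A) \<and>
      any_sup (map fst zero_pairs) (enc A)} = 32"
    using fold(3) unfolding length_filter_leaves generator_flags_eq nat_of_num_numeral by simp
qed

text \<open>By monotonicity of the entropy the two kinds of certificates exclude each other, so
  among canonical sets the first test of \<open>visit\<close> decides exactly whether the entropy
  vanishes.\<close>

lemma any_sup_zero_iff: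
  assumes "canonical (enc A)"
  shows "any_sup (map fst zero_pairs) (enc A) \<longleftrightarrow> entropy A = 0"
proof
  assume zero: "entropy A = 0"
  show "any_sup (map fst zero_pairs) (enc A)"
  proof (rule ccontr)
    assume "\<not> any_sup (map fst zero_pairs) (enc A)"
    then have "any_sub (map fst pos_certs) (enc A)" using canonical_classification(1)[OF assms] by blast
    then obtain S where "\<Union>S \<subseteq> A" "entropy (\<Union>S) > 0" by (rule entropy_pos_if_cert)
    then show False using entropy_mono[of "\<Union>S" A] zero by simp
  qed
qed (rule entropy_zero_if_cert)

lemma cov_iff_union:
  "cov 5 (cover_table (map enc generators)) (enc A) \<longleftrightarrow> A = {} \<or> A \<in> unions_upto_5"
proof -
  have fin: "finite S" if "S \<subseteq> set generators" for S using that finite_subset by blast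
  show ?thesis
  proof
    assume "cov 5 (cover_table (map enc generators)) (enc A)"
    then obtain S where S: "S \<subseteq> set generators" "card S \<le> 5" "A = \<Union>S" unfolding cov_enc_iff by blast
    then show "A = {} \<or> A \<in> unions_upto_5"
      unfolding unions_upto_5_iff min_cycle_gen_iff_generator using fin[OF S(1)]
      by (cases "S = {}") auto
  next
    assume "A = {} \<or> A \<in> unions_upto_5"
    then show "cov 5 (cover_table (map enc generators)) (enc A)"
    proof
      assume "A = {}"
      then show ?thesis unfolding cov_enc_iff by (intro exI[of _ "{}"]) simp
    next
      assume "A \<in> unions_upto_5"
      then obtain S where "card S \<le> 5" "\<forall>C\<in>S. C \<in> set generators" "A = \<Union>S"
        unfolding unions_upto_5_iff min_cycle_gen_iff_generator by blast
      then show ?thesis unfolding cov_enc_iff by (intro exI[of _ S] conjI subsetI) auto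
    qed
  qed
qed

lemma entropy_empty: "entropy {} = 0"
  by (rule entropy_zero_if_weights[of _ 0 0]) auto

lemma empty_not_union: "{} \<notin> unions_upto_5"
proof
  assume "{} \<in> unions_upto_5"
  then obtain S where "S \<noteq> {}" "\<forall>C\<in>S. min_cycle_gen C" "{} = \<Union>S"
    unfolding unions_upto_5_iff by blast
  then have "min_cycle_gen {}" by auto
  then show False unfolding min_cycle_gen_def periodic_patterns_def by simp
qed

text \<open>The canonical image of \<open>B\<close> has a positive certificate made of generators.
  Pulled back by the inverse symmetry, these are generators contained in \<open>B\<close>, hence in
  \<open>A\<close>, and they already have positive entropy.\<close>

lemma entropy_pos_iff_cycles:
  assumes gens: "\<And>D. min_cycle_gen D \<Longrightarrow> D \<subseteq> B \<Longrightarrow> D \<subseteq> A" and "A \<subseteq> B"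
  shows "entropy B > 0 \<longleftrightarrow> entropy A > 0"
proof
  assume pos: "entropy B > 0"
  obtain s where s: "s \<in> set symmetries" "canonical (enc (s -` B))" using canonical_exists by blast
  have "\<not> any_sup (map fst zero_pairs) (enc (s -` B))"
    using pos entropy_zero_if_cert entropy_symmetry[OF s(1), of B] by fastforce
  then have "any_sub (map fst pos_certs) (enc (s -` B))" using canonical_classification(1)[OF s(2)] by blast
  then obtain S where S: "\<forall>C\<in>S. min_cycle_gen C" "\<Union>S \<subseteq> s -` B" "entropy (\<Union>S) > 0"
    by (rule entropy_pos_if_cert)
  obtain t where t: "t \<in> set symmetries" "s \<circ> t = id" using symmetry_inverse[OF s(1)] .
  have "t -` C \<subseteq> A" if "C \<in> S" for C
  proof (rule gens)
    show "min_cycle_gen (t -` C)" using min_cycle_gen_symmetry S(1) that t(1) by blast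
    have "t -` C \<subseteq> t -` (s -` B)" using S(2) that by blast
    then show "t -` C \<subseteq> B" using t(2) by (simp add: vimage_comp)
  qed
  then have "t -` \<Union>S \<subseteq> A" by blast
  then show "entropy A > 0"
    using entropy_mono[of "t -` \<Union>S" A] entropy_symmetry[OF t(1), of "\<Union>S"] S(3) by simp
qed (use entropy_mono[OF assms(2)] in simp)

lemma card_positive_classes:
  "card {equiv_class A | A. A \<in> unions_upto_5 \<and> entropy A > 0} = 1187"
proof -
  have "card {equiv_class A | A. A \<in> unions_upto_5 \<and> entropy A > 0} =
      card {A. (A \<in> unions_upto_5 \<and> entropy A > 0) \<and> canonical (enc A)}"
    by (rule card_equiv_classes) (simp add: unions_upto_5_symmetry entropy_symmetry)
  also have "{A. (A \<in> unions_upto_5 \<and> entropy A > 0) \<and> canonical (enc A)} =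
      {A. canonical (enc A) \<and> cov 5 (cover_table (map enc generators)) (enc A) \<and>
        \<not> any_sup (map fst zero_pairs) (enc A)}"
    using entropy_empty by (auto simp: cov_iff_union any_sup_zero_iff entropy_pos_iff)
  also have "card \<dots> = 1187" by (rule canonical_classification(2))
  finally show ?thesis .
qed

lemma card_zero_classes:
  "card {equiv_class A | A. A \<in> unions_upto_5 \<and> entropy A = 0} = 31"
proof -
  let ?Z = "{A. (A \<in> unions_upto_5 \<and> entropy A = 0) \<and> canonical (enc A)}"
  \<comment> \<open>The empty set is covered by the empty family of generators and has been tallied,
    although it is not a union of k \<ge> 1 generators. This is the difference between 32 and
    31.\<close>
  have "canonical (enc {})"
    unfolding canonical_enc_iff by (auto simp: enc_def tiles_def)
  then have "{A. canonical (enc A) \<and> cov 5 (cover_table (map enc generators)) (enc A) \<and>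
      any_sup (map fst zero_pairs) (enc A)} = insert {} ?Z"
    using entropy_empty by (auto simp: cov_iff_union any_sup_zero_iff)
  then have "card (insert {} ?Z) = 32" using canonical_classification(3) by simp
  then have "card ?Z = 31" using empty_not_union by simp
  moreover have "card {equiv_class A | A. A \<in> unions_upto_5 \<and> entropy A = 0} = card ?Z"
    by (rule card_equiv_classes) (simp add: unions_upto_5_symmetry entropy_symmetry)
  ultimately show ?thesis by simp
qed

theorem theorem1p1:
  shows "(\<forall>(B :: tile set) (N :: tile set) (k :: nat) (C :: nat \<Rightarrow> tile set).
            different_min_cycle_gens k C \<and>
            B = (\<Union>i\<in>{1..k}. C i) \<union> N \<and>
            (\<forall>D. min_cycle_gen D \<and> D \<subseteq> B \<longrightarrow> D \<subseteq> (\<Union>i\<in>{1..k}. C i)) \<longrightarrow>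
            (entropy B > 0 \<longleftrightarrow> entropy (\<Union>i\<in>{1..k}. C i) > 0))
       \<and> card {equiv_class A | A. A \<in> unions_upto_5 \<and> entropy A > 0} = 1187
       \<and> card {equiv_class A | A. A \<in> unions_upto_5 \<and> entropy A = 0} = 31"
proof (intro conjI allI impI)
  fix B N k C
  assume "different_min_cycle_gens k C \<and> B = (\<Union>i\<in>{1..k}. C i) \<union> N \<and>
    (\<forall>D. min_cycle_gen D \<and> D \<subseteq> B \<longrightarrow> D \<subseteq> (\<Union>i\<in>{1..k}. C i))"
  then show "entropy B > 0 \<longleftrightarrow> entropy (\<Union>i\<in>{1..k}. C i) > 0"
    by (intro entropy_pos_iff_cycles) blast+
qed (rule card_positive_classes card_zero_classes)+

end
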